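(* Let $d\geq 2$ and let $\boldsymbol{X}=(X_1,X_2,\ldots,X_n)$, in which $X_1,X_2,\ldots,X_n\in L^d(\Omega,\mathcal{F},\mathbf{P})$ are nondegenerate independent and identically distributed random variables. (a) $$|\!|\!|A|\!|\!|_{\boldsymbol{X},d}=\left(\frac{\mathbf{E}\,|\langle \boldsymbol{X},\boldsymbol{\lambda}\rangle|^d}{\Gamma(d+1)}\right)^{1/d}$$ is a norm on $\mathrm{H}_n$, where $\boldsymbol{\lambda}=\boldsymbol{\lambda}(A)=(\lambda_1,\ldots,\lambda_n)$ is the vector of eigenvalues of $A\in\mathrm{H}_n$. (b) If the $X_i$ admit a moment generating function $M(t)$ and $d\geq 2$ is even, then $$|\!|\!|A|\!|\!|_{\boldsymbol{X},d}^d=[t^d]M_\Lambda(t)\quad\text{for all } A\in \mathrm{H}_n,$$ in which $M_\Lambda(t)=\prod_{i=1}^n M(\lambda_i t)$ is the moment generating function for the random variable $\Lambda=\langle \boldsymbol{X},\boldsymbol{\lambda}(A)\rangle=\lambda_1X_1+\lambda_2X_2+\cdots+\lambda_nX_n$. In particular, $|\!|\!|A|\!|\!|_{\boldsymbol{X},d}^d$ is a positive definite, homogeneous, symmetric polynomial in the eigenvalues of $A$. (c) If the first $d$ moments of $X_i$ exist, then for $A\in \mathrm{H}_n$ $$|\!|\!|A|\!|\!|_{\boldsymbol{X},d}^d=\frac{1}{d!}B_d\big(\kappa_1\operatorname{tr}A,\kappa_2\operatorname{tr}A^2,\ldots,\kappa_d\operatorname{tr}A^d\big)=\sum_{\boldsymbol{\pi}\vdash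 d}\frac{\kappa_{\boldsymbol{\pi}}\,p_{\boldsymbol{\pi}}(\boldsymbol{\lambda})}{y_{\boldsymbol{\pi}}},$$ in which $B_d$ is the complete Bell polynomial of degree $d$ and the sum runs over all partitions $\boldsymbol{\pi}$ of $d$. (d) The function $\boldsymbol{\lambda}(A)\mapsto |\!|\!|A|\!|\!|_{\boldsymbol{X},d}$ is Schur convex. (e) Let $\boldsymbol{\pi}=(\pi_1,\pi_2,\ldots,\pi_r)$ be a partition of $d$. Define $\mathrm{T}_{\boldsymbol{\pi}}:\mathrm{M}_n\to\mathbb{R}$ by setting $\mathrm{T}_{\boldsymbol{\pi}}(Z)$ to be $1/\binom{d}{d/2}$ times the sum over the $\binom{d}{d/2}$ possible locations to place $d/2$ adjoints ${}^*$ among the $d$ copies of $Z$ in $$(\operatorname{tr}\underbrace{ZZ\cdots Z}_{\pi_1})(\operatorname{tr}\underbrace{ZZ\cdots Z}_{\pi_2})\cdots(\operatorname{tr}\underbrace{ZZ\cdots Z}_{\pi_r}).$$ Then $$|\!|\!|Z|\!|\!|_{\boldsymbol{X},d}=\left(\sum_{\boldsymbol{\pi}\vdash d}\frac{\kappa_{\boldsymbol{\pi}}\mathrm{T}_{\boldsymbol{\pi}}(Z)}{y_{\boldsymbol{\pi}}}\right)^{1/d}\quad\text{for } Z\in \mathrm{M}_n,$$ in which the sum runs over all partitions $\boldsymbol{\pi}$ of $d$, is a norm on $\mathrm{M}_n$ that restricts to the norm on $\mathrm{H}_n$ above. In particular, $|\!|\!|Z|\!|\!|_{\boldsymbol{X},d}^d$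 is a positive definite trace polynomial in $Z$ and $Z^*$.
   Context: $\mathbb{N}=\{1,2,\ldots\}$ and $n\in\mathbb{N}$. $\mathrm{M}_n$ is the set of $n\times n$ complex matrices and $\mathrm{H}_n\subset \mathrm{M}_n$ the subset of Hermitian matrices ($A=A^*$), regarded as a real vector space. For $A\in \mathrm{H}_n$, $\lambda_1(A)\geq\cdots\geq\lambda_n(A)$ are its eigenvalues, also written $\lambda_1,\ldots,\lambda_n$, and $\boldsymbol{\lambda}(A)=(\lambda_1(A),\ldots,\lambda_n(A))$. $\langle\cdot,\cdot\rangle$ is the Euclidean inner product on $\mathbb{R}^n$ and $\Gamma$ is the gamma function. $(\Omega,\mathcal{F},\mathbf{P})$ is a probability space with $\Omega\subseteq\mathbb{R}$; $\mathbf{E}$ is expectation; random variables are real-valued; $L^d(\Omega,\mathcal{F},\mathbf{P})$ is the space of random variables $X$ with $\mathbf{E}|X|^d<\infty$. Nondegenerate means not almost surely constant. $\mu_k=\mathbf{E}[X_i^k]$ is the $k$th moment (with $\mu_0=1$). The moment generating function of $X_i$, if it exists, is $M(t)=\mathbf{E}[e^{tX_i}]=\sum_{k\ge 0}\mu_k t^k/k!$. $[t^k]f(t)$ denotes the coefficient of $t^k$ in the power series $f(t)$. Cumulants: if the $X_i$ admit a moment generating function $M(t)$, the cumulants $\kappa_r$ are defined by $\log M(t)=\sum_{r\ge1}\kappa_r t^r/r!$. If they do not, but $X_i\in L^d(\Omega,\mathcal{F},\mathbf{P})$ with $d\in\mathbb{N}$, then $\kappa_1,\ldots,\kappa_d$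 are defined by the recursion $\mu_r=\sum_{\ell=0}^{r-1}\binom{r-1}{\ell}\mu_\ell\kappa_{r-\ell}$ for $1\le r\le d$. The complete Bell polynomials $B_\ell(x_1,\ldots,x_\ell)$ are defined by $\sum_{\ell=0}^\infty B_\ell(x_1,\ldots,x_\ell)\frac{t^\ell}{\ell!}=\exp\big(\sum_{j=1}^\infty x_j\frac{t^j}{j!}\big)$. A partition of $d\in\mathbb{N}$, written $\boldsymbol{\pi}\vdash d$, is a tuple $\boldsymbol{\pi}=(\pi_1,\ldots,\pi_r)\in\mathbb{N}^r$ with $\pi_1\geq\cdots\geq\pi_r$ and $\pi_1+\cdots+\pi_r=d$. Put $\kappa_{\boldsymbol{\pi}}=\kappa_{\pi_1}\cdots\kappa_{\pi_r}$ and $y_{\boldsymbol{\pi}}=\prod_{i\geq1}(i!)^{m_i}m_i!$, where $m_i$ is the multiplicity of $i$ in $\boldsymbol{\pi}$. With $p_k(x_1,\ldots,x_n)=x_1^k+\cdots+x_n^k$, put $p_{\boldsymbol{\pi}}=p_{\pi_1}\cdots p_{\pi_r}$, so that $p_{\boldsymbol{\pi}}(\boldsymbol{\lambda}(A))=(\operatorname{tr}A^{\pi_1})\cdots(\operatorname{tr}A^{\pi_r})$. Majorization: for $\boldsymbol{x}\in\mathbb{R}^n$ let $\widetilde{\boldsymbol{x}}$ be its nonincreasing rearrangement; $\boldsymbol{x}\prec\boldsymbol{y}$ ($\boldsymbol{y}$ majorizes $\boldsymbol{x}$) means $\sum_{i=1}^n\widetilde{x}_i=\sum_{i=1}^n\widetilde{y}_i$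 and $\sum_{i=1}^k\widetilde{x}_i\le\sum_{i=1}^k\widetilde{y}_i$ for $1\le k\le n$. A function $f$ is Schur convex if $f(\boldsymbol{x})\le f(\boldsymbol{y})$ whenever $\boldsymbol{x}\prec\boldsymbol{y}$. A continuous real-valued function is positive definite if it is everywhere positive, except perhaps at $0$. A function is symmetric if it is invariant under all permutations of its arguments. A trace polynomial in $Z$ and $Z^*$ is a polynomial expression in the traces of words in $Z$ and $Z^*$. More formally, $\mathrm{T}_{\boldsymbol{\pi}}(Z)=\binom{d}{d/2}^{-1}\sum \operatorname{tr}w_1(Z)\cdots\operatorname{tr}w_r(Z)$, the sum over all tuples $(w_1,\ldots,w_r)$ of words in the free monoid on $x,x^*$ such that $w_j$ has length $\pi_j$ for each $j$ and the letter $x$ occurs exactly $d/2$ times in the concatenation $w_1\cdots w_r$; $w(Z)$ is the evaluation $x\mapsto Z$, $x^*\mapsto Z^*$.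
   Formalization: Part (c) is stated for even d only: for odd d its left side is unchanged under A to -A and positive for A nonzero, while its right side changes sign, so (c) fails. Part (e) is likewise for even d, as d/2 adjoints require. *)

theory Defs
  imports
    "HOL-Probability.Probability"
    "HOL-Library.Multiset"
    "HOL-Library.Poly_Mapping"
    "HOL-Combinatorics.Permutations"
    "HOL-Computational_Algebra.Formal_Power_Series"
    "Jordan_Normal_Form.Char_Poly"
    "Jordan_Normal_Form.Schur_Decomposition"
begin

unbundle no vec_syntax
unbundle no fps_syntax

text \<open>\<open>M\<^sub>n\<close> is \<^term>\<open>carrier_mat n n\<close>. Indices of vectors and matrices start at 0.\<close>

definition hermitian_mats :: "nat \<Rightarrow> complex mat set" where
  "hermitian_mats n = {A \<in> carrier_mat n n. mat_adjoint A = A}"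

definition mat_trace :: "'a::comm_monoid_add mat \<Rightarrow> 'a" where
  "mat_trace A = (\<Sum>i<dim_row A. A $$ (i, i))"

text \<open>The eigenvalues with multiplicity in nonincreasing order. This is meant for Hermitian
  matrices, whose eigenvalues are real, so that taking real parts only changes the type.\<close>

definition eigvals :: "complex mat \<Rightarrow> real Matrix.vec" where
  "eigvals A =
     vec_of_list (rev (sorted_list_of_multiset (image_mset Re (proots (char_poly A)))))"

text \<open>\<open>N\<close> is a norm on the set \<open>V\<close> of \<open>n \<times> n\<close> matrices, with \<open>K\<close> as field of scalars
  (\<open>K\<close> is \<open>\<real>\<close> for the Hermitian matrices and \<open>UNIV\<close> for all matrices).\<close>

definition is_norm_on :: "nat \<Rightarrow> complex set \<Rightarrow> complex mat set \<Rightarrow> (complex mat \<Rightarrow> real) \<Rightarrow> bool" where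
  "is_norm_on n K V N \<longleftrightarrow>
     (\<forall>A\<in>V. 0 \<le> N A) \<and>
     (\<forall>A\<in>V. N A = 0 \<longleftrightarrow> A = 0\<^sub>m n n) \<and>
     (\<forall>c\<in>K. \<forall>A\<in>V. N (c \<cdot>\<^sub>m A) = cmod c * N A) \<and>
     (\<forall>A\<in>V. \<forall>B\<in>V. N (A + B) \<le> N A + N B)"

definition Lp_rv :: "'a measure \<Rightarrow> real \<Rightarrow> ('a \<Rightarrow> real) set" where
  "Lp_rv P d = {Y \<in> borel_measurable P. integrable P (\<lambda>\<omega>. \<bar>Y \<omega>\<bar> powr d)}"

definition nondegenerate :: "'a measure \<Rightarrow> ('a \<Rightarrow> real) \<Rightarrow> bool" where
  "nondegenerate P Y \<longleftrightarrow> \<not> (\<exists>c. AE \<omega> in P. Y \<omega> = c)"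

definition moment :: "'a measure \<Rightarrow> ('a \<Rightarrow> real) \<Rightarrow> nat \<Rightarrow> real" where
  "moment P Y k = (\<integral>\<omega>. Y \<omega> ^ k \<partial>P)"

definition mgf :: "'a measure \<Rightarrow> ('a \<Rightarrow> real) \<Rightarrow> real \<Rightarrow> real" where
  "mgf P Y t = (\<integral>\<omega>. exp (t * Y \<omega>) \<partial>P)"

definition admits_mgf :: "'a measure \<Rightarrow> ('a \<Rightarrow> real) \<Rightarrow> bool" where
  "admits_mgf P Y \<longleftrightarrow> (\<exists>\<epsilon>>0. \<forall>t. \<bar>t\<bar> < \<epsilon> \<longrightarrow> integrable P (\<lambda>\<omega>. exp (t * Y \<omega>)))"

text \<open>The recursion \<open>\<mu>\<^sub>r = (\<Sum>l<r. (r-1 choose l) \<mu>\<^sub>l \<kappa>\<^sub>r\<^sub>-\<^sub>l)\<close> for \<open>r \<ge> 1\<close>, solved for \<open>\<kappa>\<^sub>r\<close>,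
  which occurs in the summand \<open>l = 0\<close> with coefficient \<open>\<mu>\<^sub>0 = 1\<close>.\<close>

fun recursive_cumulant :: "(nat \<Rightarrow> real) \<Rightarrow> nat \<Rightarrow> real" where
  "recursive_cumulant \<mu> r =
     \<mu> r - (\<Sum>l\<in>{1..<r}. of_nat ((r - 1) choose l) * \<mu> l * recursive_cumulant \<mu> (r - l))"

declare recursive_cumulant.simps [simp del]

lemma recursive_cumulant_recursion:
  assumes "\<mu> 0 = 1" and "1 \<le> r"
  shows "\<mu> r = (\<Sum>l=0..r - 1. of_nat ((r - 1) choose l) * \<mu> l * recursive_cumulant \<mu> (r - l))"
proof -
  let ?g = "\<lambda>l. of_nat ((r - 1) choose l) * \<mu> l * recursive_cumulant \<mu> (r - l)"
  have "{0..r - 1} = insert 0 {1..<r}"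
    using assms(2) by auto
  then have "sum ?g {0..r - 1} = ?g 0 + sum ?g {1..<r}"
    by simp
  also have "?g 0 = recursive_cumulant \<mu> r"
    using assms(1) by simp
  also have "\<dots> = \<mu> r - sum ?g {1..<r}"
    by (rule recursive_cumulant.simps)
  finally show ?thesis
    by simp
qed

definition cumulant :: "'a measure \<Rightarrow> ('a \<Rightarrow> real) \<Rightarrow> nat \<Rightarrow> real" where
  "cumulant P Y r =
     (if admits_mgf P Y
      then fact r * fps_nth (THE F. (\<lambda>t. ln (mgf P Y t)) has_fps_expansion F) r
      else recursive_cumulant (moment P Y) r)"

definition rv_vec_norm ::
  "'a measure \<Rightarrow> (nat \<Rightarrow> 'a \<Rightarrow> real) \<Rightarrow> real \<Rightarrow> real Matrix.vec \<Rightarrow> real" where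
  "rv_vec_norm P X d x =
     ((\<integral>\<omega>. \<bar>Matrix.vec (dim_vec x) (\<lambda>i. X i \<omega>) \<bullet> x\<bar> powr d \<partial>P) / Gamma (d + 1)) powr (1 / d)"

definition herm_norm ::
  "'a measure \<Rightarrow> (nat \<Rightarrow> 'a \<Rightarrow> real) \<Rightarrow> real \<Rightarrow> complex mat \<Rightarrow> real" where
  "herm_norm P X d A = rv_vec_norm P X d (eigvals A)"

definition decreasing_rearrangement :: "real Matrix.vec \<Rightarrow> real list" where
  "decreasing_rearrangement x = rev (sort (list_of_vec x))"

definition majorized_by :: "real Matrix.vec \<Rightarrow> real Matrix.vec \<Rightarrow> bool" where
  "majorized_by x y \<longleftrightarrow>
     dim_vec x = dim_vec y \<and>
     sum_list (decreasing_rearrangement x) = sum_list (decreasing_rearrangement y) \<and>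
     (\<forall>k\<in>{1..dim_vec x}. sum_list (take k (decreasing_rearrangement x))
                        \<le> sum_list (take k (decreasing_rearrangement y)))"

definition schur_convex :: "nat \<Rightarrow> (real Matrix.vec \<Rightarrow> real) \<Rightarrow> bool" where
  "schur_convex n f \<longleftrightarrow>
     (\<forall>x\<in>carrier_vec n. \<forall>y\<in>carrier_vec n. majorized_by x y \<longrightarrow> f x \<le> f y)"

text \<open>Polynomials with variables indexed by \<open>'v\<close>: finitely supported maps from exponent
  vectors to coefficients.\<close>

definition mpoly_eval :: "(('v \<Rightarrow>\<^sub>0 nat) \<Rightarrow>\<^sub>0 'b::comm_semiring_1) \<Rightarrow> ('v \<Rightarrow> 'b) \<Rightarrow> 'b" where
  "mpoly_eval p v =
     (\<Sum>m\<in>Poly_Mapping.keys p. Poly_Mapping.lookup p m *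
        (\<Prod>i\<in>Poly_Mapping.keys m. v i ^ Poly_Mapping.lookup m i))"

definition mpoly_vars_in :: "'v set \<Rightarrow> (('v \<Rightarrow>\<^sub>0 nat) \<Rightarrow>\<^sub>0 'b::zero) \<Rightarrow> bool" where
  "mpoly_vars_in V p \<longleftrightarrow> (\<forall>m\<in>Poly_Mapping.keys p. Poly_Mapping.keys m \<subseteq> V)"

definition mpoly_homogeneous :: "nat \<Rightarrow> (('v \<Rightarrow>\<^sub>0 nat) \<Rightarrow>\<^sub>0 'b::zero) \<Rightarrow> bool" where
  "mpoly_homogeneous d p \<longleftrightarrow>
     (\<forall>m\<in>Poly_Mapping.keys p. (\<Sum>i\<in>Poly_Mapping.keys m. Poly_Mapping.lookup m i) = d)"

definition symmetric_fun :: "nat \<Rightarrow> (real Matrix.vec \<Rightarrow> real) \<Rightarrow> bool" where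
  "symmetric_fun n f \<longleftrightarrow>
     (\<forall>\<sigma>. \<sigma> permutes {..<n} \<longrightarrow>
        (\<forall>x\<in>carrier_vec n. f (Matrix.vec n (\<lambda>i. vec_index x (\<sigma> i))) = f x))"

text \<open>Positivity on \<open>V\<close> away from the zero element \<open>z\<close>. Continuity is not part of the
  definition: it is used for polynomial functions only.\<close>

definition positive_definite_on :: "'v set \<Rightarrow> 'v \<Rightarrow> ('v \<Rightarrow> real) \<Rightarrow> bool" where
  "positive_definite_on V z f \<longleftrightarrow> (\<forall>x\<in>V. x \<noteq> z \<longrightarrow> 0 < f x)"

text \<open>Only the values \<open>x 1, \<dots>, x l\<close> matter.\<close>

definition complete_bell :: "nat \<Rightarrow> (nat \<Rightarrow> 'b) \<Rightarrow> 'b::field_char_0" where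
  "complete_bell l x =
     fact l * fps_nth (fps_compose (fps_exp 1) (Abs_fps (\<lambda>j. if j = 0 then 0 else x j / fact j))) l"

definition int_partitions :: "nat \<Rightarrow> nat list set" where
  "int_partitions d = {\<pi>. sorted_wrt (\<ge>) \<pi> \<and> (\<forall>k\<in>set \<pi>. 1 \<le> k) \<and> sum_list \<pi> = d}"

definition part_prod :: "(nat \<Rightarrow> 'b::comm_monoid_mult) \<Rightarrow> nat list \<Rightarrow> 'b" where
  "part_prod c \<pi> = prod_list (map c \<pi>)"

text \<open>Parts of multiplicity 0 would contribute the factor 1.\<close>

definition y_part :: "nat list \<Rightarrow> nat" where
  "y_part \<pi> = (\<Prod>i\<in>set \<pi>. fact i ^ count_list \<pi> i * fact (count_list \<pi> i))"

definition power_sum :: "nat \<Rightarrow> real Matrix.vec \<Rightarrow> real" where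
  "power_sum k x = (\<Sum>i<dim_vec x. vec_index x i ^ k)"

text \<open>Words in the free monoid on \<open>x\<close> (\<open>Plain\<close>) and \<open>x\<^sup>*\<close> (\<open>Star\<close>).\<close>

datatype letter = Plain | Star

definition eval_letter :: "complex mat \<Rightarrow> letter \<Rightarrow> complex mat" where
  "eval_letter Z a = (case a of Plain \<Rightarrow> Z | Star \<Rightarrow> mat_adjoint Z)"

definition eval_word :: "complex mat \<Rightarrow> letter list \<Rightarrow> complex mat" where
  "eval_word Z w = foldr (\<lambda>a B. eval_letter Z a * B) w (1\<^sub>m (dim_row Z))"

definition trace_polynomial :: "nat \<Rightarrow> (complex mat \<Rightarrow> complex) \<Rightarrow> bool" where
  "trace_polynomial n f \<longleftrightarrow>
     (\<exists>p :: (letter list \<Rightarrow>\<^sub>0 nat) \<Rightarrow>\<^sub>0 complex. \<forall>Z\<in>carrier_mat n n.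
        f Z = mpoly_eval p (\<lambda>w. mat_trace (eval_word Z w)))"

definition balanced_words :: "nat list \<Rightarrow> letter list list set" where
  "balanced_words \<pi> =
     {ws. map length ws = \<pi> \<and> count_list (concat ws) Plain = sum_list \<pi> div 2}"

definition T_part :: "nat list \<Rightarrow> complex mat \<Rightarrow> complex" where
  "T_part \<pi> Z =
     (\<Sum>ws\<in>balanced_words \<pi>. prod_list (map (\<lambda>w. mat_trace (eval_word Z w)) ws))
       / of_nat (sum_list \<pi> choose (sum_list \<pi> div 2))"

text \<open>The values of \<^term>\<open>T_part\<close> are typed as complex numbers, hence the real part. With
  \<^term>\<open>root\<close>, a negative sum would give a negative value rather than a spurious positive one.\<close>

definition mat_norm :: "(nat \<Rightarrow> real) \<Rightarrow> nat \<Rightarrow> complex mat \<Rightarrow> real" where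
  "mat_norm \<kappa> d Z =
     root d (\<Sum>\<pi>\<in>int_partitions d. part_prod \<kappa> \<pi> * Re (T_part \<pi> Z) / of_nat (y_part \<pi>))"

end

theory Submission
  imports Defs
begin

text \<open>Everything rests on one function on \<open>\<real>\<^sup>n\<close>: for a fixed exponent \<open>d\<close>
the scaled \<open>L\<^sup>d\<close> norm of the random variable \<open>\<langle>X, x\<rangle>\<close>,
called \<open>rv_gauge\<close> below. Minkowski's inequality makes it a seminorm in \<open>x\<close>. It is
definite because \<open>\<langle>X, x\<rangle> = 0\<close> with \<open>x\<^sub>i \<noteq> 0\<close> would
express \<open>X\<^sub>i\<close> through variables independent of it, so that \<open>X\<^sub>i\<close> would
be constant. It is invariant under permutations because the joint law of an i.i.d. family is a power of one
measure. Such a symmetric norm is Schur convex: if \<open>y\<close> majorizes \<open>x\<close>, then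
\<open>y\<close> can be moved to \<open>x\<close> by finitely many transfers from one coordinate to another,
and each transfer is a convex combination of a vector with a transposed copy of itself
(\<open>gauge_mono_prefix_sums\<close>).

The norm on Hermitian matrices follows from Schur convexity. In an orthonormal basis that diagonalizes
\<open>A + B\<close>, the diagonals of \<open>A\<close> and \<open>B\<close> are images of their spectra
under doubly stochastic matrices, and these do not increase the gauge
(\<open>gauge_doubly_stochastic\<close>). The spectrum of \<open>A + B\<close> is the sum of the two
diagonals, so the triangle inequality on \<open>\<real>\<^sup>n\<close> carries over
(\<open>gauge_eigvals_norm\<close>).

For even \<open>d\<close> the \<open>d\<close>th power of the gauge is the \<open>d\<close>th moment of
\<open>\<langle>X, x\<rangle>\<close> over \<open>d!\<close>, which by independence is a coefficient of the
product of the rescaled moment series of the \<open>X\<^sub>i\<close>. Formally the moment series is the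
exponential of the cumulant series, whether or not it converges. So the product is the exponential of a
series whose coefficients are the cumulants times power sums of \<open>x\<close>. The coefficients of an
exponential are sums over partitions, because both satisfy the recursion that expresses \<open>F' = K'
F\<close>.

For a general matrix \<open>Z\<close> put \<open>Z\<^sub>k = \<omega>\<^sup>k Z + \<omega>\<^sup>-\<^sup>k
Z\<^sup>*\<close> with \<open>\<omega>\<close> a primitive root of unity of order \<open>d + 1\<close>.
These matrices are Hermitian. Expanding a product of traces of powers of \<open>Z\<^sub>k\<close> of total
degree \<open>d\<close> into words, and summing over \<open>k\<close>, leaves precisely the words in which
\<open>Z\<close> and \<open>Z\<^sup>*\<close> occur equally often, since every other word carries a
nontrivial power of \<open>\<omega>\<^sup>2\<close>. Hence \<open>T\<^sub>\<pi>(Z)\<close> is an average of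
values at the \<open>Z\<^sub>k\<close> (\<open>trace_product_average\<close>), and the partition sum for
\<open>Z\<close> is up to a constant the sum of the \<open>d\<close>th powers of the norms of the
\<open>Z\<^sub>k\<close> (\<open>partition_form_eq_average\<close>). Realness, positivity and the triangle
inequality can be read off from this.\<close>

section \<open>Symmetric norms and majorization\<close>

definition doubly_stochastic :: "nat \<Rightarrow> (nat \<Rightarrow> nat \<Rightarrow> real) \<Rightarrow> bool" where
  "doubly_stochastic n S \<longleftrightarrow> (\<forall>i<n. \<forall>j<n. 0 \<le> S i j) \<and>
     (\<forall>i<n. (\<Sum>j<n. S i j) = 1) \<and> (\<forall>j<n. (\<Sum>i<n. S i j) = 1)"

text \<open>The weights \<open>c\<close> distribute a total mass of \<open>k\<close> with at most \<open>1\<close> per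
index, so the sum is largest when the mass sits on the \<open>k\<close> largest entries. Moving the mass
there changes the sum by terms \<open>(1 - c\<^sub>j)(x\<^sub>j - \<theta>)\<close> for \<open>j < k\<close>
and \<open>- c\<^sub>j (x\<^sub>j - \<theta>)\<close> otherwise, all of them nonnegative for the threshold
\<open>\<theta> = x\<^sub>k\<^sub>-\<^sub>1\<close>.\<close>

lemma weighted_sum_le_prefix_sum:
  fixes c x :: "nat \<Rightarrow> real"
  assumes c: "\<And>j. j < n \<Longrightarrow> 0 \<le> c j \<and> c j \<le> 1" and k: "k \<le> n" and tot: "(\<Sum>j<n. c j) = real k"
    and anti: "\<And>i j. i \<le> j \<Longrightarrow> j < n \<Longrightarrow> x j \<le> x i"
  shows "(\<Sum>j<n. c j * x j) \<le> (\<Sum>j<k. x j)"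
proof (cases "k = 0")
  case True
  then have "\<forall>j\<in>{..<n}. c j = 0"
    using tot c by (subst sum_nonneg_eq_0_iff[symmetric]) auto
  then show ?thesis using True by simp
next
  case False
  \<comment> \<open>the threshold between the entries that receive mass and those that lose it\<close>
  define \<theta> where "\<theta> = x (k - 1)"
  have split: "(\<Sum>j<k. h j) = (\<Sum>j<n. (if j < k then h j else 0))" for h :: "nat \<Rightarrow> real"
    using k by (intro sum.mono_neutral_cong_left) auto
  have "0 \<le> (\<Sum>j<n. ((if j < k then 1 else 0) - c j) * (x j - \<theta>))"
  proof (rule sum_nonneg)
    fix j assume j: "j \<in> {..<n}"
    show "0 \<le> ((if j < k then 1 else 0) - c j) * (x j - \<theta>)"
    proof (cases "j < k")
      case True
      then have "\<theta> \<le> x j" unfolding \<theta>_def using anti[of j "k - 1"] k False by simp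
      then show ?thesis using True c[of j] j by simp
    next
      case False
      then have "x j \<le> \<theta>" unfolding \<theta>_def using anti[of "k - 1" j] j by simp
      then show ?thesis using False c[of j] j by (simp add: mult_nonneg_nonpos)
    qed
  qed
  also have "\<dots> = (\<Sum>j<n. (if j < k then x j else 0) - c j * x j - \<theta> * ((if j < k then 1 else 0) - c j))"
    by (intro sum.cong) (auto simp: algebra_simps)
  also have "\<dots> = (\<Sum>j<k. x j) - (\<Sum>j<n. c j * x j) - \<theta> * ((\<Sum>j<k. 1) - (\<Sum>j<n. c j))"
    unfolding split by (simp add: sum_subtractf sum_distrib_left right_diff_distrib del: sum_constant)
  finally show ?thesis using tot by simp
qed

lemma sort_permutation:
  fixes x :: "nat \<Rightarrow> real"
  shows "\<exists>\<sigma>. \<sigma> permutes {..<n} \<and> (\<forall>i j. i \<le> j \<longrightarrow> j < n \<longrightarrow> x (\<sigma> j) \<le> x (\<sigma> i))"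
proof -
  define xs where "xs = map x [0..<n]"
  define ys where "ys = rev (sort xs)"
  have "mset ys = mset xs" "length xs = n" by (simp_all add: ys_def xs_def)
  then obtain \<sigma> where \<sigma>: "\<sigma> permutes {..<n}" "permute_list \<sigma> xs = ys"
    by (metis mset_eq_permutation)
  have "ys ! i = x (\<sigma> i)" if "i < n" for i
    using \<sigma> that permutes_in_image[OF \<sigma>(1), of i]
    by (simp add: permute_list_nth[symmetric] xs_def flip: \<sigma>(2)) (simp add: permute_list_nth \<open>length xs = n\<close>[unfolded xs_def])
  moreover have "ys ! j \<le> ys ! i" if "i \<le> j" "j < n" for i j
    unfolding ys_def using that by (intro sorted_rev_nth_mono) (auto simp: xs_def)
  ultimately have "x (\<sigma> j) \<le> x (\<sigma> i)" if "i \<le> j" "j < n" for i j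
    using that by (metis le_less_trans)
  then show ?thesis using \<sigma>(1) by blast
qed

text \<open>A permutation-invariant norm on \<open>\<real>\<^sup>n\<close>. Vectors are functions on all of
\<open>\<nat>\<close> of which only the first \<open>n\<close> values count; this keeps \<open>n\<close> a
variable and makes permuting coordinates a composition of functions.\<close>

locale symmetric_gauge =
  fixes n :: nat and g :: "(nat \<Rightarrow> real) \<Rightarrow> real"
  assumes gauge_cong: "(\<And>i. i < n \<Longrightarrow> x i = y i) \<Longrightarrow> g x = g y"
    and gauge_permute: "\<sigma> permutes {..<n} \<Longrightarrow> g (\<lambda>i. x (\<sigma> i)) = g x"
    and gauge_triangle: "g (\<lambda>i. x i + y i) \<le> g x + g y"
    and gauge_scale: "g (\<lambda>i. c * x i) = \<bar>c\<bar> * g x"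
    and gauge_zeroD: "g x = 0 \<Longrightarrow> i < n \<Longrightarrow> x i = 0"
begin

lemma gauge_0: "(\<And>i. i < n \<Longrightarrow> x i = 0) \<Longrightarrow> g x = 0"
  using gauge_scale[of 0 x] gauge_cong[of x "\<lambda>i. 0 * x i"] by simp

lemma gauge_nonneg: "0 \<le> g x"
  using gauge_triangle[of x "\<lambda>i. (-1) * x i"] gauge_scale[of "-1" x]
    gauge_0[of "\<lambda>i. x i + (-1) * x i"] by simp

lemma gauge_convex:
  assumes "0 \<le> t" "t \<le> 1"
  shows "g (\<lambda>i. (1 - t) * x i + t * y i) \<le> (1 - t) * g x + t * g y"
  using gauge_triangle[of "\<lambda>i. (1 - t) * x i" "\<lambda>i. t * y i"] gauge_scale[of "1 - t" x]
    gauge_scale[of t y] assms by simp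

text \<open>The majorization argument. Let \<open>k\<close> be the first index with \<open>y\<^sub>k <
x\<^sub>k\<close>; comparing prefix sums gives a \<open>j < k\<close> with \<open>y\<^sub>j >
x\<^sub>j\<close>. Moving the amount \<open>\<delta> = min (y\<^sub>j - x\<^sub>j) (x\<^sub>k -
y\<^sub>k)\<close> from \<open>y\<^sub>j\<close> to \<open>y\<^sub>k\<close> replaces \<open>y\<close> by a
convex combination of \<open>y\<close> and \<open>y\<close> with two coordinates swapped, keeps the
hypotheses, and makes one more coordinate agree with \<open>x\<close>. Only \<open>x\<close> is assumed to
be monotone, so that \<open>y\<close> need not be sorted again after a transfer.\<close>

lemma gauge_mono_prefix_sums:
  assumes anti: "\<And>i j. i \<le> j \<Longrightarrow> j < n \<Longrightarrow> x j \<le> x i"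
    and le: "\<And>k. k \<le> n \<Longrightarrow> (\<Sum>i<k. x i) \<le> (\<Sum>i<k. y i)"
    and eq: "(\<Sum>i<n. x i) = (\<Sum>i<n. y i)"
  shows "g x \<le> g y"
  using le eq
proof (induction "card {i. i < n \<and> x i \<noteq> y i}" arbitrary: y rule: less_induct)
  case less
  show ?case
  proof (cases "\<forall>i<n. x i = y i")
    case True
    then show ?thesis using gauge_cong[of x y] by simp
  next
    case False
    have "\<exists>k<n. y k < x k"
    proof (rule ccontr)
      assume "\<not> ?thesis"
      then have ge: "\<forall>i\<in>{..<n}. x i \<le> y i" by force
      with False have "\<exists>i\<in>{..<n}. x i < y i" by force
      then have "(\<Sum>i<n. x i) < (\<Sum>i<n. y i)"
        using ge by (intro sum_strict_mono_ex1) auto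
      with less.prems(2) show False by simp
    qed
    define k where "k = (LEAST k. k < n \<and> y k < x k)"
    have k: "k < n" "y k < x k"
      using LeastI_ex[OF \<open>\<exists>k<n. y k < x k\<close>] by (auto simp: k_def)
    have before: "x i \<le> y i" if "i < k" for i
      using not_less_Least[of i "\<lambda>k. k < n \<and> y k < x k"] that k(1) by (force simp: k_def[symmetric])
    have "\<exists>j<k. x j < y j"
    proof (rule ccontr)
      assume "\<not> ?thesis"
      then have "x i = y i" if "i < k" for i using before[OF that] that by force
      then have "(\<Sum>i<Suc k. y i) < (\<Sum>i<Suc k. x i)" using k(2) by simp
      with less.prems(1)[of "Suc k"] k(1) show False by simp
    qed
    then obtain j where j: "j < k" "x j < y j" by blast
    define \<delta> where "\<delta> = min (y j - x j) (x k - y k)"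
    have \<delta>: "0 < \<delta>" "\<delta> \<le> y j - x j" "\<delta> \<le> x k - y k" using j k by (auto simp: \<delta>_def)
    have gap: "\<delta> \<le> y j - y k" "0 < y j - y k" using anti[of j k] j k \<delta> by auto
    \<comment> \<open>\<open>t\<close> is the weight of the swapped vector; it is at most \<open>1\<close> as \<open>y\<^sub>k < x\<^sub>k \<le> x\<^sub>j < y\<^sub>j\<close>\<close>
    define t where "t = \<delta> / (y j - y k)"
    have t: "0 \<le> t" "t \<le> 1" "t * (y j - y k) = \<delta>" using gap \<delta> by (auto simp: t_def)
    define y' where "y' = y(j := y j - \<delta>, k := y k + \<delta>)"
    let ?\<tau> = "Transposition.transpose j k"
    have "y' i = (1 - t) * y i + t * y (?\<tau> i)" for i
    proof -
      have "y j - \<delta> = (1 - t) * y j + t * y k" "y k + \<delta> = (1 - t) * y k + t * y j"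
        unfolding t(3)[symmetric] by (auto simp: algebra_simps)
      then show ?thesis
        using j by (auto simp: y'_def transpose_def algebra_simps)
    qed
    then have "g y' = g (\<lambda>i. (1 - t) * y i + t * y (?\<tau> i))"
      by (intro gauge_cong)
    also have "\<dots> \<le> (1 - t) * g y + t * g (\<lambda>i. y (?\<tau> i))"
      by (rule gauge_convex[OF t(1,2)])
    also have "g (\<lambda>i. y (?\<tau> i)) = g y"
      by (rule gauge_permute[OF permutes_swap_id]) (use j k in auto)
    finally have y'y: "g y' \<le> g y" by (simp add: algebra_simps)
    have sum': "(\<Sum>i<m. y' i) = (\<Sum>i<m. y i) - (if j < m then \<delta> else 0) + (if k < m then \<delta> else 0)" for m
    proof -
      have "(\<Sum>i<m. y' i) = (\<Sum>i<m. y i - (if i = j then \<delta> else 0) + (if i = k then \<delta> else 0))"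
        using j by (intro sum.cong) (auto simp: y'_def)
      then show ?thesis by (simp add: sum.distrib sum_subtractf)
    qed
    have "g x \<le> g y'"
    proof (rule less.hyps)
      have "{i. i < n \<and> x i \<noteq> y' i} \<subseteq> {i. i < n \<and> x i \<noteq> y i}"
        using j k by (auto simp: y'_def)
      moreover have "x j = y' j \<or> x k = y' k"
        using j by (auto simp: y'_def \<delta>_def)
      ultimately have "{i. i < n \<and> x i \<noteq> y' i} \<subset> {i. i < n \<and> x i \<noteq> y i}"
        using j k by force
      then show "card {i. i < n \<and> x i \<noteq> y' i} < card {i. i < n \<and> x i \<noteq> y i}"
        by (intro psubset_card_mono) auto
      show "(\<Sum>i<n. x i) = (\<Sum>i<n. y' i)"
        using less.prems(2) j k by (simp add: sum')
      fix m assume m: "m \<le> n"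
      show "(\<Sum>i<m. x i) \<le> (\<Sum>i<m. y' i)"
      proof (cases "j < m \<and> m \<le> k")
        case True
        have "y j - x j \<le> (\<Sum>i<m. y i - x i)"
          by (rule member_le_sum) (use True before in auto)
        then show ?thesis using True \<delta> by (simp add: sum' sum_subtractf)
      next
        case False
        then show ?thesis using less.prems(1)[OF m] j by (auto simp: sum')
      qed
    qed
    with y'y show ?thesis by simp
  qed
qed

lemma gauge_mset:
  assumes "mset xs = mset ys" "length xs = n"
  shows "g (\<lambda>i. xs ! i) = g (\<lambda>i. ys ! i)"
proof -
  have len: "length ys = n" using assms by (metis size_mset)
  obtain \<sigma> where \<sigma>: "\<sigma> permutes {..<n}" "permute_list \<sigma> ys = xs"
    using assms len by (metis mset_eq_permutation)
  have "g (\<lambda>i. xs ! i) = g (\<lambda>i. ys ! \<sigma> i)"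
    by (rule gauge_cong) (simp add: permute_list_nth \<sigma>(1) len flip: \<sigma>(2))
  also have "\<dots> = g (\<lambda>i. ys ! i)" by (rule gauge_permute[OF \<sigma>(1)])
  finally show ?thesis .
qed

theorem gauge_schur_convex: "schur_convex n (\<lambda>x. g (vec_index x))"
  unfolding schur_convex_def
proof (intro ballI impI)
  fix x y :: "real Matrix.vec"
  assume x: "x \<in> carrier_vec n" and y: "y \<in> carrier_vec n" and maj: "majorized_by x y"
  let ?x = "decreasing_rearrangement x" and ?y = "decreasing_rearrangement y"
  have len: "length ?x = n" "length ?y = n"
    using x y by (auto simp: decreasing_rearrangement_def)
  have to_list: "g (vec_index v) = g (\<lambda>i. decreasing_rearrangement v ! i)" if "v \<in> carrier_vec n" for v
  proof -
    have "g (vec_index v) = g (\<lambda>i. list_of_vec v ! i)"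
      using that by (intro gauge_cong) (auto simp: list_of_vec_index)
    also have "\<dots> = g (\<lambda>i. decreasing_rearrangement v ! i)"
      using that by (intro gauge_mset) (auto simp: decreasing_rearrangement_def)
    finally show ?thesis .
  qed
  have pre: "(\<Sum>i<k. l ! i) = sum_list (take k l)" if "k \<le> length l" for k and l :: "real list"
    using that by (simp add: sum_list_sum_nth atLeast0LessThan)
  have "g (\<lambda>i. ?x ! i) \<le> g (\<lambda>i. ?y ! i)"
  proof (rule gauge_mono_prefix_sums)
    fix i j assume "i \<le> j" "j < n"
    then show "?x ! j \<le> ?x ! i"
      unfolding decreasing_rearrangement_def using x by (intro sorted_rev_nth_mono) auto
  next
    fix k assume "k \<le> n"
    then show "(\<Sum>i<k. ?x ! i) \<le> (\<Sum>i<k. ?y ! i)"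
      using maj x len by (cases "k = 0") (auto simp: pre majorized_by_def)
  next
    show "(\<Sum>i<n. ?x ! i) = (\<Sum>i<n. ?y ! i)"
      using maj len by (simp add: pre majorized_by_def)
  qed
  then show "g (vec_index x) \<le> g (vec_index y)"
    using to_list x y by simp
qed

text \<open>After sorting both vectors, each prefix sum of \<open>S x\<close> is a weighted sum of the entries of
\<open>x\<close> whose weights are partial column sums of \<open>S\<close>, hence lie between
\<open>0\<close> and \<open>1\<close> and add up to the length of the prefix. So \<open>x\<close> majorizes
\<open>S x\<close>.\<close>

theorem gauge_doubly_stochastic:
  assumes S: "doubly_stochastic n S"
  shows "g (\<lambda>i. \<Sum>j<n. S i j * x j) \<le> g x"
proof -
  let ?z = "\<lambda>i. \<Sum>j<n. S i j * x j"
  obtain \<sigma> where \<sigma>: "\<sigma> permutes {..<n}" "\<And>i j. i \<le> j \<Longrightarrow> j < n \<Longrightarrow> x (\<sigma> j) \<le> x (\<sigma> i)"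
    using sort_permutation[of n x] by blast
  obtain \<tau> where \<tau>: "\<tau> permutes {..<n}" "\<And>i j. i \<le> j \<Longrightarrow> j < n \<Longrightarrow> ?z (\<tau> j) \<le> ?z (\<tau> i)"
    using sort_permutation[of n ?z] by blast
  have \<sigma>n: "\<sigma> i < n" if "i < n" for i using permutes_in_image[OF \<sigma>(1), of i] that by simp
  have \<tau>n: "\<tau> i < n" if "i < n" for i using permutes_in_image[OF \<tau>(1), of i] that by simp
  have reindex: "(\<Sum>i<n. h (\<rho> i)) = (\<Sum>i<n. h i)" if "\<rho> permutes {..<n}" for \<rho> and h :: "nat \<Rightarrow> real"
    using sum.permute[OF that, of h] by (simp add: comp_def)
  have rows: "(\<Sum>j<n. S (\<tau> i) (\<sigma> j)) = 1" if "i < n" for i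
    using S \<tau>n[OF that] reindex[OF \<sigma>(1), of "S (\<tau> i)"] by (simp add: doubly_stochastic_def)
  have cols: "(\<Sum>i<n. S (\<tau> i) (\<sigma> j)) = 1" if "j < n" for j
    using S \<sigma>n[OF that] reindex[OF \<tau>(1), of "\<lambda>i. S i (\<sigma> j)"] by (simp add: doubly_stochastic_def)
  have nn: "0 \<le> S (\<tau> i) (\<sigma> j)" if "i < n" "j < n" for i j
    using S \<tau>n[OF that(1)] \<sigma>n[OF that(2)] by (simp add: doubly_stochastic_def)
  have z: "?z (\<tau> i) = (\<Sum>j<n. S (\<tau> i) (\<sigma> j) * x (\<sigma> j))" for i
    using reindex[OF \<sigma>(1), of "\<lambda>j. S (\<tau> i) j * x j"] by simp
  have "g (\<lambda>i. ?z (\<tau> i)) \<le> g (\<lambda>i. x (\<sigma> i))"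
  proof (rule gauge_mono_prefix_sums)
    fix k assume k: "k \<le> n"
    have "(\<Sum>i<k. ?z (\<tau> i)) = (\<Sum>j<n. \<Sum>i<k. S (\<tau> i) (\<sigma> j) * x (\<sigma> j))"
      unfolding z by (rule sum.swap)
    also have "\<dots> = (\<Sum>j<n. (\<Sum>i<k. S (\<tau> i) (\<sigma> j)) * x (\<sigma> j))"
      by (simp add: sum_distrib_right)
    also have "\<dots> \<le> (\<Sum>j<k. x (\<sigma> j))"
    proof (rule weighted_sum_le_prefix_sum[OF _ k])
      fix j assume j: "j < n"
      have "(\<Sum>i<k. S (\<tau> i) (\<sigma> j)) \<le> (\<Sum>i<n. S (\<tau> i) (\<sigma> j))"
        using k j nn by (intro sum_mono2) auto
      then show "0 \<le> (\<Sum>i<k. S (\<tau> i) (\<sigma> j)) \<and> (\<Sum>i<k. S (\<tau> i) (\<sigma> j)) \<le> 1"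
        using cols[OF j] nn j k by (auto intro!: sum_nonneg)
    next
      have "(\<Sum>j<n. \<Sum>i<k. S (\<tau> i) (\<sigma> j)) = (\<Sum>i<k. \<Sum>j<n. S (\<tau> i) (\<sigma> j))"
        by (rule sum.swap)
      also have "\<dots> = (\<Sum>i<k. 1)" using rows k by (intro sum.cong) auto
      finally show "(\<Sum>j<n. \<Sum>i<k. S (\<tau> i) (\<sigma> j)) = real k" by simp
    qed (rule \<sigma>(2))
    finally show "(\<Sum>i<k. ?z (\<tau> i)) \<le> (\<Sum>i<k. x (\<sigma> i))" .
  next
    have "(\<Sum>i<n. ?z (\<tau> i)) = (\<Sum>j<n. \<Sum>i<n. S (\<tau> i) (\<sigma> j) * x (\<sigma> j))"
      unfolding z by (rule sum.swap)
    also have "\<dots> = (\<Sum>j<n. (\<Sum>i<n. S (\<tau> i) (\<sigma> j)) * x (\<sigma> j))"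
      by (simp add: sum_distrib_right)
    also have "\<dots> = (\<Sum>j<n. x (\<sigma> j))" using cols by (intro sum.cong) auto
    finally show "(\<Sum>i<n. ?z (\<tau> i)) = (\<Sum>i<n. x (\<sigma> i))" .
  qed (rule \<tau>(2))
  then show ?thesis using gauge_permute[OF \<tau>(1), of ?z] gauge_permute[OF \<sigma>(1), of x] by simp
qed

end

section \<open>Unitary diagonalization of Hermitian matrices\<close>

lemma mat_adjoint_dim [simp]:
  "dim_row (mat_adjoint A) = dim_col A" "dim_col (mat_adjoint A) = dim_row A"
  by (simp_all add: mat_adjoint_def)

lemma mat_adjoint_carrier [simp]:
  "A \<in> carrier_mat r c \<Longrightarrow> mat_adjoint A \<in> carrier_mat c r"
  by auto

lemma mat_adjoint_index [simp]:
  "i < dim_col A \<Longrightarrow> j < dim_row A \<Longrightarrow> mat_adjoint A $$ (i, j) = conjugate (A $$ (j, i))"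
  by (simp add: mat_adjoint_def mat_of_rows_def)

lemma mat_mult_index_sum:
  assumes "A \<in> carrier_mat r m" "B \<in> carrier_mat m c" "i < r" "j < c"
  shows "(A * B) $$ (i, j) = (\<Sum>k<m. A $$ (i, k) * B $$ (k, j))"
  using assms by (simp add: scalar_prod_def atLeast0LessThan)

lemma mat_adjoint_adjoint: "mat_adjoint (mat_adjoint A) = A" for A :: "complex mat"
  by (rule eq_matI) auto

lemma mat_adjoint_mult:
  fixes A B :: "complex mat"
  assumes A: "A \<in> carrier_mat r m" and B: "B \<in> carrier_mat m c"
  shows "mat_adjoint (A * B) = mat_adjoint B * mat_adjoint A"
proof (rule eq_matI)
  fix i j assume "i < dim_row (mat_adjoint B * mat_adjoint A)" "j < dim_col (mat_adjoint B * mat_adjoint A)"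
  then have ij: "i < c" "j < r" using A B by auto
  have "mat_adjoint (A * B) $$ (i, j) = cnj ((A * B) $$ (j, i))"
    using A B ij by simp
  also have "\<dots> = (\<Sum>k<m. cnj (A $$ (j, k)) * cnj (B $$ (k, i)))"
    by (simp add: mat_mult_index_sum[OF A B ij(2,1)])
  also have "\<dots> = (mat_adjoint B * mat_adjoint A) $$ (i, j)"
    using A B ij
    by (subst mat_mult_index_sum[OF mat_adjoint_carrier[OF B] mat_adjoint_carrier[OF A]])
       (auto intro!: sum.cong)
  finally show "mat_adjoint (A * B) $$ (i, j) = (mat_adjoint B * mat_adjoint A) $$ (i, j)" .
qed (use A B in auto)

lemma mat_adjoint_add:
  fixes A B :: "complex mat"
  assumes "A \<in> carrier_mat r c" "B \<in> carrier_mat r c"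
  shows "mat_adjoint (A + B) = mat_adjoint A + mat_adjoint B"
  by (rule eq_matI) (use assms in auto)

lemma mat_adjoint_smult:
  "mat_adjoint (a \<cdot>\<^sub>m A) = cnj a \<cdot>\<^sub>m mat_adjoint A" for A :: "complex mat"
  by (rule eq_matI) auto

lemma hermitian_add:
  assumes "A \<in> hermitian_mats n" "B \<in> hermitian_mats n"
  shows "A + B \<in> hermitian_mats n"
  using assms mat_adjoint_add[of A n n B] by (auto simp: hermitian_mats_def)

lemma hermitian_smult:
  assumes "A \<in> hermitian_mats n" "c \<in> \<real>"
  shows "c \<cdot>\<^sub>m A \<in> hermitian_mats n"
  using assms mat_adjoint_smult[of c A] by (auto simp: hermitian_mats_def Reals_cnj_iff)

definition unitary :: "nat \<Rightarrow> complex mat \<Rightarrow> bool" where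
  "unitary n U \<longleftrightarrow> U \<in> carrier_mat n n \<and> mat_adjoint U * U = 1\<^sub>m n"

lemma unitary_carrier: "unitary n U \<Longrightarrow> U \<in> carrier_mat n n"
  by (simp add: unitary_def)

lemma unitary_mult_adjoint: "unitary n U \<Longrightarrow> U * mat_adjoint U = 1\<^sub>m n"
  unfolding unitary_def by (meson mat_adjoint_carrier mat_mult_left_right_inverse)

lemma unitary_adjoint: "unitary n U \<Longrightarrow> unitary n (mat_adjoint U)"
  using unitary_mult_adjoint[of n U] by (simp add: unitary_def mat_adjoint_adjoint)

lemma unitary_mult:
  assumes U: "unitary n U" and V: "unitary n V"
  shows "unitary n (U * V)"
proof -
  have c: "U \<in> carrier_mat n n" "V \<in> carrier_mat n n"
    using U V by (auto simp: unitary_def)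
  then have c': "mat_adjoint U \<in> carrier_mat n n" "mat_adjoint V \<in> carrier_mat n n" by auto
  have "mat_adjoint (U * V) * (U * V) = mat_adjoint V * (mat_adjoint U * (U * V))"
    unfolding mat_adjoint_mult[OF c] using c c' by (intro assoc_mult_mat) auto
  also have "mat_adjoint U * (U * V) = (mat_adjoint U * U) * V"
    using c c' by (intro assoc_mult_mat[symmetric]) auto
  finally show ?thesis using U V c by (simp add: unitary_def)
qed

definition real_diag :: "nat \<Rightarrow> (nat \<Rightarrow> real) \<Rightarrow> complex mat" where
  "real_diag n x = mat n n (\<lambda>(i, j). if i = j then of_real (x i) else 0)"

lemma real_diag_carrier [simp]: "real_diag n x \<in> carrier_mat n n"
  by (simp add: real_diag_def)

text \<open>The block diagonal matrix of a scalar and \<open>V\<close>. It is given entrywise since then a product of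
two such matrices is computed by splitting the summand \<open>0\<close> off a sum.\<close>

definition bordered :: "'a::zero \<Rightarrow> 'a mat \<Rightarrow> 'a mat" where
  "bordered c V = mat (Suc (dim_row V)) (Suc (dim_col V))
     (\<lambda>(i, j). case i of 0 \<Rightarrow> (if j = 0 then c else 0)
        | Suc i' \<Rightarrow> (case j of 0 \<Rightarrow> 0 | Suc j' \<Rightarrow> V $$ (i', j')))"

lemma bordered_carrier [simp]:
  "V \<in> carrier_mat r c \<Longrightarrow> bordered a V \<in> carrier_mat (Suc r) (Suc c)"
  by (auto simp: bordered_def)

lemma bordered_mult:
  fixes V W :: "complex mat"
  assumes V: "V \<in> carrier_mat r m" and W: "W \<in> carrier_mat m c"
  shows "bordered a V * bordered b W = bordered (a * b) (V * W)"
proof (rule eq_matI)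
  fix i j assume "i < dim_row (bordered (a * b) (V * W))" "j < dim_col (bordered (a * b) (V * W))"
  then have ij: "i < Suc r" "j < Suc c" using V W by (auto simp: bordered_def)
  have "(bordered a V * bordered b W) $$ (i, j)
      = (\<Sum>k<Suc m. bordered a V $$ (i, k) * bordered b W $$ (k, j))"
    using V W ij by (intro mat_mult_index_sum) auto
  also have "\<dots> = bordered a V $$ (i, 0) * bordered b W $$ (0, j)
      + (\<Sum>k<m. bordered a V $$ (i, Suc k) * bordered b W $$ (Suc k, j))"
    by (rule sum.lessThan_Suc_shift)
  also have "\<dots> = bordered (a * b) (V * W) $$ (i, j)"
    using V W ij
    by (cases i; cases j) (auto simp: bordered_def mat_mult_index_sum[OF V W] simp del: index_mult_mat(1))
  finally show "(bordered a V * bordered b W) $$ (i, j) = bordered (a * b) (V * W) $$ (i, j)" .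
qed (use V W in \<open>auto simp: bordered_def\<close>)

lemma bordered_adjoint: "mat_adjoint (bordered a V) = bordered (cnj a) (mat_adjoint V)"
  by (rule eq_matI) (auto simp: bordered_def split: nat.splits)

lemma bordered_one: "bordered 1 (1\<^sub>m n) = (1\<^sub>m (Suc n) :: complex mat)"
  by (rule eq_matI) (auto simp: bordered_def split: nat.splits)

lemma bordered_real_diag:
  "bordered (of_real a) (real_diag n x) = real_diag (Suc n) (case_nat a x)"
  by (rule eq_matI) (auto simp: bordered_def real_diag_def split: nat.splits)

text \<open>Gram-Schmidt applied to a basis that starts with \<open>v\<close> keeps the direction of \<open>v\<close>;
it yields orthogonal vectors, which remain to be normalized.\<close>

lemma unitary_with_first_column:
  fixes v :: "complex Matrix.vec"
  assumes v: "v \<in> carrier_vec n" and v0: "v \<noteq> 0\<^sub>v n"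
  obtains W a where "unitary n W" "col W 0 = a \<cdot>\<^sub>v v"
proof -
  interpret cof_vec_space n "TYPE(complex)" .
  define ws where "ws = gram_schmidt n (basis_completion v)"
  note bc = basis_completion[OF v v0]
  note gs = gram_schmidt_result[OF bc(2,4,5) ws_def]
  have n: "n > 0"
  proof (rule ccontr)
    assume "\<not> n > 0"
    then have "v = 0\<^sub>v n" using v by (intro eq_vecI) auto
    with v0 show False by simp
  qed
  have len: "length ws = n" using gs(4) bc(6) by simp
  obtain vs where vs: "basis_completion v = v # vs"
    using bc(7) bc(6) n by (cases "basis_completion v") auto
  have ws0: "ws ! 0 = v"
    using gram_schmidt_hd[OF v, of vs] n len unfolding ws_def vs by (cases "gram_schmidt n (v # vs)") auto
  have wsc: "ws ! i \<in> carrier_vec n" if "i < n" for i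
    using gs(3) len that by auto
  define q where "q i = sqrt (\<Sum>k<n. (cmod (vec_index (ws ! i) k))\<^sup>2)" for i
  have sp: "ws ! j \<bullet>c ws ! i = (\<Sum>k<n. vec_index (ws ! j) k * cnj (vec_index (ws ! i) k))"
    if "i < n" "j < n" for i j
    using wsc that by (auto simp: scalar_prod_def atLeast0LessThan intro!: sum.cong)
  have qq: "complex_of_real (q i) * complex_of_real (q i) = ws ! i \<bullet>c ws ! i" if "i < n" for i
  proof -
    have "complex_of_real (q i) * complex_of_real (q i) = complex_of_real ((q i)\<^sup>2)"
      by (simp add: power2_eq_square)
    also have "(q i)\<^sup>2 = (\<Sum>k<n. (cmod (vec_index (ws ! i) k))\<^sup>2)"
      unfolding q_def by (rule real_sqrt_pow2) (auto intro: sum_nonneg)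
    finally show ?thesis unfolding sp[OF that that] by (simp only: of_real_sum complex_norm_square)
  qed
  have q0: "q i \<noteq> 0" if "i < n" for i
    using qq[OF that] corthogonalD[OF gs(2), of i i] that len by auto
  define W where "W = mat n n (\<lambda>(k, i). vec_index (ws ! i) k / q i)"
  have W: "W \<in> carrier_mat n n" by (simp add: W_def)
  have "mat_adjoint W * W = 1\<^sub>m n"
  proof (rule eq_matI)
    fix i j assume "i < dim_row (1\<^sub>m n :: complex mat)" "j < dim_col (1\<^sub>m n :: complex mat)"
    then have ij: "i < n" "j < n" by auto
    have "(mat_adjoint W * W) $$ (i, j) = (\<Sum>k<n. mat_adjoint W $$ (i, k) * W $$ (k, j))"
      by (rule mat_mult_index_sum[OF mat_adjoint_carrier[OF W] W ij])
    also have "\<dots> = (\<Sum>k<n. vec_index (ws ! j) k * cnj (vec_index (ws ! i) k)) / (q i * q j)"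
      unfolding sum_divide_distrib using ij by (intro sum.cong) (auto simp: W_def)
    also have "\<dots> = (ws ! j \<bullet>c ws ! i) / (q i * q j)"
      by (simp add: sp ij)
    also have "\<dots> = 1\<^sub>m n $$ (i, j)"
      using ij qq[of i] q0[of i] corthogonalD[OF gs(2), of j i] len by auto
    finally show "(mat_adjoint W * W) $$ (i, j) = 1\<^sub>m n $$ (i, j)" .
  qed (auto simp: W_def)
  moreover have "col W 0 = complex_of_real (1 / q 0) \<cdot>\<^sub>v v"
    using n v ws0 by (intro eq_vecI) (auto simp: W_def)
  ultimately show ?thesis using W that by (auto simp: unitary_def)
qed

text \<open>Induction on the size. A unitary matrix whose first column is an eigenvector conjugates \<open>A\<close> to
a matrix whose first column is a multiple of the first unit vector. As the result is Hermitian, its first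
row has the same form and the eigenvalue is real, so the induction hypothesis applies to the remaining
block.\<close>

theorem hermitian_diagonalizable:
  assumes "A \<in> hermitian_mats n"
  obtains U x where "unitary n U" "mat_adjoint U * A * U = real_diag n x"
proof -
  have "\<exists>U x. unitary n U \<and> mat_adjoint U * A * U = real_diag n x"
    using assms
  proof (induction n arbitrary: A)
    case 0
    then have "unitary 0 (1\<^sub>m 0)" "mat_adjoint (1\<^sub>m 0) * A * 1\<^sub>m 0 = real_diag 0 (\<lambda>_. 0)"
      by (auto simp: unitary_def real_diag_def hermitian_mats_def intro!: eq_matI)
    then show ?case by blast
  next
    case (Suc n)
    let ?N = "Suc n"
    have A: "A \<in> carrier_mat ?N ?N" and Aadj: "mat_adjoint A = A"
      using Suc.prems by (auto simp: hermitian_mats_def)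
    have "degree (char_poly A) = ?N" using degree_monic_char_poly[OF A] by simp
    then have "\<not> constant (poly (char_poly A))" by (simp add: constant_degree)
    then obtain e where "poly (char_poly A) e = 0"
      using fundamental_theorem_of_algebra by blast
    then have "eigenvalue A e" using eigenvalue_root_char_poly[OF A] by simp
    then obtain v where v: "v \<in> carrier_vec ?N" "v \<noteq> 0\<^sub>v ?N" "A *\<^sub>v v = e \<cdot>\<^sub>v v"
      using A by (auto simp: eigenvalue_def eigenvector_def)
    obtain W a where W: "unitary ?N W" and W0: "col W 0 = a \<cdot>\<^sub>v v"
      by (rule unitary_with_first_column[OF v(1,2)])
    have Wc: "W \<in> carrier_mat ?N ?N" using W by (rule unitary_carrier)
    have Wa: "mat_adjoint W \<in> carrier_mat ?N ?N" using Wc by simp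
    define B where "B = mat_adjoint W * A * W"
    have Bc: "B \<in> carrier_mat ?N ?N" unfolding B_def by (intro mult_carrier_mat[OF _ Wc] mult_carrier_mat[OF Wa A])
    have Badj: "mat_adjoint B = B"
    proof -
      have "mat_adjoint B = mat_adjoint W * (mat_adjoint A * mat_adjoint (mat_adjoint W))"
        unfolding B_def using mat_adjoint_mult[OF _ Wc, of "mat_adjoint W * A" ?N] mat_adjoint_mult[OF Wa A] Wa A
        by simp
      then show ?thesis
        unfolding B_def Aadj mat_adjoint_adjoint using assoc_mult_mat[OF Wa A Wc] by simp
    qed
    have Bcol: "col B 0 = e \<cdot>\<^sub>v unit_vec ?N 0"
    proof -
      have "B = mat_adjoint W * (A * W)" unfolding B_def by (rule assoc_mult_mat[OF Wa A Wc])
      then have "col B 0 = mat_adjoint W *\<^sub>v (A *\<^sub>v col W 0)"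
        using col_mult2[OF Wa mult_carrier_mat[OF A Wc], of 0] col_mult2[OF A Wc, of 0] by simp
      also have "A *\<^sub>v col W 0 = e \<cdot>\<^sub>v col W 0"
        unfolding W0 using v mult_mat_vec[OF A v(1)] by (simp add: smult_smult_assoc mult.commute)
      also have "mat_adjoint W *\<^sub>v (e \<cdot>\<^sub>v col W 0) = e \<cdot>\<^sub>v (mat_adjoint W *\<^sub>v col W 0)"
        by (rule mult_mat_vec[OF Wa]) (metis Wc carrier_matD(1) col_dim)
      also have "mat_adjoint W *\<^sub>v col W 0 = col (mat_adjoint W * W) 0"
        using col_mult2[OF Wa Wc, of 0] by simp
      also have "\<dots> = unit_vec ?N 0"
        using W by (simp add: unitary_def)
      finally show ?thesis .
    qed
    have Bi0: "B $$ (i, 0) = (if i = 0 then e else 0)" if "i < ?N" for i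
      using arg_cong[OF Bcol, of "\<lambda>u. vec_index u i"] that Bc by auto
    have Bherm: "B $$ (i, j) = cnj (B $$ (j, i))" if "i < ?N" "j < ?N" for i j
      using arg_cong[OF Badj, of "\<lambda>M. M $$ (i, j)"] that Bc by auto
    have e: "complex_of_real (Re e) = e"
      using Bherm[of 0 0] Bi0[of 0] by (simp add: complex_eq_iff)
    define C where "C = mat n n (\<lambda>(i, j). B $$ (Suc i, Suc j))"
    have C: "C \<in> carrier_mat n n" by (simp add: C_def)
    have "mat_adjoint C = C"
      by (rule eq_matI) (auto simp: C_def Bherm[symmetric])
    with C have "C \<in> hermitian_mats n" by (simp add: hermitian_mats_def)
    then obtain V y where V: "unitary n V" "mat_adjoint V * C * V = real_diag n y"
      using Suc.IH by blast
    have Vc: "V \<in> carrier_mat n n" "mat_adjoint V \<in> carrier_mat n n" using V(1) by (auto simp: unitary_def)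
    have BC: "B = bordered e C"
    proof (rule eq_matI)
      fix i j assume "i < dim_row (bordered e C)" "j < dim_col (bordered e C)"
      then have ij: "i < ?N" "j < ?N" by (auto simp: bordered_def C_def)
      then show "B $$ (i, j) = bordered e C $$ (i, j)"
        using Bi0[of i] Bi0[of j] Bherm[of i j] e
        by (cases i; cases j) (auto simp: bordered_def C_def complex_eq_iff)
    qed (use Bc in \<open>auto simp: bordered_def C_def\<close>)
    define V' where "V' = bordered 1 V"
    have V'c: "V' \<in> carrier_mat ?N ?N" using Vc by (simp add: V'_def)
    have V'a: "mat_adjoint V' = bordered 1 (mat_adjoint V)" by (simp add: V'_def bordered_adjoint)
    have uV': "unitary ?N V'"
      using V'c V(1) unfolding unitary_def V'a unfolding V'_def
      by (simp add: bordered_mult[OF Vc(2,1)] bordered_one)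
    have "mat_adjoint V' * B * V' = bordered e (mat_adjoint V * C * V)"
      unfolding V'a BC unfolding V'_def bordered_mult[OF Vc(2) C]
        bordered_mult[OF mult_carrier_mat[OF Vc(2) C] Vc(1)] by simp
    also have "\<dots> = real_diag ?N (case_nat (Re e) y)"
      unfolding V(2) using bordered_real_diag[of "Re e" n y] e by simp
    finally have D: "mat_adjoint V' * B * V' = real_diag ?N (case_nat (Re e) y)" .
    have V'ac: "mat_adjoint V' \<in> carrier_mat ?N ?N" using V'c by simp
    have "mat_adjoint (W * V') * A * (W * V') = mat_adjoint V' * B * V'"
      unfolding mat_adjoint_mult[OF Wc V'c] B_def
      using assoc_mult_mat[OF V'ac Wa A] assoc_mult_mat[OF V'ac mult_carrier_mat[OF Wa A] Wc]
        assoc_mult_mat[OF mult_carrier_mat[OF V'ac mult_carrier_mat[OF Wa A]] Wc V'c]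
      by simp
    with D unitary_mult[OF W uV'] show ?case by metis
  qed
  then show ?thesis using that by blast
qed

lemma diagonalized_eq:
  assumes A: "A \<in> carrier_mat n n" and U: "unitary n U" and D: "mat_adjoint U * A * U = D"
  shows "A = U * D * mat_adjoint U"
proof -
  have c: "U \<in> carrier_mat n n" "mat_adjoint U \<in> carrier_mat n n"
    using U by (auto simp: unitary_def)
  have "U * D * mat_adjoint U = U * (mat_adjoint U * (A * U)) * mat_adjoint U"
    unfolding D[symmetric] assoc_mult_mat[OF c(2) A c(1)] ..
  also have "U * (mat_adjoint U * (A * U)) = (U * mat_adjoint U) * (A * U)"
    by (rule assoc_mult_mat[OF c mult_carrier_mat[OF A c(1)], symmetric])
  also have "\<dots> = A * U" using A c(1) by (simp add: unitary_mult_adjoint[OF U])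
  also have "A * U * mat_adjoint U = A * (U * mat_adjoint U)"
    by (rule assoc_mult_mat[OF A c])
  also have "\<dots> = A" using A by (simp add: unitary_mult_adjoint[OF U])
  finally show ?thesis by simp
qed

lemma diagonalized_similar:
  assumes A: "A \<in> carrier_mat n n" and U: "unitary n U" and D: "mat_adjoint U * A * U = real_diag n x"
  shows "similar_mat_wit A (real_diag n x) U (mat_adjoint U)"
proof -
  have c: "U \<in> carrier_mat n n" "mat_adjoint U \<in> carrier_mat n n"
    using U by (auto simp: unitary_def)
  show ?thesis
    by (rule similar_mat_witI[of _ _ n])
       (use c A U diagonalized_eq[OF A U D] unitary_mult_adjoint[OF U] in \<open>auto simp: unitary_def\<close>)
qed

lemma char_poly_diagonalized:
  assumes A: "A \<in> carrier_mat n n" and U: "unitary n U" and D: "mat_adjoint U * A * U = real_diag n x"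
  shows "char_poly A = (\<Prod>a\<leftarrow>map (\<lambda>i. complex_of_real (x i)) [0..<n]. [:- a, 1:])"
proof -
  have "char_poly A = char_poly (real_diag n x)"
    using diagonalized_similar[OF A U D] by (intro char_poly_similar) (auto simp: similar_mat_def)
  also have "\<dots> = (\<Prod>a\<leftarrow>diag_mat (real_diag n x). [:- a, 1:])"
    by (rule char_poly_upper_triangular[of _ n]) (auto simp: real_diag_def)
  also have "diag_mat (real_diag n x) = map (\<lambda>i. complex_of_real (x i)) [0..<n]"
    by (auto simp: diag_mat_def real_diag_def)
  finally show ?thesis .
qed

lemma proots_linear_factors: "proots (\<Prod>a\<leftarrow>as. [:- a, 1:]) = mset as" for as :: "complex list"
proof (induction as)
  case (Cons a as)
  have "(\<Prod>a\<leftarrow>as. [:- a, 1:]) \<noteq> 0" by (auto simp: prod_list_zero_iff)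
  then have "proots ([:- a, 1:] * (\<Prod>a\<leftarrow>as. [:- a, 1:])) = proots [:- a, 1:] + proots (\<Prod>a\<leftarrow>as. [:- a, 1:])"
    by (intro proots_mult) simp_all
  then show ?case unfolding list.map prod_list.Cons Cons.IH proots_linear_factor by simp
qed simp

lemma eigvals_diagonalized:
  assumes A: "A \<in> carrier_mat n n" and U: "unitary n U" and D: "mat_adjoint U * A * U = real_diag n x"
  shows "eigvals A = vec_of_list (rev (sort (map x [0..<n])))"
proof -
  have "proots (char_poly A) = mset (map (\<lambda>i. complex_of_real (x i)) [0..<n])"
    unfolding char_poly_diagonalized[OF A U D] by (rule proots_linear_factors)
  then have "image_mset Re (proots (char_poly A)) = mset (map x [0..<n])"
    by (simp add: image_mset.compositionality comp_def)
  then show ?thesis unfolding eigvals_def by (simp only: sorted_list_of_multiset_mset)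
qed

text \<open>The weights \<open>\<bar>V\<^sub>j\<^sub>i\<bar>\<^sup>2\<close> form a doubly stochastic matrix when
\<open>V\<close> is unitary, since they sum the squared entries of its columns and rows.\<close>

lemma real_diag_conjugation_diagonal:
  assumes V: "unitary n V" and i: "i < n"
  shows "(mat_adjoint V * real_diag n x * V) $$ (i, i) = of_real (\<Sum>j<n. (cmod (V $$ (j, i)))\<^sup>2 * x j)"
proof -
  have c: "V \<in> carrier_mat n n" "mat_adjoint V \<in> carrier_mat n n"
    using V by (auto simp: unitary_def)
  have D: "(real_diag n x * V) $$ (j, i) = of_real (x j) * V $$ (j, i)" if "j < n" for j
  proof -
    have "(real_diag n x * V) $$ (j, i) = (\<Sum>k<n. real_diag n x $$ (j, k) * V $$ (k, i))"
      by (rule mat_mult_index_sum[OF real_diag_carrier c(1) that i])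
    also have "\<dots> = (\<Sum>k<n. if k = j then of_real (x j) * V $$ (j, i) else 0)"
      using that by (intro sum.cong) (auto simp: real_diag_def)
    finally show ?thesis using that by simp
  qed
  have "(mat_adjoint V * real_diag n x * V) $$ (i, i) = (mat_adjoint V * (real_diag n x * V)) $$ (i, i)"
    by (subst assoc_mult_mat[OF c(2) real_diag_carrier c(1)]) simp
  also have "\<dots> = (\<Sum>j<n. mat_adjoint V $$ (i, j) * (real_diag n x * V) $$ (j, i))"
    by (rule mat_mult_index_sum[OF c(2) mult_carrier_mat[OF real_diag_carrier c(1)] i i])
  also have "\<dots> = (\<Sum>j<n. of_real ((cmod (V $$ (j, i)))\<^sup>2) * of_real (x j))"
    using c i D by (intro sum.cong) (auto simp: complex_norm_square mult_ac simp del: index_mult_mat(1) of_real_power)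
  finally show ?thesis by simp
qed

lemma unitary_column_norm:
  assumes V: "unitary n V" and i: "i < n"
  shows "(\<Sum>j<n. (cmod (V $$ (j, i)))\<^sup>2) = 1"
proof -
  have c: "V \<in> carrier_mat n n" "mat_adjoint V \<in> carrier_mat n n"
    using V by (auto simp: unitary_def)
  have "complex_of_real (\<Sum>j<n. (cmod (V $$ (j, i)))\<^sup>2) = (\<Sum>j<n. mat_adjoint V $$ (i, j) * V $$ (j, i))"
    unfolding of_real_sum complex_norm_square using c i by (intro sum.cong) auto
  also have "\<dots> = 1"
    using mat_mult_index_sum[OF c(2,1) i i] V i by (simp add: unitary_def)
  finally show ?thesis by (simp only: of_real_eq_1_iff)
qed

lemma unitary_row_norm:
  assumes V: "unitary n V" and j: "j < n"
  shows "(\<Sum>i<n. (cmod (V $$ (j, i)))\<^sup>2) = 1"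
proof -
  have "(\<Sum>i<n. (cmod (V $$ (j, i)))\<^sup>2) = (\<Sum>i<n. (cmod (mat_adjoint V $$ (i, j)))\<^sup>2)"
    using unitary_carrier[OF V] j by (intro sum.cong) auto
  also have "\<dots> = 1" by (rule unitary_column_norm[OF unitary_adjoint[OF V] j])
  finally show ?thesis .
qed

lemma diagonal_is_stochastic_image_of_spectrum:
  assumes A: "A \<in> carrier_mat n n" and U: "unitary n U" and D: "mat_adjoint U * A * U = real_diag n x"
    and W: "unitary n W"
  obtains S where "doubly_stochastic n S"
    "\<And>i. i < n \<Longrightarrow> (mat_adjoint W * A * W) $$ (i, i) = of_real (\<Sum>j<n. S i j * x j)"
proof -
  let ?V = "mat_adjoint U * W"
  have c: "U \<in> carrier_mat n n" "mat_adjoint U \<in> carrier_mat n n" "W \<in> carrier_mat n n" "mat_adjoint W \<in> carrier_mat n n"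
    using U W by (auto simp: unitary_def)
  have V: "unitary n ?V" by (rule unitary_mult[OF unitary_adjoint[OF U] W])
  have "mat_adjoint W * A * W = mat_adjoint W * (U * (real_diag n x * mat_adjoint U)) * W"
    using diagonalized_eq[OF A U D] assoc_mult_mat[OF c(1) real_diag_carrier c(2)] by simp
  also have "\<dots> = (mat_adjoint W * U) * (real_diag n x * mat_adjoint U) * W"
    by (subst assoc_mult_mat[OF c(4,1) mult_carrier_mat[OF real_diag_carrier c(2)]]) simp
  also have "\<dots> = (mat_adjoint W * U) * real_diag n x * mat_adjoint U * W"
    by (subst assoc_mult_mat[OF mult_carrier_mat[OF c(4,1)] real_diag_carrier c(2)]) simp
  also have "\<dots> = (mat_adjoint W * U) * real_diag n x * ?V"
    by (rule assoc_mult_mat[OF mult_carrier_mat[OF mult_carrier_mat[OF c(4,1)] real_diag_carrier] c(2,3)])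
  also have "mat_adjoint W * U = mat_adjoint ?V"
    by (simp add: mat_adjoint_mult[OF c(2,3)] mat_adjoint_adjoint)
  finally have eq: "mat_adjoint W * A * W = mat_adjoint ?V * real_diag n x * ?V" .
  show ?thesis
  proof (rule that)
    show "doubly_stochastic n (\<lambda>i j. (cmod (?V $$ (j, i)))\<^sup>2)"
      unfolding doubly_stochastic_def
      using unitary_column_norm[OF V] unitary_row_norm[OF V] by simp
    fix i assume "i < n"
    then show "(mat_adjoint W * A * W) $$ (i, i) = of_real (\<Sum>j<n. (cmod (?V $$ (j, i)))\<^sup>2 * x j)"
      unfolding eq by (rule real_diag_conjugation_diagonal[OF V])
  qed
qed

section \<open>Symmetric norms of the spectrum\<close>

context symmetric_gauge
begin

lemma gauge_eigvals:
  assumes A: "A \<in> carrier_mat n n" and U: "unitary n U" and D: "mat_adjoint U * A * U = real_diag n x"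
  shows "g (vec_index (eigvals A)) = g x"
proof -
  have "g (vec_index (eigvals A)) = g (\<lambda>i. rev (sort (map x [0..<n])) ! i)"
    unfolding eigvals_diagonalized[OF A U D] by (intro gauge_cong) (simp add: vec_of_list_index)
  also have "\<dots> = g (\<lambda>i. map x [0..<n] ! i)"
    by (intro gauge_mset) auto
  also have "\<dots> = g x" by (intro gauge_cong) simp
  finally show ?thesis .
qed

text \<open>The triangle inequality is the only part that is not immediate from a diagonalization. In a basis that
diagonalizes \<open>A + B\<close>, the spectrum of the sum is the sum of the diagonals of \<open>A\<close>
and \<open>B\<close>, and these diagonals have at most the gauge of the respective spectra.\<close>

theorem gauge_eigvals_norm:
  "is_norm_on n \<real> (hermitian_mats n) (\<lambda>A. g (vec_index (eigvals A)))"
  unfolding is_norm_on_def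
proof (intro conjI ballI)
  fix A assume "A \<in> hermitian_mats n"
  show "0 \<le> g (vec_index (eigvals A))" by (rule gauge_nonneg)
next
  fix A assume A: "A \<in> hermitian_mats n"
  then have Ac: "A \<in> carrier_mat n n" by (simp add: hermitian_mats_def)
  obtain U x where U: "unitary n U" and D: "mat_adjoint U * A * U = real_diag n x"
    by (rule hermitian_diagonalizable[OF A])
  have c: "U \<in> carrier_mat n n" "mat_adjoint U \<in> carrier_mat n n"
    using U by (auto simp: unitary_def)
  have N: "g (vec_index (eigvals A)) = g x" by (rule gauge_eigvals[OF Ac U D])
  show "(g (vec_index (eigvals A)) = 0) = (A = 0\<^sub>m n n)"
  proof
    assume "g (vec_index (eigvals A)) = 0"
    then have "x i = 0" if "i < n" for i using gauge_zeroD[of x i] that N by simp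
    then have "real_diag n x = 0\<^sub>m n n" by (intro eq_matI) (auto simp: real_diag_def)
    then show "A = 0\<^sub>m n n" using diagonalized_eq[OF Ac U D] c by simp
  next
    assume "A = 0\<^sub>m n n"
    then have "real_diag n x = 0\<^sub>m n n" using D c by simp
    then have "real_diag n x $$ (i, i) = 0" if "i < n" for i using that by simp
    then have "x i = 0" if "i < n" for i using that by (simp add: real_diag_def)
    then show "g (vec_index (eigvals A)) = 0" unfolding N by (rule gauge_0)
  qed
next
  fix c :: complex and A assume cR: "c \<in> \<real>" and A: "A \<in> hermitian_mats n"
  then obtain a where a: "c = of_real a" by (auto elim: Reals_cases)
  have Ac: "A \<in> carrier_mat n n" using A by (simp add: hermitian_mats_def)
  obtain U x where U: "unitary n U" and D: "mat_adjoint U * A * U = real_diag n x"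
    by (rule hermitian_diagonalizable[OF A])
  have cU: "U \<in> carrier_mat n n" "mat_adjoint U \<in> carrier_mat n n"
    using U by (auto simp: unitary_def)
  have "mat_adjoint U * (c \<cdot>\<^sub>m A) * U = c \<cdot>\<^sub>m real_diag n x"
    unfolding mult_smult_distrib[OF cU(2) Ac] mult_smult_assoc_mat[OF mult_carrier_mat[OF cU(2) Ac] cU(1)] D ..
  also have "\<dots> = real_diag n (\<lambda>i. a * x i)"
    by (intro eq_matI) (auto simp: real_diag_def a)
  finally have "g (vec_index (eigvals (c \<cdot>\<^sub>m A))) = g (\<lambda>i. a * x i)"
    using Ac by (intro gauge_eigvals[OF _ U]) auto
  then show "g (vec_index (eigvals (c \<cdot>\<^sub>m A))) = cmod c * g (vec_index (eigvals A))"
    by (simp add: gauge_scale gauge_eigvals[OF Ac U D] a)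
next
  fix A B assume A: "A \<in> hermitian_mats n" and B: "B \<in> hermitian_mats n"
  have Ac: "A \<in> carrier_mat n n" and Bc: "B \<in> carrier_mat n n"
    using A B by (auto simp: hermitian_mats_def)
  obtain U x where U: "unitary n U" and Dx: "mat_adjoint U * A * U = real_diag n x"
    by (rule hermitian_diagonalizable[OF A])
  obtain V y where V: "unitary n V" and Dy: "mat_adjoint V * B * V = real_diag n y"
    by (rule hermitian_diagonalizable[OF B])
  obtain W z where W: "unitary n W" and Dz: "mat_adjoint W * (A + B) * W = real_diag n z"
    by (rule hermitian_diagonalizable[OF hermitian_add[OF A B]])
  have c: "W \<in> carrier_mat n n" "mat_adjoint W \<in> carrier_mat n n"
    using W by (auto simp: unitary_def)
  obtain S where S: "doubly_stochastic n S"
    "\<And>i. i < n \<Longrightarrow> (mat_adjoint W * A * W) $$ (i, i) = of_real (\<Sum>j<n. S i j * x j)"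
    using diagonal_is_stochastic_image_of_spectrum[OF Ac U Dx W] by blast
  obtain T where T: "doubly_stochastic n T"
    "\<And>i. i < n \<Longrightarrow> (mat_adjoint W * B * W) $$ (i, i) = of_real (\<Sum>j<n. T i j * y j)"
    using diagonal_is_stochastic_image_of_spectrum[OF Bc V Dy W] by blast
  have z: "z i = (\<Sum>j<n. S i j * x j) + (\<Sum>j<n. T i j * y j)" if i: "i < n" for i
  proof -
    have "complex_of_real (z i) = (mat_adjoint W * (A + B) * W) $$ (i, i)"
      unfolding Dz using i by (simp add: real_diag_def)
    also have "mat_adjoint W * (A + B) * W = mat_adjoint W * A * W + mat_adjoint W * B * W"
      unfolding mult_add_distrib_mat[OF c(2) Ac Bc]
      by (rule add_mult_distrib_mat[OF mult_carrier_mat[OF c(2) Ac] mult_carrier_mat[OF c(2) Bc] c(1)])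
    also have "\<dots> $$ (i, i) = (mat_adjoint W * A * W) $$ (i, i) + (mat_adjoint W * B * W) $$ (i, i)"
      using i c Ac Bc by (intro index_add_mat) auto
    also have "\<dots> = of_real ((\<Sum>j<n. S i j * x j) + (\<Sum>j<n. T i j * y j))"
      using S(2)[OF i] T(2)[OF i] by simp
    finally show ?thesis by (simp only: of_real_eq_iff)
  qed
  have "g (vec_index (eigvals (A + B))) = g z"
    using Ac Bc by (intro gauge_eigvals[OF _ W Dz]) auto
  also have "\<dots> = g (\<lambda>i. (\<Sum>j<n. S i j * x j) + (\<Sum>j<n. T i j * y j))"
    by (rule gauge_cong) (rule z)
  also have "\<dots> \<le> g (\<lambda>i. \<Sum>j<n. S i j * x j) + g (\<lambda>i. \<Sum>j<n. T i j * y j)"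
    by (rule gauge_triangle)
  also have "\<dots> \<le> g x + g y"
    by (intro add_mono gauge_doubly_stochastic S(1) T(1))
  finally show "g (vec_index (eigvals (A + B))) \<le> g (vec_index (eigvals A)) + g (vec_index (eigvals B))"
    using gauge_eigvals[OF Ac U Dx] gauge_eigvals[OF Bc V Dy] by simp
qed

end

section \<open>Norms from independent and identically distributed variables\<close>

text \<open>Convexity on the open half-line extends to \<open>0\<close> because \<open>s powr d \<le> s\<close> for
\<open>s\<close> in the unit interval.\<close>

lemma powr_convex_nonneg:
  fixes u v t d :: real
  assumes d: "1 \<le> d" and t: "0 \<le> t" "t \<le> 1" and uv: "0 \<le> u" "0 \<le> v"
  shows "((1 - t) * u + t * v) powr d \<le> (1 - t) * u powr d + t * v powr d"
proof -
  have le: "s powr d \<le> s" if "0 \<le> s" "s \<le> 1" for s :: real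
    using powr_mono'[OF d that] that by simp
  consider "u = 0" | "v = 0" | "0 < u" "0 < v" using uv by linarith
  then show ?thesis
  proof cases
    case 1
    then show ?thesis using t uv le[of t] by (simp add: powr_mult mult_right_mono)
  next
    case 2
    then show ?thesis using t uv le[of "1 - t"] by (simp add: powr_mult mult_right_mono)
  next
    case 3
    then show ?thesis
      using convex_onD[OF powr_convex[OF d], of t u v] t by simp
  qed
qed

lemma abs_powr_convex:
  fixes a b t d :: real
  assumes "1 \<le> d" "0 \<le> t" "t \<le> 1"
  shows "\<bar>(1 - t) * a + t * b\<bar> powr d \<le> (1 - t) * \<bar>a\<bar> powr d + t * \<bar>b\<bar> powr d"
proof -
  have "\<bar>(1 - t) * a + t * b\<bar> \<le> (1 - t) * \<bar>a\<bar> + t * \<bar>b\<bar>"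
    using abs_triangle_ineq[of "(1 - t) * a" "t * b"] assms by (simp add: abs_mult)
  then have "\<bar>(1 - t) * a + t * b\<bar> powr d \<le> ((1 - t) * \<bar>a\<bar> + t * \<bar>b\<bar>) powr d"
    using assms by (intro powr_mono2) auto
  also have "\<dots> \<le> (1 - t) * \<bar>a\<bar> powr d + t * \<bar>b\<bar> powr d"
    using assms by (intro powr_convex_nonneg) auto
  finally show ?thesis .
qed

lemma Lp_rv_scale:
  assumes "f \<in> Lp_rv M d"
  shows "(\<lambda>\<omega>. c * f \<omega>) \<in> Lp_rv M d"
  using assms by (auto simp: Lp_rv_def abs_mult powr_mult)

lemma Lp_rv_add:
  assumes d: "1 \<le> d" and f: "f \<in> Lp_rv M d" and h: "h \<in> Lp_rv M d"
  shows "(\<lambda>\<omega>. f \<omega> + h \<omega>) \<in> Lp_rv M d"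
proof -
  have [measurable]: "f \<in> borel_measurable M" "h \<in> borel_measurable M"
    using f h by (auto simp: Lp_rv_def)
  have "integrable M (\<lambda>\<omega>. \<bar>2 * f \<omega>\<bar> powr d + \<bar>2 * h \<omega>\<bar> powr d)"
    using Lp_rv_scale[OF f, of 2] Lp_rv_scale[OF h, of 2] by (auto simp: Lp_rv_def)
  then have "integrable M (\<lambda>\<omega>. \<bar>f \<omega> + h \<omega>\<bar> powr d)"
  proof (rule Bochner_Integration.integrable_bound)
    show "AE \<omega> in M. norm (\<bar>f \<omega> + h \<omega>\<bar> powr d) \<le> norm (\<bar>2 * f \<omega>\<bar> powr d + \<bar>2 * h \<omega>\<bar> powr d)"
    proof (rule AE_I2)
      fix \<omega>
      have bound: "\<bar>f \<omega> + h \<omega>\<bar> powr d \<le> (1 / 2) * \<bar>2 * f \<omega>\<bar> powr d + (1 / 2) * \<bar>2 * h \<omega>\<bar> powr d"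
        using abs_powr_convex[OF d, of "1/2" "2 * f \<omega>" "2 * h \<omega>"] by simp
      have weaken: "norm s \<le> norm (a + b)"
        if "s \<le> (1 / 2) * a + (1 / 2) * b" "0 \<le> s" "0 \<le> a" "0 \<le> b" for s a b :: real
        using that by simp
      show "norm (\<bar>f \<omega> + h \<omega>\<bar> powr d) \<le> norm (\<bar>2 * f \<omega>\<bar> powr d + \<bar>2 * h \<omega>\<bar> powr d)"
        by (rule weaken[OF bound]) auto
    qed
  qed measurable
  then show ?thesis by (simp add: Lp_rv_def)
qed

lemma Lp_rv_sum:
  assumes "1 \<le> d" "\<And>i. i \<in> I \<Longrightarrow> f i \<in> Lp_rv M d"
  shows "(\<lambda>\<omega>. \<Sum>i\<in>I. f i \<omega>) \<in> Lp_rv M d"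
  using assms(2)
proof (induction I rule: infinite_finite_induct)
  case (insert i I)
  then show ?case
    using Lp_rv_add[OF assms(1) insert.prems[of i] insert.IH] by simp
qed (auto simp: Lp_rv_def)

text \<open>Let \<open>p\<close> and \<open>q\<close> be slightly larger than the norms of \<open>f\<close> and
\<open>h\<close>. Then \<open>(f + h) / (p + q)\<close> is a convex combination of \<open>f / p\<close> and
\<open>h / q\<close>, so convexity of the power function bounds its norm by \<open>1\<close>. The slack
\<open>e / 2\<close> keeps the denominators positive when a norm vanishes. The statement is for arbitrary
measures, as it is applied to the probability measure and to a counting measure.\<close>

theorem Minkowski_inequality:
  assumes d: "1 \<le> d" and f: "f \<in> Lp_rv M d" and h: "h \<in> Lp_rv M d"
  shows "(\<integral>\<omega>. \<bar>f \<omega> + h \<omega>\<bar> powr d \<partial>M) powr (1 / d)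
    \<le> (\<integral>\<omega>. \<bar>f \<omega>\<bar> powr d \<partial>M) powr (1 / d) + (\<integral>\<omega>. \<bar>h \<omega>\<bar> powr d \<partial>M) powr (1 / d)"
    (is "?N (\<lambda>\<omega>. f \<omega> + h \<omega>) \<le> ?N f + ?N h")
proof (rule field_le_epsilon)
  fix e :: real assume e: "0 < e"
  define p where "p = ?N f + e / 2"
  define q where "q = ?N h + e / 2"
  have pq: "0 < p" "0 < q" using e by (auto simp: p_def q_def add_nonneg_pos)
  have small: "(\<integral>\<omega>. \<bar>k \<omega>\<bar> powr d \<partial>M) \<le> r powr d" if "?N k \<le> r" "0 < r" for k and r :: real
  proof -
    have "(\<integral>\<omega>. \<bar>k \<omega>\<bar> powr d \<partial>M) = ?N k powr d"
      using d by (simp add: powr_powr)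
    also have "\<dots> \<le> r powr d" using that d by (intro powr_mono2) auto
    finally show ?thesis .
  qed
  define t where "t = q / (p + q)"
  have t: "0 \<le> t" "t \<le> 1" "1 - t = p / (p + q)" using pq by (auto simp: t_def field_simps)
  have int: "integrable M (\<lambda>\<omega>. \<bar>f \<omega>\<bar> powr d)" "integrable M (\<lambda>\<omega>. \<bar>h \<omega>\<bar> powr d)"
     "integrable M (\<lambda>\<omega>. \<bar>f \<omega> + h \<omega>\<bar> powr d)"
    using f h Lp_rv_add[OF d f h] by (auto simp: Lp_rv_def)
  have pw: "\<bar>f \<omega> + h \<omega>\<bar> powr d
      \<le> (p + q) powr d * ((1 - t) / p powr d * \<bar>f \<omega>\<bar> powr d + t / q powr d * \<bar>h \<omega>\<bar> powr d)" for \<omega>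
  proof -
    have "f \<omega> + h \<omega> = (p + q) * ((1 - t) * (f \<omega> / p) + t * (h \<omega> / q))"
    proof -
      have "(p + q) * (1 - t) = p" "(p + q) * t = q"
        unfolding t(3) unfolding t_def using pq by auto
      then have "(p + q) * ((1 - t) * (f \<omega> / p) + t * (h \<omega> / q)) = p * (f \<omega> / p) + q * (h \<omega> / q)"
        by (simp only: distrib_left mult.assoc[symmetric])
      then show ?thesis using pq by simp
    qed
    then have "\<bar>f \<omega> + h \<omega>\<bar> powr d = (p + q) powr d * \<bar>(1 - t) * (f \<omega> / p) + t * (h \<omega> / q)\<bar> powr d"
      using pq by (simp add: abs_mult powr_mult)
    also have "\<dots> \<le> (p + q) powr d * ((1 - t) * \<bar>f \<omega> / p\<bar> powr d + t * \<bar>h \<omega> / q\<bar> powr d)"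
      by (intro mult_left_mono abs_powr_convex d t(1,2)) auto
    also have "\<bar>f \<omega> / p\<bar> powr d = \<bar>f \<omega>\<bar> powr d / p powr d" using pq by (simp add: powr_divide)
    also have "\<bar>h \<omega> / q\<bar> powr d = \<bar>h \<omega>\<bar> powr d / q powr d" using pq by (simp add: powr_divide)
    finally show ?thesis by simp
  qed
  have "(\<integral>\<omega>. \<bar>f \<omega> + h \<omega>\<bar> powr d \<partial>M)
      \<le> (\<integral>\<omega>. (p + q) powr d * ((1 - t) / p powr d * \<bar>f \<omega>\<bar> powr d + t / q powr d * \<bar>h \<omega>\<bar> powr d) \<partial>M)"
    using int by (intro integral_mono pw) auto
  also have "\<dots> = (p + q) powr d * ((1 - t) / p powr d * (\<integral>\<omega>. \<bar>f \<omega>\<bar> powr d \<partial>M)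
      + t / q powr d * (\<integral>\<omega>. \<bar>h \<omega>\<bar> powr d \<partial>M))"
    using int by simp
  also have "\<dots> \<le> (p + q) powr d * ((1 - t) / p powr d * p powr d + t / q powr d * q powr d)"
    using pq t e by (intro mult_left_mono add_mono small) (auto simp: p_def q_def)
  also have "\<dots> = (p + q) powr d" using pq by simp
  finally have "?N (\<lambda>\<omega>. f \<omega> + h \<omega>) \<le> ((p + q) powr d) powr (1 / d)"
    using d by (intro powr_mono2) (auto intro: integral_nonneg_AE)
  also have "\<dots> = p + q" using pq d by (simp add: powr_powr)
  finally show "?N (\<lambda>\<omega>. f \<omega> + h \<omega>) \<le> ?N f + ?N h + e" by (simp add: p_def q_def)
qed

lemma (in prob_space) integrable_power_le:
  fixes Y :: "'a \<Rightarrow> real"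
  assumes Y: "Y \<in> Lp_rv M d" and k: "real k \<le> d"
  shows "integrable M (\<lambda>\<omega>. Y \<omega> ^ k)"
proof (rule Bochner_Integration.integrable_bound)
  show "integrable M (\<lambda>\<omega>. 1 + \<bar>Y \<omega>\<bar> powr d)" using Y by (simp add: Lp_rv_def)
  show "AE \<omega> in M. norm (Y \<omega> ^ k) \<le> norm (1 + \<bar>Y \<omega>\<bar> powr d)"
  proof (rule AE_I2)
    fix \<omega>
    have "\<bar>Y \<omega>\<bar> ^ k \<le> 1 + \<bar>Y \<omega>\<bar> powr d"
    proof (cases "\<bar>Y \<omega>\<bar> \<le> 1")
      case True
      then have "\<bar>Y \<omega>\<bar> ^ k \<le> 1" by (simp add: power_le_one)
      then show ?thesis by (simp add: add_increasing2)
    next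
      case False
      then have "\<bar>Y \<omega>\<bar> ^ k = \<bar>Y \<omega>\<bar> powr real k" by (simp add: powr_realpow)
      also have "\<dots> \<le> \<bar>Y \<omega>\<bar> powr d" using False k by (intro powr_mono) auto
      finally show ?thesis by simp
    qed
    then show "norm (Y \<omega> ^ k) \<le> norm (1 + \<bar>Y \<omega>\<bar> powr d)" by (simp add: power_abs)
  qed
qed (use Y in \<open>auto simp: Lp_rv_def intro: borel_measurable_power\<close>)

text \<open>Almost surely \<open>V = - U\<close>, so the variance of \<open>U\<close> is minus the covariance of
\<open>U\<close> and \<open>V\<close>, which is \<open>0\<close> by independence. Integrability of the
square follows from that of the product.\<close>

lemma (in prob_space) self_independent_const:
  fixes U V :: "'a \<Rightarrow> real"
  assumes ind: "indep_var borel U borel V" and U: "integrable M U" and V: "integrable M V"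
    and sum: "AE \<omega> in M. U \<omega> + V \<omega> = 0"
  shows "AE \<omega> in M. U \<omega> = expectation U"
proof -
  have [measurable]: "U \<in> borel_measurable M" "V \<in> borel_measurable M" using U V by auto
  have eq: "AE \<omega> in M. V \<omega> - expectation V = - (U \<omega> - expectation U)"
  proof -
    have "expectation U + expectation V = (\<integral>\<omega>. U \<omega> + V \<omega> \<partial>M)" using U V by simp
    also have "\<dots> = (\<integral>\<omega>. 0 \<partial>M)" using sum by (intro integral_cong_AE) auto
    finally have "expectation U + expectation V = 0" by simp
    with sum show ?thesis by auto
  qed
  have ind': "indep_var borel (\<lambda>\<omega>. U \<omega> - expectation U) borel (\<lambda>\<omega>. V \<omega> - expectation V)"
    using indep_var_compose[OF ind, of "\<lambda>x. x - expectation U" borel "\<lambda>x. x - expectation V" borel]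
    by (simp add: comp_def)
  have intU: "integrable M (\<lambda>\<omega>. U \<omega> - expectation U)" and intV: "integrable M (\<lambda>\<omega>. V \<omega> - expectation V)"
    using U V by auto
  have e: "AE \<omega> in M. (U \<omega> - expectation U) * (V \<omega> - expectation V) = - (U \<omega> - expectation U)\<^sup>2"
    using eq by eventually_elim (simp only: power2_eq_square mult_minus_right)
  have int: "integrable M (\<lambda>\<omega>. - (U \<omega> - expectation U)\<^sup>2)"
    using indep_var_integrable[OF ind' intU intV] e by (subst integrable_cong_AE[symmetric]) auto
  have "(\<integral>\<omega>. - (U \<omega> - expectation U)\<^sup>2 \<partial>M) = (\<integral>\<omega>. (U \<omega> - expectation U) * (V \<omega> - expectation V) \<partial>M)"
    using e by (intro integral_cong_AE) auto
  also have "\<dots> = expectation (\<lambda>\<omega>. U \<omega> - expectation U) * expectation (\<lambda>\<omega>. V \<omega> - expectation V)"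
    by (rule indep_var_lebesgue_integral[OF ind' intU intV])
  also have "\<dots> = 0" using U by (simp add: prob_space)
  finally have "(\<integral>\<omega>. (U \<omega> - expectation U)\<^sup>2 \<partial>M) = 0" by simp
  then have "AE \<omega> in M. (U \<omega> - expectation U)\<^sup>2 = 0"
    using int by (subst (asm) integral_nonneg_eq_0_iff_AE) auto
  then show ?thesis by eventually_elim simp
qed

locale iid_family = prob_space P for P :: "'a measure" +
  fixes X :: "nat \<Rightarrow> 'a \<Rightarrow> real" and n :: nat and d :: real
  assumes n: "1 \<le> n" and d: "2 \<le> d"
    and Lp: "\<And>i. i < n \<Longrightarrow> X i \<in> Lp_rv P d"
    and nondeg: "\<And>i. i < n \<Longrightarrow> nondegenerate P (X i)"
    and indep: "indep_vars (\<lambda>_. borel) X {..<n}"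
    and ident: "\<And>i j. i < n \<Longrightarrow> j < n \<Longrightarrow> distr P borel (X i) = distr P borel (X j)"
begin

abbreviation lin :: "(nat \<Rightarrow> real) \<Rightarrow> 'a \<Rightarrow> real" where
  "lin x \<omega> \<equiv> (\<Sum>i<n. X i \<omega> * x i)"

definition rv_gauge :: "(nat \<Rightarrow> real) \<Rightarrow> real" where
  "rv_gauge x = ((\<integral>\<omega>. \<bar>lin x \<omega>\<bar> powr d \<partial>P) / Gamma (d + 1)) powr (1 / d)"

lemma X_measurable [measurable]: "i < n \<Longrightarrow> X i \<in> borel_measurable P"
  using Lp by (simp add: Lp_rv_def)

lemma X_integrable: "i < n \<Longrightarrow> integrable P (X i)"
  using integrable_power_le[OF Lp, of i 1] d by simp

lemma lin_Lp: "lin x \<in> Lp_rv P d"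
proof (rule Lp_rv_sum)
  fix i assume "i \<in> {..<n}"
  then show "(\<lambda>\<omega>. X i \<omega> * x i) \<in> Lp_rv P d"
    using Lp_rv_scale[OF Lp[of i], of "x i"] by (simp add: mult.commute)
qed (use d in simp)

lemma joint_law: "distr P (Pi\<^sub>M {..<n} (\<lambda>_. borel)) (\<lambda>\<omega>. \<lambda>i\<in>{..<n}. X i \<omega>)
    = Pi\<^sub>M {..<n} (\<lambda>_. distr P borel (X 0))"
proof -
  have ne: "{..<n} \<noteq> {}" using n by (metis One_nat_def Suc_le_lessD empty_iff lessThan_iff)
  have "distr P (Pi\<^sub>M {..<n} (\<lambda>_. borel)) (\<lambda>\<omega>. \<lambda>i\<in>{..<n}. X i \<omega>)
      = Pi\<^sub>M {..<n} (\<lambda>i. distr P borel (X i))"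
    using ne indep by (subst indep_vars_iff_distr_eq_PiM'[symmetric]) auto
  also have "\<dots> = Pi\<^sub>M {..<n} (\<lambda>_. distr P borel (X 0))"
    using n by (intro PiM_cong ident) auto
  finally show ?thesis .
qed

text \<open>The integral depends only on the joint law, a power of a single measure, and such a power is invariant under
permutations of the coordinates.\<close>

lemma lin_permute_integral:
  assumes \<sigma>: "\<sigma> permutes {..<n}"
  shows "(\<integral>\<omega>. \<bar>lin (\<lambda>i. x (\<sigma> i)) \<omega>\<bar> powr d \<partial>P) = (\<integral>\<omega>. \<bar>lin x \<omega>\<bar> powr d \<partial>P)"
proof -
  let ?L = "Pi\<^sub>M {..<n} (\<lambda>_. distr P borel (X 0))"
  let ?B = "Pi\<^sub>M {..<n} (\<lambda>_. borel :: real measure)"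
  let ?h = "\<lambda>y \<eta>. \<bar>\<Sum>i<n. \<eta> i * y i\<bar> powr d"
  have X0: "X 0 \<in> borel_measurable P" using n by simp
  have sets: "sets ?L = sets ?B" by (intro sets_PiM_cong) auto
  have meas: "?h y \<in> borel_measurable ?B" for y by measurable
  have measL: "?h y \<in> borel_measurable ?L" for y using meas measurable_cong_sets[OF sets refl] by blast
  have tr: "(\<integral>\<omega>. \<bar>lin y \<omega>\<bar> powr d \<partial>P) = (\<integral>\<eta>. ?h y \<eta> \<partial>?L)" for y
    unfolding joint_law[symmetric] by (subst integral_distr[OF _ meas]) (auto intro!: measurable_restrict)
  have \<sigma>n: "\<sigma> i < n" if "i < n" for i using permutes_in_image[OF \<sigma>, of i] that by simp
  have "distr ?L ?L (\<lambda>\<eta>. \<lambda>i\<in>{..<n}. \<eta> (\<sigma> i)) = ?L"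
    using \<sigma> by (intro distr_PiM_reindex)
      (auto intro: prob_space_distr[OF X0] permutes_inj_on \<sigma>n)
  then have "(\<integral>\<eta>. ?h (\<lambda>i. x (\<sigma> i)) \<eta> \<partial>?L) = (\<integral>\<eta>. ?h (\<lambda>i. x (\<sigma> i)) \<eta> \<partial>distr ?L ?L (\<lambda>\<eta>. \<lambda>i\<in>{..<n}. \<eta> (\<sigma> i)))"
    by simp
  also have "\<dots> = (\<integral>\<eta>. ?h (\<lambda>i. x (\<sigma> i)) (\<lambda>i\<in>{..<n}. \<eta> (\<sigma> i)) \<partial>?L)"
    using \<sigma>n by (intro integral_distr measL measurable_restrict) auto
  also have "\<dots> = (\<integral>\<eta>. \<bar>\<Sum>i<n. \<eta> (\<sigma> i) * x (\<sigma> i)\<bar> powr d \<partial>?L)"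
    by simp
  also have "\<dots> = (\<integral>\<eta>. ?h x \<eta> \<partial>?L)"
    using sum.permute[OF \<sigma>, of "\<lambda>i. \<eta> i * x i" for \<eta>] by (simp add: comp_def)
  finally show ?thesis by (simp add: tr)
qed

lemma lin_eq_0_AE:
  assumes zero: "AE \<omega> in P. lin x \<omega> = 0" and i: "i < n"
  shows "x i = 0"
proof (rule ccontr)
  assume xi: "x i \<noteq> 0"
  let ?Y = "\<lambda>j \<omega>. X j \<omega> * x j"
  let ?U = "?Y i" and ?V = "\<lambda>\<omega>. \<Sum>j\<in>{..<n} - {i}. ?Y j \<omega>"
  have ins: "insert i ({..<n} - {i}) = {..<n}" using i by auto
  have "indep_vars (\<lambda>_. borel) ?Y {..<n}"
    by (rule indep_vars_compose2[OF indep, where Y = "\<lambda>j y. y * x j"]) auto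
  then have ind: "indep_var borel ?U borel ?V"
    using indep_vars_sum[of "{..<n} - {i}" i ?Y, unfolded ins] by simp
  have "lin x \<omega> = ?U \<omega> + ?V \<omega>" for \<omega>
    using i by (subst sum.remove[of _ i]) auto
  then have "AE \<omega> in P. ?U \<omega> + ?V \<omega> = 0" using zero by simp
  then have "AE \<omega> in P. ?U \<omega> = expectation ?U"
    using i by (intro self_independent_const[OF ind]) (auto intro!: X_integrable Bochner_Integration.integrable_sum integrable_mult_left)
  then have "AE \<omega> in P. X i \<omega> = expectation ?U / x i"
    by eventually_elim (use xi in \<open>simp add: field_simps\<close>)
  then show False using nondeg[OF i] by (auto simp: nondegenerate_def)
qed

sublocale symmetric_gauge n rv_gauge
proof
  fix x y :: "nat \<Rightarrow> real" assume "\<And>i. i < n \<Longrightarrow> x i = y i"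
  then have "lin x \<omega> = lin y \<omega>" for \<omega> by (intro sum.cong) auto
  then show "rv_gauge x = rv_gauge y" by (simp add: rv_gauge_def)
next
  fix \<sigma> and x :: "nat \<Rightarrow> real" assume "\<sigma> permutes {..<n}"
  then show "rv_gauge (\<lambda>i. x (\<sigma> i)) = rv_gauge x" by (simp add: rv_gauge_def lin_permute_integral)
next
  fix x y :: "nat \<Rightarrow> real"
  have split: "rv_gauge z = (\<integral>\<omega>. \<bar>lin z \<omega>\<bar> powr d \<partial>P) powr (1 / d) / Gamma (d + 1) powr (1 / d)" for z
    unfolding rv_gauge_def by (rule powr_divide)
  have "lin (\<lambda>i. x i + y i) \<omega> = lin x \<omega> + lin y \<omega>" for \<omega>
    by (simp add: sum.distrib distrib_left)
  then show "rv_gauge (\<lambda>i. x i + y i) \<le> rv_gauge x + rv_gauge y"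
    unfolding split add_divide_distrib[symmetric]
    by (simp only:, intro divide_right_mono Minkowski_inequality lin_Lp) (use d in auto)
next
  fix c :: real and x :: "nat \<Rightarrow> real"
  have "lin (\<lambda>i. c * x i) \<omega> = c * lin x \<omega>" for \<omega>
    by (simp add: sum_distrib_left mult.left_commute)
  then have "rv_gauge (\<lambda>i. c * x i) = (\<bar>c\<bar> powr d * ((\<integral>\<omega>. \<bar>lin x \<omega>\<bar> powr d \<partial>P) / Gamma (d + 1))) powr (1 / d)"
    unfolding rv_gauge_def by (simp add: abs_mult powr_mult)
  also have "\<dots> = \<bar>c\<bar> * rv_gauge x"
    using d unfolding rv_gauge_def
    by (subst powr_mult) (auto simp: powr_powr intro: divide_nonneg_pos Gamma_real_pos)
  finally show "rv_gauge (\<lambda>i. c * x i) = \<bar>c\<bar> * rv_gauge x" .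
next
  fix x :: "nat \<Rightarrow> real" and i assume "rv_gauge x = 0" and i: "i < n"
  moreover have "Gamma (d + 1) > 0" using d by (intro Gamma_real_pos) auto
  ultimately have "(\<integral>\<omega>. \<bar>lin x \<omega>\<bar> powr d \<partial>P) = 0" by (simp add: rv_gauge_def)
  then have "AE \<omega> in P. \<bar>lin x \<omega>\<bar> powr d = 0"
    using lin_Lp[of x] by (subst (asm) integral_nonneg_eq_0_iff_AE) (auto simp: Lp_rv_def)
  then have "AE \<omega> in P. lin x \<omega> = 0" by eventually_elim simp
  then show "x i = 0" using i by (rule lin_eq_0_AE)
qed

lemma rv_vec_norm_eq_gauge: "x \<in> carrier_vec n \<Longrightarrow> rv_vec_norm P X d x = rv_gauge (vec_index x)"
  by (auto simp: rv_vec_norm_def rv_gauge_def scalar_prod_def atLeast0LessThan)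

end

section \<open>Exponentials of power series, partitions and cumulants\<close>

text \<open>States \<open>F = exp K\<close> through the logarithmic derivative. In this form the relation passes to
products and to rescaling of the variable by comparison of coefficients, it determines \<open>F\<close> from
\<open>K\<close> and \<open>K\<close> from \<open>F\<close>, and it can be checked for a series that is
given by a recursion.\<close>

definition is_exp_of :: "'a::field_char_0 fps \<Rightarrow> 'a fps \<Rightarrow> bool" where
  "is_exp_of K F \<longleftrightarrow> fps_nth K 0 = 0 \<and> fps_nth F 0 = 1 \<and> fps_deriv F = fps_deriv K * F"

lemma fps_linear_ode_unique:
  fixes F G L :: "'a::field_char_0 fps"
  assumes F: "fps_deriv F = L * F" and G: "fps_deriv G = L * G" and 0: "fps_nth F 0 = fps_nth G 0"
  shows "F = G"
proof (rule fps_ext)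
  fix k
  show "fps_nth F k = fps_nth G k"
  proof (induction k rule: less_induct)
    case (less k)
    show ?case
    proof (cases k)
      case (Suc j)
      have "of_nat (Suc j) * fps_nth F (Suc j) = (\<Sum>i=0..j. fps_nth L i * fps_nth F (j - i))"
        using arg_cong[OF F, of "\<lambda>H. fps_nth H j"] by (simp add: fps_mult_nth)
      also have "\<dots> = (\<Sum>i=0..j. fps_nth L i * fps_nth G (j - i))"
        using less.IH Suc by (intro sum.cong) auto
      also have "\<dots> = of_nat (Suc j) * fps_nth G (Suc j)"
        using arg_cong[OF G, of "\<lambda>H. fps_nth H j"] by (simp add: fps_mult_nth)
      finally show ?thesis using Suc by (simp del: of_nat_Suc)
    qed (use 0 in simp)
  qed
qed

lemma is_exp_of_compose:
  assumes "fps_nth K 0 = 0"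
  shows "is_exp_of K (fps_compose (fps_exp 1) K)"
  using assms by (simp add: is_exp_of_def fps_compose_deriv mult.commute)

lemma is_exp_of_imp_eq_compose:
  assumes "is_exp_of K F"
  shows "F = fps_compose (fps_exp 1) K"
  using assms is_exp_of_compose[of K] fps_linear_ode_unique[of F "fps_deriv K" "fps_compose (fps_exp 1) K"]
  by (simp add: is_exp_of_def)

lemma is_exp_of_unique_log:
  assumes "is_exp_of K F" "is_exp_of L F"
  shows "K = L"
proof -
  have "fps_deriv K * F = fps_deriv L * F" "F \<noteq> 0"
    using assms by (auto simp: is_exp_of_def)
  then have "fps_deriv K = fps_deriv L" by simp
  then show ?thesis using assms by (simp add: is_exp_of_def fps_deriv_eq_iff)
qed

lemma is_exp_of_prod:
  assumes "\<And>i. i \<in> I \<Longrightarrow> is_exp_of (K i) (F i)"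
  shows "is_exp_of (\<Sum>i\<in>I. K i) (\<Prod>i\<in>I. F i)"
  using assms
proof (induction I rule: infinite_finite_induct)
  case (insert i I)
  then have "is_exp_of (K i) (F i)" "is_exp_of (\<Sum>i\<in>I. K i) (\<Prod>i\<in>I. F i)" by auto
  then show ?case using insert.hyps by (simp add: is_exp_of_def algebra_simps)
qed (auto simp: is_exp_of_def)

lemma is_exp_of_coeff_iff:
  "fps_deriv F = fps_deriv K * F \<longleftrightarrow>
     (\<forall>j. of_nat (Suc j) * fps_nth F (Suc j) =
        (\<Sum>i=0..j. of_nat (Suc i) * fps_nth K (Suc i) * fps_nth F (j - i)))"
  by (simp add: fps_eq_iff fps_mult_nth)

lemma is_exp_of_scale:
  assumes "is_exp_of K F"
  shows "is_exp_of (Abs_fps (\<lambda>k. c ^ k * fps_nth K k)) (Abs_fps (\<lambda>k. c ^ k * fps_nth F k))"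
  unfolding is_exp_of_def is_exp_of_coeff_iff
proof (intro conjI allI)
  fix j
  have "of_nat (Suc j) * fps_nth F (Suc j) =
      (\<Sum>i=0..j. of_nat (Suc i) * fps_nth K (Suc i) * fps_nth F (j - i))"
    using assms unfolding is_exp_of_def is_exp_of_coeff_iff by blast
  then have "c ^ Suc j * (of_nat (Suc j) * fps_nth F (Suc j)) =
      (\<Sum>i=0..j. c ^ Suc j * (of_nat (Suc i) * fps_nth K (Suc i) * fps_nth F (j - i)))"
    by (simp only: sum_distrib_left)
  also have "\<dots> = (\<Sum>i=0..j. of_nat (Suc i) * (c ^ Suc i * fps_nth K (Suc i)) * (c ^ (j - i) * fps_nth F (j - i)))"
  proof (rule sum.cong)
    fix i assume "i \<in> {0..j}"
    then have "c ^ Suc j = c ^ Suc i * c ^ (j - i)" by (simp flip: power_add)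
    then show "c ^ Suc j * (of_nat (Suc i) * fps_nth K (Suc i) * fps_nth F (j - i)) =
        of_nat (Suc i) * (c ^ Suc i * fps_nth K (Suc i)) * (c ^ (j - i) * fps_nth F (j - i))"
      by (simp only: mult_ac)
  qed simp
  finally show "of_nat (Suc j) * fps_nth (Abs_fps (\<lambda>k. c ^ k * fps_nth F k)) (Suc j) =
      (\<Sum>i=0..j. of_nat (Suc i) * fps_nth (Abs_fps (\<lambda>k. c ^ k * fps_nth K k)) (Suc i) *
        fps_nth (Abs_fps (\<lambda>k. c ^ k * fps_nth F k)) (j - i))"
    by (simp only: fps_nth_Abs_fps mult_ac)
qed (use assms in \<open>auto simp: is_exp_of_def\<close>)

definition exp_gen_fps :: "(nat \<Rightarrow> 'a) \<Rightarrow> 'a::field_char_0 fps" where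
  "exp_gen_fps a = Abs_fps (\<lambda>k. a k / fact k)"

text \<open>The value at index \<open>0\<close> is overridden, since a logarithm of a series with constant term
\<open>1\<close> has constant term \<open>0\<close> whereas \<open>recursive_cumulant \<mu> 0 = \<mu>
0\<close>.\<close>

definition cumulant_fps :: "(nat \<Rightarrow> 'a) \<Rightarrow> 'a::field_char_0 fps" where
  "cumulant_fps x = Abs_fps (\<lambda>j. if j = 0 then 0 else x j / fact j)"

text \<open>The recursion for the cumulants is \<open>F' = K' F\<close> written out in coefficients. It holds for every
sequence that starts with \<open>1\<close>, also when it is a sequence of moments only up to some index.\<close>

lemma is_exp_of_recursive_cumulant:
  assumes "\<mu> 0 = 1"
  shows "is_exp_of (cumulant_fps (recursive_cumulant \<mu>)) (exp_gen_fps \<mu>)"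
  unfolding is_exp_of_def is_exp_of_coeff_iff
proof (intro conjI allI)
  fix j
  let ?\<kappa> = "recursive_cumulant \<mu>"
  have "of_nat (Suc j) * fps_nth (exp_gen_fps \<mu>) (Suc j) = \<mu> (Suc j) / fact j"
    by (simp add: exp_gen_fps_def del: of_nat_Suc)
  also have "\<mu> (Suc j) = (\<Sum>l=0..j. of_nat (j choose l) * \<mu> l * ?\<kappa> (Suc j - l))"
    using recursive_cumulant_recursion[of \<mu> "Suc j", OF assms] by simp
  also have "\<dots> / fact j = (\<Sum>l=0..j. of_nat (j choose l) * \<mu> l * ?\<kappa> (Suc j - l) / fact j)"
    by (rule sum_divide_distrib)
  also have "\<dots> = (\<Sum>i=0..j. of_nat (j choose (j - i)) * \<mu> (j - i) * ?\<kappa> (Suc j - (j - i)) / fact j)"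
    by (rule sum.atLeastAtMost_rev[of _ 0 j, simplified])
  also have "\<dots> = (\<Sum>i=0..j. of_nat (Suc i) * fps_nth (cumulant_fps ?\<kappa>) (Suc i) * fps_nth (exp_gen_fps \<mu>) (j - i))"
  proof (rule sum.cong)
    fix i assume i: "i \<in> {0..j}"
    then have "Suc j - (j - i) = Suc i" by auto
    moreover have "real (j choose (j - i)) / fact j = 1 / (fact i * fact (j - i))"
      using i by (simp add: binomial_fact mult.commute)
    ultimately have "of_nat (j choose (j - i)) * \<mu> (j - i) * ?\<kappa> (Suc j - (j - i)) / fact j
        = \<mu> (j - i) * ?\<kappa> (Suc i) * (1 / (fact i * fact (j - i)))"
      by (metis (no_types, opaque_lifting) mult.commute mult.left_commute times_divide_eq_right)
    also have "\<dots> = of_nat (Suc i) * fps_nth (cumulant_fps ?\<kappa>) (Suc i) * fps_nth (exp_gen_fps \<mu>) (j - i)"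
      by (simp add: cumulant_fps_def exp_gen_fps_def del: of_nat_Suc)
    finally show "of_nat (j choose (j - i)) * \<mu> (j - i) * ?\<kappa> (Suc j - (j - i)) / fact j
        = of_nat (Suc i) * fps_nth (cumulant_fps ?\<kappa>) (Suc i) * fps_nth (exp_gen_fps \<mu>) (j - i)" .
  qed simp
  finally show "of_nat (Suc j) * fps_nth (exp_gen_fps \<mu>) (Suc j) =
    (\<Sum>i=0..j. of_nat (Suc i) * fps_nth (cumulant_fps ?\<kappa>) (Suc i) * fps_nth (exp_gen_fps \<mu>) (j - i))" .
qed (use assms in \<open>auto simp: cumulant_fps_def exp_gen_fps_def\<close>)

text \<open>Partitions as multisets, so that a part can be added or removed without sorting.\<close>

definition mset_partitions :: "nat \<Rightarrow> nat multiset set" where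
  "mset_partitions k = {M. 0 \<notin># M \<and> sum_mset M = k}"

text \<open>The summand of the partition formula as a product over the distinct parts: \<open>x\<^sub>i / i!\<close> to
the power of the multiplicity of \<open>i\<close>, over the factorial of this multiplicity.\<close>

definition mset_weight :: "(nat \<Rightarrow> 'a::field_char_0) \<Rightarrow> nat multiset \<Rightarrow> 'a" where
  "mset_weight x M = (\<Prod>i\<in>set_mset M. (x i / fact i) ^ count M i / fact (count M i))"

lemma prod_list_map_count:
  fixes f :: "'b \<Rightarrow> 'c::comm_monoid_mult"
  shows "prod_list (map f l) = (\<Prod>i\<in>set l. f i ^ count_list l i)"
proof (induction l)
  case (Cons a l)
  have "(\<Prod>i\<in>set (a # l). f i ^ count_list (a # l) i)
      = (\<Prod>i\<in>insert a (set l). (if i = a then f i else 1) * f i ^ count_list l i)"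
    by (intro prod.cong) auto
  also have "\<dots> = f a * (\<Prod>i\<in>insert a (set l). f i ^ count_list l i)"
    by (subst prod.distrib) simp
  also have "(\<Prod>i\<in>insert a (set l). f i ^ count_list l i) = (\<Prod>i\<in>set l. f i ^ count_list l i)"
    by (intro prod.mono_neutral_right) (auto simp: count_list_0_iff)
  finally show ?case using Cons.IH by simp
qed simp

lemma mset_weight_mset: "mset_weight x (mset \<pi>) = part_prod x \<pi> / of_nat (y_part \<pi>)"
  by (simp add: mset_weight_def part_prod_def prod_list_map_count y_part_def count_mset power_divide
      of_nat_prod prod_dividef prod.distrib)

lemma bij_betw_int_partitions: "bij_betw mset (int_partitions k) (mset_partitions k)"
proof (rule bij_betw_byWitness[where f' = "\<lambda>M. rev (sorted_list_of_multiset M)"])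
  show "\<forall>\<pi>\<in>int_partitions k. rev (sorted_list_of_multiset (mset \<pi>)) = \<pi>"
  proof
    fix \<pi> assume "\<pi> \<in> int_partitions k"
    then have "sorted (rev \<pi>)" by (simp add: int_partitions_def sorted_wrt_rev)
    then have "sort (rev \<pi>) = rev \<pi>" by (rule sorted_sort_id)
    then have "sort \<pi> = rev \<pi>" by (metis mset_rev properties_for_sort sorted_sort mset_sort)
    then show "rev (sorted_list_of_multiset (mset \<pi>)) = \<pi>" by simp
  qed
  show "\<forall>M\<in>mset_partitions k. mset (rev (sorted_list_of_multiset M)) = M" by simp
  show "mset ` int_partitions k \<subseteq> mset_partitions k"
    by (force simp: int_partitions_def mset_partitions_def sum_mset_sum_list)
  show "(\<lambda>M. rev (sorted_list_of_multiset M)) ` mset_partitions k \<subseteq> int_partitions k"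
  proof (intro image_subsetI)
    fix M assume M: "M \<in> mset_partitions k"
    have "sum_list (sorted_list_of_multiset M) = k"
      using M sum_mset_sum_list[of "sorted_list_of_multiset M"] by (simp add: mset_partitions_def)
    then show "rev (sorted_list_of_multiset M) \<in> int_partitions k"
      using M sorted_sorted_list_of_multiset[of M]
      by (auto simp: int_partitions_def mset_partitions_def sorted_wrt_rev Suc_le_eq intro: gr0I)
  qed
qed

lemma finite_int_partitions: "finite (int_partitions k)"
proof (rule finite_subset)
  show "int_partitions k \<subseteq> {\<pi>. set \<pi> \<subseteq> {..k} \<and> length \<pi> \<le> k}"
  proof (intro subsetI)
    fix \<pi> assume \<pi>: "\<pi> \<in> int_partitions k"
    then have sum: "sum_list \<pi> = k" and pos: "\<forall>j\<in>set \<pi>. 1 \<le> j" by (auto simp: int_partitions_def)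
    have "length \<pi> \<le> sum_list \<pi>" using pos by (induction \<pi>) auto
    moreover have "j \<le> sum_list \<pi>" if "j \<in> set \<pi>" for j using that by (intro member_le_sum_list) auto
    ultimately show "\<pi> \<in> {\<pi>. set \<pi> \<subseteq> {..k} \<and> length \<pi> \<le> k}" using sum by auto
  qed
  show "finite {\<pi>. set \<pi> \<subseteq> {..k} \<and> length \<pi> \<le> k}" by (rule finite_lists_length_le) simp
qed

lemma finite_mset_partitions: "finite (mset_partitions k)"
  using bij_betw_finite[OF bij_betw_int_partitions] finite_int_partitions by blast

lemma mset_weight_add:
  "of_nat (Suc (count N j)) * mset_weight x (add_mset j N) = x j / fact j * mset_weight x N"
proof -
  let ?h = "\<lambda>M i. (x i / fact i) ^ count M i / fact (count M i)"
  have ins: "mset_weight x N = prod (?h N) (insert j (set_mset N))"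
    unfolding mset_weight_def by (intro prod.mono_neutral_left) (auto simp: not_in_iff)
  have "mset_weight x (add_mset j N) = prod (?h (add_mset j N)) (insert j (set_mset N))"
    by (simp add: mset_weight_def)
  also have "\<dots> = ?h (add_mset j N) j * prod (?h (add_mset j N)) (set_mset N - {j})"
    by (subst prod.insert_remove) auto
  also have "prod (?h (add_mset j N)) (set_mset N - {j}) = prod (?h N) (set_mset N - {j})"
    by (intro prod.cong) auto
  also have "?h (add_mset j N) j = x j / fact j / of_nat (Suc (count N j)) * ?h N j"
    by (simp del: of_nat_Suc)
  finally show ?thesis
    unfolding ins by (subst prod.insert_remove) (auto simp del: of_nat_Suc)
qed

lemma sum_mset_eq_sum_count: "sum_mset M = (\<Sum>j\<in>set_mset M. j * count M j)" for M :: "nat multiset"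
proof (induction M)
  case (add a M)
  have "(\<Sum>j\<in>set_mset (add_mset a M). j * count (add_mset a M) j)
      = (\<Sum>j\<in>insert a (set_mset M). (if j = a then a else 0) + j * count M j)"
    by (intro sum.cong) auto
  also have "\<dots> = a + (\<Sum>j\<in>insert a (set_mset M). j * count M j)"
    by (subst sum.distrib) simp
  also have "(\<Sum>j\<in>insert a (set_mset M). j * count M j) = (\<Sum>j\<in>set_mset M. j * count M j)"
    by (intro sum.mono_neutral_right) (auto simp: not_in_iff)
  finally show ?case using add.IH by simp
qed simp

text \<open>Write \<open>k\<close> as the sum of \<open>j\<close> times the multiplicity of \<open>j\<close> over the
distinct parts \<open>j\<close> of a partition of \<open>k\<close>, and remove one copy of \<open>j\<close>:
the pairs of a partition of \<open>k\<close> and one of its distinct parts \<open>j\<close> correspond to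
the pairs of \<open>j\<close> and a partition of \<open>k - j\<close>, and the multiplicity cancels against
the factorial in the weight.\<close>

lemma partition_sum_recursion:
  fixes x :: "nat \<Rightarrow> 'a::field_char_0"
  shows "of_nat k * (\<Sum>M\<in>mset_partitions k. mset_weight x M) =
    (\<Sum>j\<in>{1..k}. of_nat j * (x j / fact j) * (\<Sum>N\<in>mset_partitions (k - j). mset_weight x N))"
proof -
  have "of_nat k * (\<Sum>M\<in>mset_partitions k. mset_weight x M)
      = (\<Sum>M\<in>mset_partitions k. \<Sum>j\<in>set_mset M. of_nat j * (of_nat (count M j) * mset_weight x M))"
    unfolding sum_distrib_left
  proof (rule sum.cong)
    fix M assume "M \<in> mset_partitions k"
    then have "k = (\<Sum>j\<in>set_mset M. j * count M j)"
      using sum_mset_eq_sum_count[of M] by (simp add: mset_partitions_def)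
    then show "of_nat k * mset_weight x M = (\<Sum>j\<in>set_mset M. of_nat j * (of_nat (count M j) * mset_weight x M))"
      by (simp add: sum_distrib_right mult.assoc)
  qed simp
  also have "\<dots> = (\<Sum>(M, j)\<in>Sigma (mset_partitions k) set_mset. of_nat j * (of_nat (count M j) * mset_weight x M))"
    by (rule sum.Sigma) (auto intro: finite_mset_partitions)
  also have "\<dots> = (\<Sum>(j, N)\<in>Sigma {1..k} (\<lambda>j. mset_partitions (k - j)). of_nat j * (x j / fact j * mset_weight x N))"
  proof (rule sum.reindex_bij_witness[where i = "\<lambda>(j, N). (add_mset j N, j)" and j = "\<lambda>(M, j). (j, M - {#j#})"])
    fix Mj assume "Mj \<in> Sigma (mset_partitions k) set_mset"
    then obtain M j where Mj: "Mj = (M, j)" "M \<in> mset_partitions k" "j \<in># M" by auto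
    then obtain N where N: "M = add_mset j N" by (metis insert_DiffM)
    have j: "j \<noteq> 0" using Mj by (auto simp: mset_partitions_def intro: gr0I)
    show "(case case Mj of (M, j) \<Rightarrow> (j, M - {#j#}) of (j, N) \<Rightarrow> (add_mset j N, j)) = Mj"
      using Mj N by simp
    show "(case Mj of (M, j) \<Rightarrow> (j, M - {#j#})) \<in> Sigma {1..k} (\<lambda>j. mset_partitions (k - j))"
      using Mj N j by (auto simp: mset_partitions_def)
    show "(case case Mj of (M, j) \<Rightarrow> (j, M - {#j#}) of (j, N) \<Rightarrow> of_nat j * (x j / fact j * mset_weight x N))
        = (case Mj of (M, j) \<Rightarrow> of_nat j * (of_nat (count M j) * mset_weight x M))"
      using mset_weight_add[of N j x] by (simp add: Mj(1) N del: of_nat_Suc)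
  next
    fix jN assume "jN \<in> Sigma {1..k} (\<lambda>j. mset_partitions (k - j))"
    then show "(case case jN of (j, N) \<Rightarrow> (add_mset j N, j) of (M, j) \<Rightarrow> (j, M - {#j#})) = jN"
      and "(case jN of (j, N) \<Rightarrow> (add_mset j N, j)) \<in> Sigma (mset_partitions k) set_mset"
      by (auto simp: mset_partitions_def)
  qed
  also have "\<dots> = (\<Sum>j\<in>{1..k}. \<Sum>N\<in>mset_partitions (k - j). of_nat j * (x j / fact j * mset_weight x N))"
    by (rule sum.Sigma[symmetric]) (auto intro: finite_mset_partitions)
  also have "\<dots> = (\<Sum>j\<in>{1..k}. of_nat j * (x j / fact j) * (\<Sum>N\<in>mset_partitions (k - j). mset_weight x N))"
    by (simp add: sum_distrib_left mult.assoc)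
  finally show ?thesis .
qed

lemma fps_exp_eq_partition_sum:
  "fps_compose (fps_exp 1) (cumulant_fps x) = Abs_fps (\<lambda>k. \<Sum>M\<in>mset_partitions k. mset_weight x M)"
proof -
  let ?a = "\<lambda>k. \<Sum>M\<in>mset_partitions k. mset_weight x M"
  have "mset_partitions 0 = {{#}}"
    by (auto simp: mset_partitions_def) (metis gr0I multiset_nonemptyE)
  then have 0: "?a 0 = 1" by (simp add: mset_weight_def)
  have "is_exp_of (cumulant_fps x) (Abs_fps ?a)"
    unfolding is_exp_of_def is_exp_of_coeff_iff
  proof (intro conjI allI)
    fix j
    have "of_nat (Suc j) * ?a (Suc j) = (\<Sum>i\<in>{1..Suc j}. of_nat i * (x i / fact i) * ?a (Suc j - i))"
      by (rule partition_sum_recursion)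
    also have "\<dots> = (\<Sum>i=0..j. of_nat (Suc i) * (x (Suc i) / fact (Suc i)) * ?a (Suc j - Suc i))"
      using sum.shift_bounds_cl_Suc_ivl[of "\<lambda>i. of_nat i * (x i / fact i) * ?a (Suc j - i)" 0 j] by simp
    finally show "of_nat (Suc j) * fps_nth (Abs_fps ?a) (Suc j) =
      (\<Sum>i=0..j. of_nat (Suc i) * fps_nth (cumulant_fps x) (Suc i) * fps_nth (Abs_fps ?a) (j - i))"
      by (simp add: cumulant_fps_def del: of_nat_Suc fact_Suc)
  qed (use 0 in \<open>auto simp: cumulant_fps_def\<close>)
  from is_exp_of_imp_eq_compose[OF this] show ?thesis by simp
qed

lemma fps_exp_nth_eq_partition_sum:
  "fps_nth (fps_compose (fps_exp 1) (cumulant_fps x)) k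
     = (\<Sum>\<pi>\<in>int_partitions k. part_prod x \<pi> / of_nat (y_part \<pi>))"
  unfolding fps_exp_eq_partition_sum mset_weight_mset[symmetric]
  by (simp add: sum.reindex_bij_betw[OF bij_betw_int_partitions])

theorem complete_bell_eq_partition_sum:
  "complete_bell k x / fact k = (\<Sum>\<pi>\<in>int_partitions k. part_prod x \<pi> / of_nat (y_part \<pi>))"
  unfolding fps_exp_nth_eq_partition_sum[symmetric] by (simp add: complete_bell_def cumulant_fps_def)

section \<open>Moments of linear combinations\<close>

lemma abs_powr_even: "even m \<Longrightarrow> 0 < m \<Longrightarrow> \<bar>x::real\<bar> powr real m = x ^ m"
  by (cases "x = 0") (auto simp: powr_realpow power_even_abs)

lemma (in prob_space) indep_power_sum_integral:
  fixes U V :: "'a \<Rightarrow> real"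
  assumes ind: "indep_var borel U borel V"
    and U: "\<And>l. l \<le> k \<Longrightarrow> integrable M (\<lambda>\<omega>. U \<omega> ^ l)" and V: "\<And>l. l \<le> k \<Longrightarrow> integrable M (\<lambda>\<omega>. V \<omega> ^ l)"
  shows "(\<integral>\<omega>. (U \<omega> + V \<omega>) ^ k \<partial>M) / fact k
    = (\<Sum>l\<le>k. (\<integral>\<omega>. U \<omega> ^ l \<partial>M) / fact l * ((\<integral>\<omega>. V \<omega> ^ (k - l) \<partial>M) / fact (k - l)))"
proof -
  have ind': "indep_var borel (\<lambda>\<omega>. U \<omega> ^ l) borel (\<lambda>\<omega>. V \<omega> ^ j)" for l j
    using indep_var_compose[OF ind, of "\<lambda>x. x ^ l" borel "\<lambda>x. x ^ j" borel] by (simp add: comp_def)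
  have int: "integrable M (\<lambda>\<omega>. U \<omega> ^ l * V \<omega> ^ (k - l))" if "l \<le> k" for l
    using that by (intro indep_var_integrable ind' U V) auto
  have "(\<integral>\<omega>. (U \<omega> + V \<omega>) ^ k \<partial>M) = (\<integral>\<omega>. (\<Sum>l\<le>k. real (k choose l) * (U \<omega> ^ l * V \<omega> ^ (k - l))) \<partial>M)"
    by (simp add: binomial_ring mult.assoc)
  also have "\<dots> = (\<Sum>l\<le>k. real (k choose l) * (\<integral>\<omega>. U \<omega> ^ l * V \<omega> ^ (k - l) \<partial>M))"
    using int by (subst Bochner_Integration.integral_sum) auto
  also have "\<dots> = (\<Sum>l\<le>k. real (k choose l) * ((\<integral>\<omega>. U \<omega> ^ l \<partial>M) * (\<integral>\<omega>. V \<omega> ^ (k - l) \<partial>M)))"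
    by (intro sum.cong refl arg_cong2[of _ _ _ _ "(*)"] indep_var_lebesgue_integral ind' U V) auto
  finally show ?thesis
    by (simp add: sum_divide_distrib binomial_fact field_simps)
qed

context iid_family
begin

abbreviation \<mu> :: "nat \<Rightarrow> real" where "\<mu> \<equiv> moment P (X 0)"

lemma moment_0: "\<mu> 0 = 1"
  by (simp add: moment_def prob_space)

lemma integral_ident:
  fixes h :: "real \<Rightarrow> real"
  assumes i: "i < n" and h: "h \<in> borel_measurable borel"
  shows "(\<integral>\<omega>. h (X i \<omega>) \<partial>P) = (\<integral>\<omega>. h (X 0 \<omega>) \<partial>P)"
proof -
  have "(\<integral>\<omega>. h (X i \<omega>) \<partial>P) = (\<integral>y. h y \<partial>distr P borel (X i))"
    by (rule integral_distr[symmetric, OF X_measurable[OF i] h])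
  also have "\<dots> = (\<integral>y. h y \<partial>distr P borel (X 0))" using ident[of i 0] i by simp
  also have "\<dots> = (\<integral>\<omega>. h (X 0 \<omega>) \<partial>P)"
    using n by (intro integral_distr[OF X_measurable h]) simp
  finally show ?thesis .
qed

lemma integrable_ident:
  fixes h :: "real \<Rightarrow> real"
  assumes i: "i < n" and h: "h \<in> borel_measurable borel"
  shows "integrable P (\<lambda>\<omega>. h (X i \<omega>)) \<longleftrightarrow> integrable P (\<lambda>\<omega>. h (X 0 \<omega>))"
proof -
  have "integrable P (\<lambda>\<omega>. h (X i \<omega>)) \<longleftrightarrow> integrable (distr P borel (X i)) h"
    by (rule integrable_distr_eq[symmetric, OF X_measurable[OF i] h])
  also have "distr P borel (X i) = distr P borel (X 0)" using ident[of i 0] i by simp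
  also have "integrable (distr P borel (X 0)) h \<longleftrightarrow> integrable P (\<lambda>\<omega>. h (X 0 \<omega>))"
    using n by (intro integrable_distr_eq[OF X_measurable h]) simp
  finally show ?thesis .
qed

lemma lin_indep:
  assumes j: "j < n"
  shows "indep_var borel (\<lambda>\<omega>. X j \<omega> * x j) borel (\<lambda>\<omega>. \<Sum>i<j. X i \<omega> * x i)"
proof -
  have "indep_vars (\<lambda>_. borel) (\<lambda>i \<omega>. X i \<omega> * x i) {..<n}"
    by (rule indep_vars_compose2[OF indep, where Y = "\<lambda>i y. y * x i"]) auto
  then have "indep_vars (\<lambda>_. borel) (\<lambda>i \<omega>. X i \<omega> * x i) (insert j {..<j})"
    by (rule indep_vars_subset) (use j in auto)
  from indep_vars_sum[OF _ _ this] show ?thesis by simp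
qed

text \<open>By the binomial theorem and independence, normalized moments of a sum are the Cauchy product of those of its
terms. The number of variables in the sum is a separate parameter, so that they can be added one at a time.\<close>

lemma prefix_power_integral:
  assumes "j \<le> n" "real k \<le> d"
  shows "(\<integral>\<omega>. (\<Sum>i<j. X i \<omega> * x i) ^ k \<partial>P) / fact k
    = fps_nth (\<Prod>i<j. Abs_fps (\<lambda>k. x i ^ k * fps_nth (exp_gen_fps \<mu>) k)) k"
  using assms
proof (induction j arbitrary: k)
  case 0
  then show ?case by (cases k) (auto simp: prob_space)
next
  case (Suc j)
  have pre: "(\<lambda>\<omega>. \<Sum>i<j. X i \<omega> * x i) \<in> Lp_rv P d"
    using Lp_rv_scale[OF Lp] Suc.prems d by (intro Lp_rv_sum) (auto simp: mult.commute[of "X _ _"])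
  have last: "(\<lambda>\<omega>. X j \<omega> * x j) \<in> Lp_rv P d"
    using Lp_rv_scale[OF Lp[of j], of "x j"] Suc.prems by (simp add: mult.commute)
  let ?F = "\<lambda>i. Abs_fps (\<lambda>k. x i ^ k * fps_nth (exp_gen_fps \<mu>) k)"
  have "(\<integral>\<omega>. (\<Sum>i<Suc j. X i \<omega> * x i) ^ k \<partial>P) / fact k
      = (\<integral>\<omega>. (X j \<omega> * x j + (\<Sum>i<j. X i \<omega> * x i)) ^ k \<partial>P) / fact k"
    by (simp add: add.commute)
  also have "\<dots> = (\<Sum>l\<le>k. (\<integral>\<omega>. (X j \<omega> * x j) ^ l \<partial>P) / fact l
      * ((\<integral>\<omega>. (\<Sum>i<j. X i \<omega> * x i) ^ (k - l) \<partial>P) / fact (k - l)))"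
    using Suc.prems by (intro indep_power_sum_integral lin_indep integrable_power_le[OF pre] integrable_power_le[OF last]) auto
  also have "\<dots> = (\<Sum>l\<le>k. fps_nth (?F j) l * fps_nth (\<Prod>i<j. ?F i) (k - l))"
  proof (intro sum.cong refl arg_cong2[of _ _ _ _ "(*)"])
    fix l assume l: "l \<in> {..k}"
    show "(\<integral>\<omega>. (\<Sum>i<j. X i \<omega> * x i) ^ (k - l) \<partial>P) / fact (k - l) = fps_nth (\<Prod>i<j. ?F i) (k - l)"
      using Suc.prems by (intro Suc.IH) auto
    have "(\<integral>\<omega>. X j \<omega> ^ l \<partial>P) = \<mu> l"
      using integral_ident[of j "\<lambda>y. y ^ l"] Suc.prems by (simp add: moment_def)
    then show "(\<integral>\<omega>. (X j \<omega> * x j) ^ l \<partial>P) / fact l = fps_nth (?F j) l"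
      by (simp add: power_mult_distrib exp_gen_fps_def)
  qed
  also have "\<dots> = fps_nth (?F j * (\<Prod>i<j. ?F i)) k"
    by (simp add: fps_mult_nth atLeast0AtMost)
  also have "?F j * (\<Prod>i<j. ?F i) = (\<Prod>i<Suc j. ?F i)"
    by (simp add: mult.commute)
  finally show ?case .
qed

lemma gauge_power:
  assumes m: "d = real m" "even m"
  shows "rv_gauge x ^ m = (\<integral>\<omega>. lin x \<omega> ^ m \<partial>P) / fact m"
proof -
  have m0: "0 < m" using d m by simp
  have "rv_gauge x ^ m = rv_gauge x powr real m"
    using m0 gauge_nonneg[of x] by (cases "rv_gauge x = 0") (auto simp: powr_realpow)
  also have "\<dots> = (\<integral>\<omega>. \<bar>lin x \<omega>\<bar> powr d \<partial>P) / Gamma (d + 1)"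
  proof -
    have "0 \<le> (\<integral>\<omega>. \<bar>lin x \<omega>\<bar> powr d \<partial>P) / Gamma (d + 1)"
      using d by (intro divide_nonneg_pos integral_nonneg_AE Gamma_real_pos) auto
    then show ?thesis unfolding rv_gauge_def using m0 m(1) by (simp add: powr_powr)
  qed
  also have "Gamma (d + 1) = fact m" unfolding m(1) by (metis Gamma_fact add.commute)
  finally show ?thesis using m m0 by (simp add: abs_powr_even)
qed

lemma gauge_power_eq_coeff:
  assumes m: "d = real m" "even m"
  shows "rv_gauge x ^ m = fps_nth (\<Prod>i<n. Abs_fps (\<lambda>k. x i ^ k * fps_nth (exp_gen_fps \<mu>) k)) m"
  unfolding gauge_power[OF m] using prefix_power_integral[of n m x] m by simp

text \<open>The logarithm of the product of the series \<open>F(x\<^sub>i t)\<close> is the sum of the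
\<open>K(x\<^sub>i t)\<close>, in which the power sums of \<open>x\<close> appear.\<close>

lemma gauge_power_eq_partition_sum_recursive:
  assumes m: "d = real m" "even m"
  shows "rv_gauge x ^ m = (\<Sum>\<pi>\<in>int_partitions m.
    part_prod (\<lambda>r. recursive_cumulant \<mu> r * (\<Sum>i<n. x i ^ r)) \<pi> / of_nat (y_part \<pi>))"
proof -
  let ?K = "cumulant_fps (recursive_cumulant \<mu>)"
  have "is_exp_of (\<Sum>i<n. Abs_fps (\<lambda>k. x i ^ k * fps_nth ?K k))
      (\<Prod>i<n. Abs_fps (\<lambda>k. x i ^ k * fps_nth (exp_gen_fps \<mu>) k))"
    by (intro is_exp_of_prod is_exp_of_scale is_exp_of_recursive_cumulant moment_0)
  also have "(\<Sum>i<n. Abs_fps (\<lambda>k. x i ^ k * fps_nth ?K k))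
      = cumulant_fps (\<lambda>r. recursive_cumulant \<mu> r * (\<Sum>i<n. x i ^ r))"
    by (rule fps_ext) (auto simp: fps_sum_nth cumulant_fps_def sum_distrib_left sum_divide_distrib mult.commute)
  finally have "(\<Prod>i<n. Abs_fps (\<lambda>k. x i ^ k * fps_nth (exp_gen_fps \<mu>) k))
      = fps_compose (fps_exp 1) (cumulant_fps (\<lambda>r. recursive_cumulant \<mu> r * (\<Sum>i<n. x i ^ r)))"
    by (rule is_exp_of_imp_eq_compose)
  then show ?thesis
    unfolding gauge_power_eq_coeff[OF m] by (simp only: fps_exp_nth_eq_partition_sum)
qed

end

section \<open>Moment generating functions\<close>

lemma exp_series_partial_sum_le:
  fixes u :: real
  assumes "0 \<le> u"
  shows "(\<Sum>k<N. u ^ k / fact k) \<le> exp u"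
proof -
  have "(\<lambda>k. u ^ k / fact k) sums exp u"
    using exp_converges[of u] by (simp add: divide_inverse mult.commute)
  then show ?thesis using assms
    by (metis (no_types, lifting) divide_nonneg_pos fact_gt_zero sum_le_suminf sums_iff finite_lessThan zero_le_power)
qed

text \<open>Integration of the exponential series term by term is justified by the integrable bound \<open>exp \<bar>t
Y\<bar> \<le> exp (t Y) + exp (- t Y)\<close>, which holds for all partial sums of absolute values.\<close>

lemma (in prob_space) mgf_has_fps_expansion:
  fixes Y :: "'a \<Rightarrow> real"
  assumes Y [measurable]: "Y \<in> borel_measurable M" and mgf: "admits_mgf M Y"
  shows "mgf M Y has_fps_expansion exp_gen_fps (moment M Y)"
proof (rule has_fps_expansionI)
  obtain \<epsilon> where \<epsilon>: "0 < \<epsilon>" "\<And>t. \<bar>t\<bar> < \<epsilon> \<Longrightarrow> integrable M (\<lambda>\<omega>. exp (t * Y \<omega>))"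
    using mgf by (auto simp: admits_mgf_def)
  have sums: "(\<lambda>k. fps_nth (exp_gen_fps (moment M Y)) k * t ^ k) sums mgf M Y t" if t: "\<bar>t\<bar> < \<epsilon>" for t
  proof -
    let ?f = "\<lambda>k \<omega>. (t * Y \<omega>) ^ k / fact k"
    let ?B = "\<lambda>\<omega>. exp (t * Y \<omega>) + exp (- t * Y \<omega>)"
    have intB: "integrable M ?B" using \<epsilon>(2)[of t] \<epsilon>(2)[of "- t"] t by auto
    have partial: "(\<Sum>k<N. norm (?f k \<omega>)) \<le> ?B \<omega>" for N \<omega>
    proof -
      have "(\<Sum>k<N. norm (?f k \<omega>)) = (\<Sum>k<N. \<bar>t * Y \<omega>\<bar> ^ k / fact k)"
        by (simp add: power_abs)
      also have "\<dots> \<le> exp \<bar>t * Y \<omega>\<bar>" by (rule exp_series_partial_sum_le) simp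
      also have "\<dots> \<le> ?B \<omega>" by (cases "0 \<le> t * Y \<omega>") (auto simp: abs_if)
      finally show ?thesis .
    qed
    have int: "integrable M (?f k)" for k
    proof (rule Bochner_Integration.integrable_bound[OF intB])
      show "AE \<omega> in M. norm (?f k \<omega>) \<le> norm (?B \<omega>)"
      proof (rule AE_I2)
        fix \<omega>
        have "norm (?f k \<omega>) \<le> (\<Sum>k<Suc k. norm (?f k \<omega>))"
          by (rule member_le_sum) auto
        also have "\<dots> \<le> ?B \<omega>" by (rule partial)
        also have "\<dots> \<le> norm (?B \<omega>)" by simp
        finally show "norm (?f k \<omega>) \<le> norm (?B \<omega>)" .
      qed
    qed measurable
    have exps: "(\<lambda>k. u ^ k / fact k) sums exp u" for u :: real
      using exp_converges[of u] by (simp add: divide_inverse mult.commute)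
    have "(\<lambda>k. \<integral>\<omega>. ?f k \<omega> \<partial>M) sums (\<integral>\<omega>. suminf (\<lambda>k. ?f k \<omega>) \<partial>M)"
    proof (rule sums_integral[OF int])
      show "AE \<omega> in M. summable (\<lambda>k. norm (?f k \<omega>))"
        by (intro AE_I2 summableI_nonneg_bounded[OF _ partial]) auto
      show "summable (\<lambda>k. \<integral>\<omega>. norm (?f k \<omega>) \<partial>M)"
      proof (rule summableI_nonneg_bounded)
        fix N
        have "(\<Sum>k<N. \<integral>\<omega>. norm (?f k \<omega>) \<partial>M) = (\<integral>\<omega>. (\<Sum>k<N. norm (?f k \<omega>)) \<partial>M)"
          by (rule Bochner_Integration.integral_sum[symmetric]) (intro integrable_norm int)
        also have "\<dots> \<le> (\<integral>\<omega>. ?B \<omega> \<partial>M)"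
          by (intro integral_mono partial intB Bochner_Integration.integrable_sum integrable_norm int)
        finally show "(\<Sum>k<N. \<integral>\<omega>. norm (?f k \<omega>) \<partial>M) \<le> (\<integral>\<omega>. ?B \<omega> \<partial>M)" .
      qed (auto intro: integral_nonneg_AE)
    qed
    also have "(\<integral>\<omega>. suminf (\<lambda>k. ?f k \<omega>) \<partial>M) = mgf M Y t"
      unfolding mgf_def using exps by (simp add: sums_iff)
    also have "(\<lambda>k. \<integral>\<omega>. ?f k \<omega> \<partial>M) = (\<lambda>k. fps_nth (exp_gen_fps (moment M Y)) k * t ^ k)"
      by (simp add: fun_eq_iff power_mult_distrib exp_gen_fps_def moment_def)
    finally show ?thesis .
  qed
  have "eventually (\<lambda>t. t \<in> {- \<epsilon><..<\<epsilon>}) (nhds 0)"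
    using \<epsilon>(1) by (intro eventually_nhds_in_open) auto
  then show "eventually (\<lambda>t. (\<lambda>k. fps_nth (exp_gen_fps (moment M Y)) k * t ^ k) sums mgf M Y t) (nhds 0)"
    by eventually_elim (use sums in auto)
qed

text \<open>The coefficients vanish one after the other, because derivatives of the zero function are zero. The argument
needs only derivatives within the field, so that it covers the real numbers.\<close>

lemma has_fps_expansion_eventually_0:
  fixes F :: "'a::{banach, real_normed_field} fps"
  assumes "(\<lambda>_. 0) has_fps_expansion F"
  shows "F = 0"
proof (rule fps_ext)
  fix k
  show "fps_nth F k = fps_nth 0 k"
    using assms
  proof (induction k arbitrary: F)
    case 0
    then have "eventually (\<lambda>z. eval_fps F z = 0) (nhds 0)" by (simp add: has_fps_expansion_def)
    then have "eval_fps F 0 = 0" by (rule eventually_nhds_x_imp_x)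
    then show ?case by (simp add: eval_fps_at_0)
  next
    case (Suc k)
    from has_fps_expansion_deriv[OF Suc.prems] have "(\<lambda>_. 0) has_fps_expansion fps_deriv F" by simp
    then have "fps_nth (fps_deriv F) k = fps_nth 0 k" by (rule Suc.IH)
    then have "of_nat (Suc k) * fps_nth F (Suc k) = 0" by (simp only: fps_deriv_nth fps_zero_nth Suc_eq_plus1)
    then show ?case using of_nat_neq_0[of k] by (metis fps_zero_nth mult_eq_0_iff)
  qed
qed

lemma has_fps_expansion_unique:
  fixes F G :: "'a::{banach, real_normed_field} fps"
  assumes "f has_fps_expansion F" "f has_fps_expansion G"
  shows "F = G"
  using has_fps_expansion_eventually_0[of "F - G"] has_fps_expansion_diff[OF assms] by simp

text \<open>Termwise integration multiplies the coefficients by factors at most \<open>1\<close> and shifts them by one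
place.\<close>

lemma conv_radius_fps_integral0:
  fixes L :: "real fps"
  shows "fps_conv_radius L \<le> fps_conv_radius (fps_integral0 L)"
  unfolding fps_conv_radius_def
proof (rule conv_radius_geI_ex')
  fix r :: real assume r: "0 < r" "ereal r < conv_radius (fps_nth L)"
  have "summable (\<lambda>k. norm (fps_nth L k * of_real r ^ k))"
    using r by (intro abs_summable_in_conv_radius) auto
  then have "summable (\<lambda>k. r * norm (fps_nth L k * of_real r ^ k))" by (rule summable_mult)
  then have "summable (\<lambda>k. fps_nth (fps_integral0 L) (Suc k) * of_real r ^ Suc k)"
  proof (rule summable_comparison_test'[where N = 0])
    fix k
    have "\<bar>inverse (1 + real k)\<bar> \<le> 1" by (simp add: field_simps)
    then have "\<bar>inverse (1 + real k)\<bar> * (r * \<bar>fps_nth L k * r ^ k\<bar>) \<le> r * \<bar>fps_nth L k * r ^ k\<bar>"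
      using r by (intro mult_left_le_one_le) auto
    then show "norm (fps_nth (fps_integral0 L) (Suc k) * of_real r ^ Suc k) \<le> r * norm (fps_nth L k * of_real r ^ k)"
      using r by (simp add: fps_integral_def abs_mult mult_ac)
  qed
  then show "summable (\<lambda>k. fps_nth (fps_integral0 L) k * of_real r ^ k)"
    by (subst (asm) summable_Suc_iff)
qed

text \<open>The candidate \<open>K\<close> is the formal integral of \<open>F' / F\<close>. Near \<open>0\<close> it
converges, has the same derivative as \<open>ln f\<close>, and agrees with it at \<open>0\<close>.\<close>

lemma ln_has_fps_expansion:
  fixes f :: "real \<Rightarrow> real"
  assumes f: "f has_fps_expansion F" and F0: "fps_nth F 0 = 1"
  obtains K where "is_exp_of K F" "(\<lambda>t. ln (f t)) has_fps_expansion K"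
proof -
  define L where "L = fps_deriv F * inverse F"
  define K where "K = fps_integral0 L"
  have L: "(\<lambda>t. deriv f t * inverse (f t)) has_fps_expansion L"
    unfolding L_def using F0 by (intro has_fps_expansion_mult has_fps_expansion_deriv has_fps_expansion_inverse f) auto
  have dK: "fps_deriv K = L" by (simp add: K_def fps_deriv_fps_integral)
  have "inverse F * F = 1" using F0 by (intro inverse_mult_eq_1) auto
  then have isK: "is_exp_of K F"
    using F0 by (simp add: is_exp_of_def dK L_def mult.assoc) (simp add: K_def fps_integral_def)
  have rL: "0 < fps_conv_radius L" using L by (simp add: has_fps_expansion_def)
  then have rK: "0 < fps_conv_radius K" using conv_radius_fps_integral0[of L] by (simp add: K_def)
  have rF: "0 < fps_conv_radius F" using f by (simp add: has_fps_expansion_def)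
  have "eventually (\<lambda>z. eval_fps F z = f z) (nhds 0)" using f by (simp add: has_fps_expansion_def)
  then have "eval_fps F 0 = f 0" by (rule eventually_nhds_x_imp_x)
  then have f0: "f 0 = 1" using F0 by (simp add: eval_fps_at_0)
  have "isCont f 0" using has_fps_expansion_imp_continuous[OF f] by (simp add: continuous_within)
  then have "(f \<longlongrightarrow> f 0) (nhds 0)" by (simp only: isCont_def tendsto_at_iff_tendsto_nhds)
  then have "(f \<longlongrightarrow> 1) (nhds 0)" by (simp add: f0)
  then have pos: "eventually (\<lambda>t. 0 < f t) (nhds 0)" by (rule order_tendstoD) simp
  have "eventually (\<lambda>t. eval_fps F t = f t) (nhds 0)" "eventually (\<lambda>t. eval_fps L t = deriv f t * inverse (f t)) (nhds 0)"
    using f L by (auto simp: has_fps_expansion_def)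
  moreover have "eventually (\<lambda>t. t \<in> eball 0 (fps_conv_radius F)) (nhds 0)" "eventually (\<lambda>t. t \<in> eball 0 (fps_conv_radius K)) (nhds 0)"
    using rF rK by (rule_tac eventually_nhds_in_open; simp add: zero_ereal_def)+
  ultimately have "eventually (\<lambda>t. eval_fps F t = f t \<and> eval_fps L t = deriv f t * inverse (f t) \<and> 0 < f t
      \<and> t \<in> eball 0 (fps_conv_radius F) \<and> t \<in> eball 0 (fps_conv_radius K)) (nhds 0)"
    using pos by eventually_elim auto
  then obtain r where r: "0 < r" "\<And>t. dist t 0 < r \<Longrightarrow> eval_fps F t = f t \<and> eval_fps L t = deriv f t * inverse (f t) \<and> 0 < f t
      \<and> t \<in> eball 0 (fps_conv_radius F) \<and> t \<in> eball 0 (fps_conv_radius K)"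
    unfolding eventually_nhds_metric by blast
  have "\<exists>c. \<forall>t\<in>ball 0 r. eval_fps K t - ln (f t) = c"
  proof (rule has_field_derivative_zero_constant)
    fix t :: real assume t: "t \<in> ball 0 r"
    then have P: "eval_fps F t = f t" "eval_fps L t = deriv f t * inverse (f t)" "0 < f t"
       "t \<in> eball 0 (fps_conv_radius F)" "t \<in> eball 0 (fps_conv_radius K)"
      using r(2)[of t] by (auto simp: dist_commute)
    have "(eval_fps F has_field_derivative eval_fps (fps_deriv F) t) (at t)"
      using P by (intro has_field_derivative_eval_fps) auto
    moreover have "eventually (\<lambda>u. eval_fps F u = f u) (nhds t)"
      using eventually_nhds_in_open[OF open_ball t] by eventually_elim (use r(2) in \<open>auto simp: dist_commute\<close>)
    ultimately have "(f has_field_derivative eval_fps (fps_deriv F) t) (at t)"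
      by (subst (asm) DERIV_cong_ev[OF refl _ refl])
    then have f': "(f has_field_derivative deriv f t) (at t)" by (metis DERIV_imp_deriv)
    have "(eval_fps K has_field_derivative eval_fps L t) (at t)"
      using P has_field_derivative_eval_fps[of t K UNIV] by (simp add: dK)
    from DERIV_diff[OF this DERIV_chain2[OF DERIV_ln[OF P(3)] f']]
    have "((\<lambda>t. eval_fps K t - ln (f t)) has_field_derivative 0) (at t)" by (simp add: P(2) mult.commute)
    then show "((\<lambda>t. eval_fps K t - ln (f t)) has_field_derivative 0) (at t within ball 0 r)"
      by (rule has_field_derivative_at_within)
  qed simp
  then obtain c where c: "\<forall>t\<in>ball 0 r. eval_fps K t - ln (f t) = c" by blast
  have "c = 0" using bspec[OF c, of 0] r(1) isK by (simp add: f0 eval_fps_at_0 is_exp_of_def)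
  have "eventually (\<lambda>t. t \<in> ball 0 r) (nhds (0::real))" using r(1) by (intro eventually_nhds_in_open) auto
  then have "eventually (\<lambda>t. eval_fps K t = ln (f t)) (nhds 0)"
    by eventually_elim (use c \<open>c = 0\<close> in auto)
  then have "(\<lambda>t. ln (f t)) has_fps_expansion K" using rK by (simp add: has_fps_expansion_def)
  with isK show ?thesis by (rule that)
qed

text \<open>Both definitions of cumulants give the logarithm of the moment series, and this logarithm is unique. At
index \<open>0\<close> they differ.\<close>

lemma (in prob_space) cumulant_eq_recursive_cumulant:
  fixes Y :: "'a \<Rightarrow> real"
  assumes Y: "Y \<in> borel_measurable M" and r: "1 \<le> r"
  shows "cumulant M Y r = recursive_cumulant (moment M Y) r"
proof (cases "admits_mgf M Y")
  case True
  let ?F = "exp_gen_fps (moment M Y)"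
  have 0: "moment M Y 0 = 1" by (simp add: moment_def prob_space)
  then have "fps_nth ?F 0 = 1" by (simp add: exp_gen_fps_def)
  then obtain K where K: "is_exp_of K ?F" "(\<lambda>t. ln (mgf M Y t)) has_fps_expansion K"
    by (rule ln_has_fps_expansion[OF mgf_has_fps_expansion[OF Y True]])
  have "(THE F. (\<lambda>t. ln (mgf M Y t)) has_fps_expansion F) = K"
    using K(2) by (intro the_equality) (auto intro: has_fps_expansion_unique)
  moreover have "K = cumulant_fps (recursive_cumulant (moment M Y))"
    by (rule is_exp_of_unique_log[OF K(1) is_exp_of_recursive_cumulant]) (rule 0)
  ultimately show ?thesis using True r by (simp add: cumulant_def cumulant_fps_def)
qed (simp add: cumulant_def)

lemma part_prod_cong: "(\<And>j. j \<in> set \<pi> \<Longrightarrow> f j = h j) \<Longrightarrow> part_prod f \<pi> = part_prod h \<pi>"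
  unfolding part_prod_def by (metis map_cong)

context iid_family
begin

lemma cumulant_X: "1 \<le> r \<Longrightarrow> cumulant P (X 0) r = recursive_cumulant \<mu> r"
  using n by (intro cumulant_eq_recursive_cumulant) auto

theorem gauge_power_eq_partition_sum:
  assumes m: "d = real m" "even m"
  shows "rv_gauge x ^ m = (\<Sum>\<pi>\<in>int_partitions m.
    part_prod (\<lambda>r. cumulant P (X 0) r * (\<Sum>i<n. x i ^ r)) \<pi> / of_nat (y_part \<pi>))"
  unfolding gauge_power_eq_partition_sum_recursive[OF m]
  by (intro sum.cong refl arg_cong2[of _ _ _ _ "(/)"] part_prod_cong)
     (auto simp: cumulant_X int_partitions_def)

lemma lin_mgf:
  assumes int: "\<forall>i<n. integrable P (\<lambda>\<omega>. exp (x i * t * X i \<omega>))"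
  shows "integrable P (\<lambda>\<omega>. exp (t * (\<Sum>i<n. x i * X i \<omega>)))"
    and "mgf P (\<lambda>\<omega>. \<Sum>i<n. x i * X i \<omega>) t = (\<Prod>i<n. mgf P (X 0) (x i * t))"
proof -
  have ind: "indep_vars (\<lambda>_. borel) (\<lambda>i \<omega>. exp (x i * t * X i \<omega>)) {..<n}"
    by (rule indep_vars_compose2[OF indep, where Y = "\<lambda>i y. exp (x i * t * y)"]) auto
  have e: "exp (t * (\<Sum>i<n. x i * X i \<omega>)) = (\<Prod>i<n. exp (x i * t * X i \<omega>))" for \<omega>
    by (simp add: exp_sum[symmetric] sum_distrib_left mult_ac)
  show "integrable P (\<lambda>\<omega>. exp (t * (\<Sum>i<n. x i * X i \<omega>)))"
    unfolding e using int by (intro indep_vars_integrable ind) auto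
  have "mgf P (\<lambda>\<omega>. \<Sum>i<n. x i * X i \<omega>) t = (\<Prod>i<n. \<integral>\<omega>. exp (x i * t * X i \<omega>) \<partial>P)"
    unfolding mgf_def e using int by (intro indep_vars_lebesgue_integral ind) auto
  also have "\<dots> = (\<Prod>i<n. mgf P (X 0) (x i * t))"
    unfolding mgf_def by (intro prod.cong refl integral_ident[where h = "\<lambda>y. exp (x _ * t * y)"]) auto
  finally show "mgf P (\<lambda>\<omega>. \<Sum>i<n. x i * X i \<omega>) t = (\<Prod>i<n. mgf P (X 0) (x i * t))" .
qed

lemma lin_admits_mgf:
  assumes mgf: "admits_mgf P (X 0)"
  shows "admits_mgf P (\<lambda>\<omega>. \<Sum>i<n. x i * X i \<omega>)"
proof -
  obtain \<epsilon> where \<epsilon>: "0 < \<epsilon>" "\<And>t. \<bar>t\<bar> < \<epsilon> \<Longrightarrow> integrable P (\<lambda>\<omega>. exp (t * X 0 \<omega>))"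
    using mgf by (auto simp: admits_mgf_def)
  \<comment> \<open>every \<open>\<bar>x i * t\<bar>\<close> is at most \<open>b * \<bar>t\<bar>\<close>; the summand \<open>1\<close> keeps \<open>b\<close> positive\<close>
  define b where "b = 1 + (\<Sum>i<n. \<bar>x i\<bar>)"
  have b: "0 < b" by (simp add: b_def add_pos_nonneg sum_nonneg)
  have "integrable P (\<lambda>\<omega>. exp (t * (\<Sum>i<n. x i * X i \<omega>)))" if t: "\<bar>t\<bar> < \<epsilon> / b" for t
  proof (rule lin_mgf(1), intro allI impI)
    fix i assume i: "i < n"
    have "\<bar>x i\<bar> \<le> (\<Sum>i<n. \<bar>x i\<bar>)" by (rule member_le_sum) (use i in auto)
    then have "\<bar>x i\<bar> \<le> b" by (simp add: b_def)
    then have "\<bar>x i * t\<bar> \<le> b * \<bar>t\<bar>" by (simp add: abs_mult mult_right_mono)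
    also have "\<dots> < \<epsilon>" using t b by (simp add: field_simps)
    finally show "integrable P (\<lambda>\<omega>. exp (x i * t * X i \<omega>))"
      using integrable_ident[OF i, of "\<lambda>y. exp (x i * t * y)"] \<epsilon>(2) by simp
  qed
  then show ?thesis unfolding admits_mgf_def using \<epsilon>(1) b by (intro exI[of _ "\<epsilon> / b"]) auto
qed

lemma prod_mgf_has_fps_expansion:
  assumes mgf: "admits_mgf P (X 0)"
  shows "(\<lambda>t. \<Prod>i<n. mgf P (X 0) (x i * t)) has_fps_expansion
    (\<Prod>i<n. Abs_fps (\<lambda>k. x i ^ k * fps_nth (exp_gen_fps \<mu>) k))"
proof (rule has_fps_expansion_prod)
  fix i assume "i \<in> {..<n}"
  obtain \<epsilon> where \<epsilon>: "0 < \<epsilon>" "\<And>t. \<bar>t\<bar> < \<epsilon> \<Longrightarrow> integrable P (\<lambda>\<omega>. exp (t * X 0 \<omega>))"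
    using mgf by (auto simp: admits_mgf_def)
  let ?Y = "\<lambda>\<omega>. x i * X 0 \<omega>"
  have "integrable P (\<lambda>\<omega>. exp (t * ?Y \<omega>))" if "\<bar>t\<bar> < \<epsilon> / (1 + \<bar>x i\<bar>)" for t
  proof -
    have "\<bar>t * x i\<bar> \<le> \<bar>t\<bar> * (1 + \<bar>x i\<bar>)" by (simp add: abs_mult mult_left_mono)
    also have "\<dots> < \<epsilon>" using that by (simp add: field_simps)
    finally show ?thesis using \<epsilon>(2)[of "t * x i"] by (simp add: mult.assoc)
  qed
  then have "admits_mgf P ?Y"
    unfolding admits_mgf_def using \<epsilon>(1) by (intro exI[of _ "\<epsilon> / (1 + \<bar>x i\<bar>)"]) auto
  then have "mgf P ?Y has_fps_expansion exp_gen_fps (moment P ?Y)"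
    using n by (intro mgf_has_fps_expansion) auto
  moreover have "mgf P ?Y = (\<lambda>t. mgf P (X 0) (x i * t))" by (simp add: fun_eq_iff mgf_def mult_ac)
  moreover have "exp_gen_fps (moment P ?Y) = Abs_fps (\<lambda>k. x i ^ k * fps_nth (exp_gen_fps \<mu>) k)"
    by (simp add: fps_eq_iff exp_gen_fps_def moment_def power_mult_distrib)
  ultimately show "(\<lambda>t. mgf P (X 0) (x i * t)) has_fps_expansion Abs_fps (\<lambda>k. x i ^ k * fps_nth (exp_gen_fps \<mu>) k)"
    by simp
qed

end

section \<open>Traces and polynomial functions\<close>

lemma mat_trace_smult: "mat_trace (c \<cdot>\<^sub>m A) = c * mat_trace A" if "A \<in> carrier_mat n n" for A :: "complex mat"
  using that by (simp add: mat_trace_def sum_distrib_left)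

lemma mat_trace_comm:
  fixes A B :: "complex mat"
  assumes A: "A \<in> carrier_mat n m" and B: "B \<in> carrier_mat m n"
  shows "mat_trace (A * B) = mat_trace (B * A)"
proof -
  have "mat_trace (A * B) = (\<Sum>i<n. \<Sum>k<m. A $$ (i, k) * B $$ (k, i))"
    using A unfolding mat_trace_def by (intro sum.cong mat_mult_index_sum[OF A B]) auto
  also have "\<dots> = (\<Sum>k<m. \<Sum>i<n. B $$ (k, i) * A $$ (i, k))"
    by (subst sum.swap) (simp add: mult.commute)
  also have "\<dots> = mat_trace (B * A)"
    using B unfolding mat_trace_def by (intro sum.cong mat_mult_index_sum[OF B A, symmetric]) auto
  finally show ?thesis .
qed

lemma real_diag_pow: "real_diag n x ^\<^sub>m k = real_diag n (\<lambda>i. x i ^ k)"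
proof (induction k)
  case 0
  show ?case by (rule eq_matI) (auto simp: real_diag_def)
next
  case (Suc k)
  show ?case
  proof (rule eq_matI)
    fix i j assume "i < dim_row (real_diag n (\<lambda>i. x i ^ Suc k))" "j < dim_col (real_diag n (\<lambda>i. x i ^ Suc k))"
    then have ij: "i < n" "j < n" by (auto simp: real_diag_def)
    have "(real_diag n x ^\<^sub>m Suc k) $$ (i, j) = (\<Sum>l<n. real_diag n (\<lambda>i. x i ^ k) $$ (i, l) * real_diag n x $$ (l, j))"
      by (simp only: pow_mat.simps Suc.IH mat_mult_index_sum[OF real_diag_carrier real_diag_carrier ij])
    also have "\<dots> = (\<Sum>l<n. if l = i then real_diag n (\<lambda>i. x i ^ Suc k) $$ (i, j) else 0)"
      using ij by (intro sum.cong) (auto simp: real_diag_def)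
    finally show "(real_diag n x ^\<^sub>m Suc k) $$ (i, j) = real_diag n (\<lambda>i. x i ^ Suc k) $$ (i, j)"
      using ij by simp
  qed (auto simp: real_diag_def)
qed

lemma power_sum_eigvals_diagonalized:
  assumes A: "A \<in> carrier_mat n n" and U: "unitary n U" and D: "mat_adjoint U * A * U = real_diag n x"
  shows "power_sum k (eigvals A) = (\<Sum>i<n. x i ^ k)"
proof -
  let ?l = "rev (sort (map x [0..<n]))"
  have "power_sum k (eigvals A) = (\<Sum>i<n. (?l ! i) ^ k)"
    unfolding eigvals_diagonalized[OF A U D] power_sum_def by (simp add: vec_of_list_index)
  also have "\<dots> = sum_list (map (\<lambda>y. y ^ k) ?l)"
    by (simp add: sum_list_sum_nth atLeast0LessThan)
  also have "\<dots> = (\<Sum>y\<in>#mset ?l. y ^ k)" by (simp only: mset_map[symmetric] sum_mset_sum_list)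
  also have "\<dots> = (\<Sum>y\<in>#mset (map x [0..<n]). y ^ k)" by simp
  also have "\<dots> = sum_list (map (\<lambda>y. y ^ k) (map x [0..<n]))" by (simp only: mset_map[symmetric] sum_mset_sum_list)
  also have "\<dots> = (\<Sum>i<n. x i ^ k)" by (simp add: sum_list_sum_nth atLeast0LessThan)
  finally show ?thesis .
qed

text \<open>A trace of a power is computed on the diagonal form; the order of the eigenvalues does not matter for a
power sum.\<close>

theorem hermitian_trace_power:
  assumes A: "A \<in> hermitian_mats n"
  shows "mat_trace (A ^\<^sub>m k) = of_real (power_sum k (eigvals A))"
proof -
  have Ac: "A \<in> carrier_mat n n" using A by (simp add: hermitian_mats_def)
  obtain U x where U: "unitary n U" and D: "mat_adjoint U * A * U = real_diag n x"
    by (rule hermitian_diagonalizable[OF A])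
  have c: "U \<in> carrier_mat n n" "mat_adjoint U \<in> carrier_mat n n" "real_diag n x ^\<^sub>m k \<in> carrier_mat n n"
    using U by (auto simp: unitary_def real_diag_pow)
  from diagonalized_similar[OF Ac U D] have "A ^\<^sub>m k = U * real_diag n x ^\<^sub>m k * mat_adjoint U" by (rule similar_mat_wit_pow_id)
  then have "mat_trace (A ^\<^sub>m k) = mat_trace (mat_adjoint U * (U * real_diag n x ^\<^sub>m k))"
    using mat_trace_comm[OF mult_carrier_mat[OF c(1,3)] c(2)] by simp
  also have "mat_adjoint U * (U * real_diag n x ^\<^sub>m k) = mat_adjoint U * U * real_diag n x ^\<^sub>m k"
    by (rule assoc_mult_mat[OF c(2,1,3), symmetric])
  also have "\<dots> = real_diag n (\<lambda>i. x i ^ k)"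
    using U by (simp add: unitary_def real_diag_pow left_mult_one_mat[OF real_diag_carrier])
  also have "mat_trace \<dots> = of_real (power_sum k (eigvals A))"
    unfolding power_sum_eigvals_diagonalized[OF Ac U D] by (simp add: mat_trace_def real_diag_def)
  finally show ?thesis .
qed

lemma eigvals_carrier:
  assumes "A \<in> hermitian_mats n"
  shows "eigvals A \<in> carrier_vec n"
proof -
  have Ac: "A \<in> carrier_mat n n" using assms by (simp add: hermitian_mats_def)
  obtain U x where "unitary n U" "mat_adjoint U * A * U = real_diag n x"
    by (rule hermitian_diagonalizable[OF assms])
  from eigvals_diagonalized[OF Ac this] show ?thesis by (intro carrier_vecI) simp
qed

lemma list_all2_Cons_set:
  "{ws. list_all2 (\<lambda>w p. w \<in> W p) ws (p # \<pi>)} = (\<lambda>(w, ws). w # ws) ` (W p \<times> {ws. list_all2 (\<lambda>w p. w \<in> W p) ws \<pi>})"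
  by (auto simp: list_all2_Cons2)

lemma finite_list_all2:
  assumes "\<And>p. p \<in> set \<pi> \<Longrightarrow> finite (W p)"
  shows "finite {ws. list_all2 (\<lambda>w p. w \<in> W p) ws \<pi>}"
  using assms by (induction \<pi>) (auto simp: list_all2_Cons_set)

text \<open>The distributive law for a list of factors. The summands are indexed by lists that choose one element from
each \<open>W p\<close>, which serves for words as well as for multi-indices.\<close>

lemma prod_list_sum:
  fixes f :: "'b \<Rightarrow> 'c::comm_semiring_1"
  shows "prod_list (map (\<lambda>p. sum f (W p)) \<pi>) = (\<Sum>ws | list_all2 (\<lambda>w p. w \<in> W p) ws \<pi>. prod_list (map f ws))"
proof (induction \<pi>)
  case (Cons p \<pi>)
  have "prod_list (map (\<lambda>p. sum f (W p)) (p # \<pi>))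
      = (\<Sum>w\<in>W p. \<Sum>ws | list_all2 (\<lambda>w p. w \<in> W p) ws \<pi>. f w * prod_list (map f ws))"
    by (simp add: Cons.IH sum_product)
  also have "\<dots> = (\<Sum>(w, ws)\<in>W p \<times> {ws. list_all2 (\<lambda>w p. w \<in> W p) ws \<pi>}. prod_list (map f (w # ws)))"
    by (simp add: sum.cartesian_product)
  also have "\<dots> = (\<Sum>ws | list_all2 (\<lambda>w p. w \<in> W p) ws (p # \<pi>). prod_list (map f ws))"
    unfolding list_all2_Cons_set by (subst sum.reindex) (auto simp: inj_on_def case_prod_beta)
  finally show ?case .
qed simp

lemma prod_list_map_mult:
  fixes f h :: "'b \<Rightarrow> 'c::comm_monoid_mult"
  shows "prod_list (map (\<lambda>i. f i * h i) l) = prod_list (map f l) * prod_list (map h l)"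
  by (induction l) (auto simp: mult_ac)

text \<open>The exponent vector of the product of the variables in a list.\<close>

definition list_monomial :: "'v list \<Rightarrow> 'v \<Rightarrow>\<^sub>0 nat" where
  "list_monomial l = (\<Sum>i\<leftarrow>l. Poly_Mapping.single i 1)"

lemma lookup_list_monomial: "Poly_Mapping.lookup (list_monomial l) i = count_list l i"
  by (induction l) (auto simp: list_monomial_def lookup_add lookup_single when_def)

lemma keys_list_monomial: "Poly_Mapping.keys (list_monomial l) = set l"
  by (auto simp: in_keys_iff lookup_list_monomial count_list_0_iff)

lemma mpoly_eval_superset:
  assumes "finite A" "Poly_Mapping.keys p \<subseteq> A"
  shows "mpoly_eval p v = (\<Sum>m\<in>A. Poly_Mapping.lookup p m *
    (\<Prod>i\<in>Poly_Mapping.keys m. v i ^ Poly_Mapping.lookup m i))"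
  unfolding mpoly_eval_def using assms by (intro sum.mono_neutral_left) (auto simp: in_keys_iff)

lemma mpoly_of_monomial_list:
  fixes c :: "'s \<Rightarrow> 'b::comm_semiring_1" and l :: "'s \<Rightarrow> 'v list"
  assumes S: "finite S"
  shows "\<exists>p. (\<forall>v. mpoly_eval p v = (\<Sum>s\<in>S. c s * prod_list (map v (l s)))) \<and>
    Poly_Mapping.keys p \<subseteq> list_monomial ` l ` S"
proof -
  define p where "p = (\<Sum>s\<in>S. Poly_Mapping.single (list_monomial (l s)) (c s))"
  let ?A = "list_monomial ` l ` S"
  have look: "Poly_Mapping.lookup p m = (\<Sum>s\<in>S. if list_monomial (l s) = m then c s else 0)" for m
    unfolding p_def lookup_sum lookup_single when_def ..
  have keys: "Poly_Mapping.keys p \<subseteq> ?A"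
  proof
    fix m assume "m \<in> Poly_Mapping.keys p"
    then have "(\<Sum>s\<in>S. if list_monomial (l s) = m then c s else 0) \<noteq> 0"
      unfolding in_keys_iff look .
    then obtain s where "s \<in> S" "(if list_monomial (l s) = m then c s else 0) \<noteq> 0"
      by (rule sum.not_neutral_contains_not_neutral)
    then have "s \<in> S" "list_monomial (l s) = m" by presburger+
    then show "m \<in> ?A" by blast
  qed
  show ?thesis
  proof (intro exI conjI allI)
    fix v :: "'v \<Rightarrow> 'b"
    define w where "w m = (\<Prod>i\<in>Poly_Mapping.keys m. v i ^ Poly_Mapping.lookup m i)" for m
    have w: "w (list_monomial (l s)) = prod_list (map v (l s))" for s
      unfolding w_def keys_list_monomial lookup_list_monomial prod_list_map_count ..
    have fin: "finite ?A" using S by simp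
    have "mpoly_eval p v = (\<Sum>m\<in>?A. Poly_Mapping.lookup p m * w m)"
      unfolding w_def by (rule mpoly_eval_superset[OF fin keys])
    also have "\<dots> = (\<Sum>m\<in>?A. \<Sum>s\<in>S. if list_monomial (l s) = m then c s * w m else 0)"
      unfolding look sum_distrib_right by (intro sum.cong refl) (simp only: if_distrib[of "\<lambda>x. x * _"] mult_zero_left)
    also have "\<dots> = (\<Sum>s\<in>S. \<Sum>m\<in>?A. if list_monomial (l s) = m then c s * w m else 0)"
      by (rule sum.swap)
    also have "\<dots> = (\<Sum>s\<in>S. c s * prod_list (map v (l s)))"
    proof (rule sum.cong)
      fix s assume s: "s \<in> S"
      have "(\<Sum>m\<in>?A. if list_monomial (l s) = m then c s * w m else 0)
          = (if list_monomial (l s) \<in> ?A then c s * w (list_monomial (l s)) else 0)"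
        by (rule sum.delta'[OF fin])
      also have "list_monomial (l s) \<in> ?A" using s by blast
      then have "(if list_monomial (l s) \<in> ?A then c s * w (list_monomial (l s)) else 0) = c s * prod_list (map v (l s))"
        unfolding w by (simp only: if_True)
      finally show "(\<Sum>m\<in>?A. if list_monomial (l s) = m then c s * w m else 0) = c s * prod_list (map v (l s))" .
    qed (rule refl)
    finally show "mpoly_eval p v = (\<Sum>s\<in>S. c s * prod_list (map v (l s)))" .
  qed (rule keys)
qed

lemma sum_count_list: "(\<Sum>i\<in>set l. count_list l i) = length l"
  using prod_list_map_count[of "\<lambda>_. 2::nat" l] by (simp add: power_sum[symmetric] sum_count_set)

context iid_family
begin

lemma prod_list_X_integrable:
  assumes l: "set l \<subseteq> {..<n}" and len: "real (length l) \<le> d"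
  shows "integrable P (\<lambda>\<omega>. prod_list (map (\<lambda>i. X i \<omega>) l))"
proof -
  have meas: "(\<lambda>\<omega>. prod_list (map (\<lambda>i. X i \<omega>) l)) \<in> borel_measurable P"
    using l by (induction l) auto
  \<comment> \<open>every factor is bounded by \<open>?Y\<close>, whose powers up to \<open>d\<close> are integrable\<close>
  let ?Y = "\<lambda>\<omega>. \<Sum>i<n. \<bar>X i \<omega>\<bar>"
  have "(\<lambda>\<omega>. \<bar>X i \<omega>\<bar>) \<in> Lp_rv P d" if "i < n" for i
    using Lp[OF that] by (auto simp: Lp_rv_def)
  then have "?Y \<in> Lp_rv P d" using d by (intro Lp_rv_sum) auto
  then have "integrable P (\<lambda>\<omega>. ?Y \<omega> ^ length l)" by (rule integrable_power_le[OF _ len])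
  then show ?thesis
  proof (rule Bochner_Integration.integrable_bound[OF _ meas], intro AE_I2)
    fix \<omega>
    have "\<bar>prod_list (map (\<lambda>i. X i \<omega>) l)\<bar> \<le> ?Y \<omega> ^ length l"
      using l
    proof (induction l)
      case (Cons a l)
      have "\<bar>X a \<omega>\<bar> \<le> ?Y \<omega>" by (rule member_le_sum) (use Cons.prems in auto)
      then show ?case using Cons by (auto simp: abs_mult intro!: mult_mono sum_nonneg)
    qed simp
    then show "norm (prod_list (map (\<lambda>i. X i \<omega>) l)) \<le> norm (?Y \<omega> ^ length l)" by simp
  qed
qed

text \<open>Expand the power of \<open>\<langle>X, x\<rangle>\<close> into products indexed by lists of \<open>m\<close>
indices. The expectations of the products of the \<open>X\<^sub>i\<close> become the coefficients.\<close>

theorem gauge_power_polynomial: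
  assumes m: "d = real m" "even m"
  obtains p :: "(nat \<Rightarrow>\<^sub>0 nat) \<Rightarrow>\<^sub>0 real" where "\<And>x. mpoly_eval p x = rv_gauge x ^ m"
    "mpoly_vars_in {..<n} p" "mpoly_homogeneous m p"
proof -
  define S where "S = {l. list_all2 (\<lambda>i (u::unit). i \<in> {..<n}) l (replicate m ())}"
  have S_eq: "S = {l. length l = m \<and> set l \<subseteq> {..<n}}"
    by (auto simp: S_def list_all2_conv_all_nth set_conv_nth subset_iff)
  have fin: "finite S" unfolding S_def by (rule finite_list_all2) simp
  define c where "c l = (\<integral>\<omega>. prod_list (map (\<lambda>i. X i \<omega>) l) \<partial>P) / fact m" for l
  obtain p where p: "\<forall>v. mpoly_eval p v = (\<Sum>l\<in>S. c l * prod_list (map v (id l)))"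
      "Poly_Mapping.keys p \<subseteq> list_monomial ` id ` S"
    using mpoly_of_monomial_list[OF fin, of c id] by blast
  show ?thesis
  proof (rule that)
    fix x
    have "lin x \<omega> ^ m = (\<Sum>l\<in>S. prod_list (map (\<lambda>i. X i \<omega>) l) * prod_list (map x l))" for \<omega>
    proof -
      have "lin x \<omega> ^ m = prod_list (map (\<lambda>u::unit. lin x \<omega>) (replicate m ()))" by simp
      also have "\<dots> = (\<Sum>l\<in>S. prod_list (map (\<lambda>i. X i \<omega> * x i) l))"
        unfolding S_def by (rule prod_list_sum)
      finally show ?thesis by (simp only: prod_list_map_mult)
    qed
    then have "rv_gauge x ^ m = (\<integral>\<omega>. (\<Sum>l\<in>S. prod_list (map (\<lambda>i. X i \<omega>) l) * prod_list (map x l)) \<partial>P) / fact m"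
      by (simp add: gauge_power[OF m])
    also have "\<dots> = (\<Sum>l\<in>S. (\<integral>\<omega>. prod_list (map (\<lambda>i. X i \<omega>) l) * prod_list (map x l) \<partial>P)) / fact m"
      using m by (subst Bochner_Integration.integral_sum) (auto simp: S_eq intro!: integrable_mult_left prod_list_X_integrable)
    also have "\<dots> = mpoly_eval p x" by (simp add: p c_def sum_divide_distrib)
    finally show "mpoly_eval p x = rv_gauge x ^ m" by simp
  next
    show "mpoly_vars_in {..<n} p"
      using p(2) by (force simp: mpoly_vars_in_def S_eq keys_list_monomial)
    show "mpoly_homogeneous m p"
      using p(2) by (auto simp: mpoly_homogeneous_def S_eq keys_list_monomial lookup_list_monomial sum_count_list)
  qed
qed

end

section \<open>Words in a matrix and its adjoint\<close>

lemma pow_mat_Suc_left: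
  fixes A :: "complex mat"
  assumes A: "A \<in> carrier_mat n n"
  shows "A ^\<^sub>m Suc k = A * A ^\<^sub>m k"
proof (induction k)
  case 0
  show ?case using A by simp
next
  case (Suc k)
  have "A ^\<^sub>m Suc (Suc k) = (A * A ^\<^sub>m k) * A" using Suc.IH by simp
  also have "\<dots> = A * (A ^\<^sub>m k * A)" by (rule assoc_mult_mat[OF A pow_carrier_mat[OF A] A])
  finally show ?case by simp
qed

lemma eval_letter_carrier: "Z \<in> carrier_mat n n \<Longrightarrow> eval_letter Z a \<in> carrier_mat n n"
  by (simp add: eval_letter_def split: letter.split)

lemma eval_word_Nil: "Z \<in> carrier_mat n n \<Longrightarrow> eval_word Z [] = 1\<^sub>m n"
  by (simp add: eval_word_def)

lemma eval_word_Cons: "eval_word Z (a # w) = eval_letter Z a * eval_word Z w"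
  by (simp add: eval_word_def)

lemma eval_word_carrier:
  assumes Z: "Z \<in> carrier_mat n n"
  shows "eval_word Z w \<in> carrier_mat n n"
proof (induction w)
  case Nil
  then show ?case by (simp add: eval_word_Nil[OF Z])
next
  case (Cons a w)
  then show ?case unfolding eval_word_Cons by (rule mult_carrier_mat[OF eval_letter_carrier[OF Z]])
qed

definition letter_weight :: "complex \<Rightarrow> complex \<Rightarrow> letter \<Rightarrow> complex" where
  "letter_weight a b x = (case x of Plain \<Rightarrow> a | Star \<Rightarrow> b)"

text \<open>Two free scalars allow the numbers of letters \<open>Z\<close> and \<open>Z\<^sup>*\<close> in a word to be
read off from its weight.\<close>

definition star_pencil :: "complex \<Rightarrow> complex \<Rightarrow> complex mat \<Rightarrow> complex mat" where
  "star_pencil a b Z = a \<cdot>\<^sub>m Z + b \<cdot>\<^sub>m mat_adjoint Z"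

lemma star_pencil_carrier: "Z \<in> carrier_mat n n \<Longrightarrow> star_pencil a b Z \<in> carrier_mat n n"
  by (simp add: star_pencil_def)

lemma UNIV_letter: "UNIV = {Plain, Star}"
  using letter.exhaust by auto

lemma prod_list_letter_weight:
  "prod_list (map (letter_weight a b) w) = a ^ count_list w Plain * b ^ count_list w Star"
proof (induction w)
  case (Cons x w)
  then show ?case by (cases x) (auto simp: letter_weight_def)
qed simp

lemma length_eq_count_letters: "length w = count_list w Plain + count_list w Star"
proof (induction w)
  case (Cons x w)
  then show ?case by (cases x) auto
qed simp

definition words :: "nat \<Rightarrow> letter list set" where
  "words p = {w. length w = p}"

lemma words_Suc: "words (Suc p) = (\<lambda>(x, w). x # w) ` (UNIV \<times> words p)"
  by (auto simp: words_def length_Suc_conv)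

lemma finite_words: "finite (words p)"
  by (induction p) (auto simp: words_Suc UNIV_letter, simp add: words_def)

lemma star_pencil_power_index:
  assumes Z: "Z \<in> carrier_mat n n"
  shows "i < n \<Longrightarrow> j < n \<Longrightarrow> (star_pencil a b Z ^\<^sub>m p) $$ (i, j)
    = (\<Sum>w\<in>words p. prod_list (map (letter_weight a b) w) * eval_word Z w $$ (i, j))"
proof (induction p arbitrary: i)
  case 0
  have "words 0 = {[]}" by (auto simp: words_def)
  then show ?case using Z 0 by (simp add: eval_word_Nil[OF Z] star_pencil_def)
next
  case (Suc p)
  let ?H = "star_pencil a b Z" and ?W = "\<lambda>w. prod_list (map (letter_weight a b) w)"
  note H = star_pencil_carrier[OF Z, of a b]
  have Hil: "?H $$ (i, l) = (\<Sum>x\<in>UNIV. letter_weight a b x * eval_letter Z x $$ (i, l))" if "l < n" for l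
    using Z Suc.prems that by (simp add: star_pencil_def UNIV_letter letter_weight_def eval_letter_def)
  have "(?H ^\<^sub>m Suc p) $$ (i, j) = (\<Sum>l<n. ?H $$ (i, l) * (?H ^\<^sub>m p) $$ (l, j))"
    unfolding pow_mat_Suc_left[OF H] by (rule mat_mult_index_sum[OF H pow_carrier_mat[OF H] Suc.prems])
  also have "\<dots> = (\<Sum>l<n. \<Sum>x\<in>UNIV. \<Sum>w\<in>words p.
      (letter_weight a b x * ?W w) * (eval_letter Z x $$ (i, l) * eval_word Z w $$ (l, j)))"
    using Suc.prems by (intro sum.cong refl) (simp add: Hil Suc.IH sum_product mult_ac)
  also have "\<dots> = (\<Sum>x\<in>UNIV. \<Sum>l<n. \<Sum>w\<in>words p.
      (letter_weight a b x * ?W w) * (eval_letter Z x $$ (i, l) * eval_word Z w $$ (l, j)))"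
    by (rule sum.swap)
  also have "\<dots> = (\<Sum>x\<in>UNIV. \<Sum>w\<in>words p. \<Sum>l<n.
      (letter_weight a b x * ?W w) * (eval_letter Z x $$ (i, l) * eval_word Z w $$ (l, j)))"
    by (intro sum.cong refl sum.swap)
  also have "\<dots> = (\<Sum>x\<in>UNIV. \<Sum>w\<in>words p. ?W (x # w) * eval_word Z (x # w) $$ (i, j))"
    unfolding eval_word_Cons
    by (simp only: mat_mult_index_sum[OF eval_letter_carrier[OF Z] eval_word_carrier[OF Z] Suc.prems]
        sum_distrib_left list.map prod_list.Cons)
  also have "\<dots> = (\<Sum>(x, w)\<in>UNIV \<times> words p. ?W (x # w) * eval_word Z (x # w) $$ (i, j))"
    by (rule sum.cartesian_product)
  also have "\<dots> = (\<Sum>w\<in>words (Suc p). ?W w * eval_word Z w $$ (i, j))"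
    unfolding words_Suc by (subst sum.reindex) (auto simp: inj_on_def case_prod_beta comp_def)
  finally show ?case .
qed

lemma star_pencil_power_trace:
  assumes Z: "Z \<in> carrier_mat n n"
  shows "mat_trace (star_pencil a b Z ^\<^sub>m p)
    = (\<Sum>w\<in>words p. prod_list (map (letter_weight a b) w) * mat_trace (eval_word Z w))"
proof -
  have H: "star_pencil a b Z ^\<^sub>m p \<in> carrier_mat n n"
    by (rule pow_carrier_mat[OF star_pencil_carrier[OF Z]])
  have tr: "mat_trace M = (\<Sum>i<n. M $$ (i, i))" if "M \<in> carrier_mat n n" for M :: "complex mat"
    using that by (simp add: mat_trace_def)
  have "mat_trace (star_pencil a b Z ^\<^sub>m p)
      = (\<Sum>i<n. \<Sum>w\<in>words p. prod_list (map (letter_weight a b) w) * eval_word Z w $$ (i, i))"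
    unfolding tr[OF H] by (intro sum.cong refl star_pencil_power_index[OF Z]) auto
  also have "\<dots> = (\<Sum>w\<in>words p. prod_list (map (letter_weight a b) w) * mat_trace (eval_word Z w))"
    unfolding tr[OF eval_word_carrier[OF Z]] sum_distrib_left by (rule sum.swap)
  finally show ?thesis .
qed

lemma list_all2_words: "list_all2 (\<lambda>w p. w \<in> words p) ws \<pi> \<longleftrightarrow> map length ws = \<pi>"
proof -
  have "list_all2 (\<lambda>w p. w \<in> words p) ws \<pi> \<longleftrightarrow> list_all2 (\<lambda>w p. length w = p) ws \<pi>"
    by (simp add: words_def)
  also have "\<dots> \<longleftrightarrow> map length ws = \<pi>"
    by (simp add: list_all2_map1[symmetric, where P = "(=)"] list.rel_eq)
  finally show ?thesis .
qed

lemma finite_words_tuples: "finite {ws :: letter list list. map length ws = \<pi>}"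
  using finite_list_all2[of \<pi> words] finite_words by (simp add: list_all2_words)

lemma length_concat_words: "map length ws = \<pi> \<Longrightarrow> length (concat ws) = sum_list \<pi>"
  by (auto simp: length_concat)

lemma prod_list_concat_weight:
  fixes f :: "'b list \<Rightarrow> 'c::comm_monoid_mult"
  shows "prod_list (map (\<lambda>w. prod_list (map h w) * f w) ws) = prod_list (map h (concat ws)) * prod_list (map f ws)"
  by (induction ws) (auto simp: mult_ac)

lemma star_pencil_trace_product:
  assumes Z: "Z \<in> carrier_mat n n"
  shows "prod_list (map (\<lambda>p. mat_trace (star_pencil a b Z ^\<^sub>m p)) \<pi>)
    = (\<Sum>ws | map length ws = \<pi>. a ^ count_list (concat ws) Plain * b ^ count_list (concat ws) Star
        * prod_list (map (\<lambda>w. mat_trace (eval_word Z w)) ws))"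
  unfolding star_pencil_power_trace[OF Z] prod_list_sum list_all2_words prod_list_concat_weight
  unfolding prod_list_letter_weight ..

section \<open>Averaging over rotations\<close>

definition unity_root :: "nat \<Rightarrow> complex" where
  "unity_root N = cis (2 * pi / real N)"

lemma unity_root_pow: "unity_root N ^ k = cis (2 * pi * real k / real N)"
  unfolding unity_root_def by (simp add: Complex.DeMoivre mult.commute)

lemma unity_root_inj:
  assumes "p < N" "q < N" "unity_root N ^ p = unity_root N ^ q"
  shows "p = q"
proof -
  have "inj_on (\<lambda>k. cis (2 * pi * real k / real N)) {..<N}"
    using Complex.bij_betw_roots_unity[of N] assms by (auto simp: bij_betw_def)
  then show ?thesis using assms by (auto simp: unity_root_pow inj_on_def)
qed

lemma unity_root_cnj: "cnj (unity_root N) = inverse (unity_root N)"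
  by (simp add: unity_root_def cis_cnj cis_inverse)

lemma unity_root_nonzero: "unity_root N \<noteq> 0"
  by (simp add: unity_root_def)

text \<open>A geometric sum whose ratio \<open>\<omega>\<^sup>p\<^sup>-\<^sup>q\<close> is an \<open>N\<close>th root of
unity. The ratio is \<open>1\<close> only for \<open>p = q\<close>, because both exponents are smaller than
the order \<open>N\<close>.\<close>

lemma unity_root_average:
  assumes pq: "p < N" "q < N"
  shows "(\<Sum>k<N. (unity_root N ^ k) ^ p * (cnj (unity_root N ^ k)) ^ q) = (if p = q then of_nat N else 0)"
proof -
  let ?z = "unity_root N ^ p / unity_root N ^ q"
  have term_eq: "(unity_root N ^ k) ^ p * (cnj (unity_root N ^ k)) ^ q = ?z ^ k" for k
    by (simp add: unity_root_cnj power_inverse divide_inverse power_mult_distrib power_mult[symmetric] mult.commute)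
  show ?thesis
  proof (cases "p = q")
    case True
    then show ?thesis unfolding term_eq using unity_root_nonzero[of N] by simp
  next
    case False
    then have z1: "?z \<noteq> 1" using unity_root_inj[OF pq] unity_root_nonzero[of N] by (auto simp: field_simps)
    have one: "unity_root N ^ N = 1" using pq by (simp add: unity_root_pow)
    have "?z ^ N = (unity_root N ^ N) ^ p / (unity_root N ^ N) ^ q"
      by (simp add: power_divide power_mult[symmetric] mult.commute)
    then have "?z ^ N = 1" by (simp add: one)
    then show ?thesis unfolding term_eq using geometric_sum[OF z1, of N] False by simp
  qed
qed

text \<open>The order \<open>d + 1\<close> is just large enough for words of length \<open>d\<close>: the numbers of
letters of the two kinds are at most \<open>d\<close>, so they are distinguished by powers of
\<open>\<omega>\<close>.\<close>

definition hermitian_rotation :: "nat \<Rightarrow> nat \<Rightarrow> complex mat \<Rightarrow> complex mat" where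
  "hermitian_rotation d k Z = star_pencil (unity_root (Suc d) ^ k) (cnj (unity_root (Suc d) ^ k)) Z"

lemma hermitian_rotation_hermitian:
  assumes Z: "Z \<in> carrier_mat n n"
  shows "hermitian_rotation d k Z \<in> hermitian_mats n"
proof -
  have "mat_adjoint (star_pencil c (cnj c) Z) = star_pencil c (cnj c) Z" for c
    by (rule eq_matI) (use Z in \<open>auto simp: star_pencil_def\<close>)
  then show ?thesis using star_pencil_carrier[OF Z] unfolding hermitian_mats_def hermitian_rotation_def by blast
qed

text \<open>Expand the traces into words. A word with \<open>p\<close> letters \<open>Z\<close> and \<open>q\<close>
letters \<open>Z\<^sup>*\<close> has the weight
\<open>\<omega>\<^sup>k\<^sup>(\<^sup>p\<^sup>-\<^sup>q\<^sup>)\<close>, and the sum over \<open>k\<close>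
keeps only the words with \<open>p = q\<close>.\<close>

theorem trace_product_average:
  assumes Z: "Z \<in> carrier_mat n n" and d: "even d" "sum_list \<pi> = d"
  shows "(\<Sum>k<Suc d. prod_list (map (\<lambda>p. mat_trace (hermitian_rotation d k Z ^\<^sub>m p)) \<pi>))
    = of_nat (Suc d) * of_nat (d choose (d div 2)) * T_part \<pi> Z"
proof -
  let ?tr = "\<lambda>ws. prod_list (map (\<lambda>w. mat_trace (eval_word Z w)) ws)"
  let ?P = "\<lambda>ws. count_list (concat ws) Plain" and ?S = "\<lambda>ws. count_list (concat ws) Star"
  let ?\<omega> = "unity_root (Suc d)"
  have cnt: "?P ws + ?S ws = d" if "map length ws = \<pi>" for ws
    using length_eq_count_letters[of "concat ws"] length_concat_words[OF that] d by simp
  have "(\<Sum>k<Suc d. prod_list (map (\<lambda>p. mat_trace (hermitian_rotation d k Z ^\<^sub>m p)) \<pi>))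
      = (\<Sum>k<Suc d. \<Sum>ws | map length ws = \<pi>. (?\<omega> ^ k) ^ ?P ws * (cnj (?\<omega> ^ k)) ^ ?S ws * ?tr ws)"
    unfolding hermitian_rotation_def star_pencil_trace_product[OF Z] ..
  also have "\<dots> = (\<Sum>ws | map length ws = \<pi>. \<Sum>k<Suc d. (?\<omega> ^ k) ^ ?P ws * (cnj (?\<omega> ^ k)) ^ ?S ws * ?tr ws)"
    by (rule sum.swap)
  also have "\<dots> = (\<Sum>ws | map length ws = \<pi>. if ?P ws = d div 2 then of_nat (Suc d) * ?tr ws else 0)"
  proof (rule sum.cong)
    fix ws :: "letter list list" assume "ws \<in> {ws. map length ws = \<pi>}"
    then have c: "?P ws + ?S ws = d" using cnt by simp
    then have "?P ws < Suc d" "?S ws < Suc d" by auto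
    from unity_root_average[OF this]
    have "(\<Sum>k<Suc d. (?\<omega> ^ k) ^ ?P ws * (cnj (?\<omega> ^ k)) ^ ?S ws * ?tr ws)
        = (if ?P ws = ?S ws then of_nat (Suc d) else 0) * ?tr ws"
      by (simp only: sum_distrib_right[symmetric])
    moreover have "?P ws = ?S ws \<longleftrightarrow> ?P ws = d div 2" using c d by presburger
    ultimately show "(\<Sum>k<Suc d. (?\<omega> ^ k) ^ ?P ws * (cnj (?\<omega> ^ k)) ^ ?S ws * ?tr ws)
        = (if ?P ws = d div 2 then of_nat (Suc d) * ?tr ws else 0)" by simp
  qed (rule refl)
  also have "\<dots> = (\<Sum>ws\<in>balanced_words \<pi>. of_nat (Suc d) * ?tr ws)"
    using d by (intro sum.mono_neutral_cong_right finite_words_tuples) (auto simp: balanced_words_def)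
  also have "\<dots> = of_nat (Suc d) * of_nat (d choose (d div 2)) * T_part \<pi> Z"
    using d by (simp add: T_part_def sum_distrib_left[symmetric])
  finally show ?thesis .
qed

text \<open>The same average for scalars. It evaluates the constant that occurs when the partition sum is restricted to
Hermitian matrices, without counting the balanced words.\<close>

lemma rotation_binomial_average:
  assumes "even d"
  shows "(\<Sum>k<Suc d. (2 * Re (unity_root (Suc d) ^ k)) ^ d) = real (Suc d) * real (d choose (d div 2))"
proof -
  let ?\<omega> = "unity_root (Suc d)"
  have "complex_of_real (\<Sum>k<Suc d. (2 * Re (?\<omega> ^ k)) ^ d) = (\<Sum>k<Suc d. (?\<omega> ^ k + cnj (?\<omega> ^ k)) ^ d)"
    by (simp only: of_real_sum of_real_power complex_add_cnj)
  also have "\<dots> = (\<Sum>k<Suc d. \<Sum>p\<le>d. of_nat (d choose p) * ((?\<omega> ^ k) ^ p * (cnj (?\<omega> ^ k)) ^ (d - p)))"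
    by (simp only: binomial_ring mult.assoc)
  also have "\<dots> = (\<Sum>p\<le>d. of_nat (d choose p) * (\<Sum>k<Suc d. (?\<omega> ^ k) ^ p * (cnj (?\<omega> ^ k)) ^ (d - p)))"
    unfolding sum_distrib_left by (rule sum.swap)
  also have "\<dots> = (\<Sum>p\<le>d. if p = d div 2 then of_nat (d choose p) * of_nat (Suc d) else 0)"
  proof (rule sum.cong)
    fix p assume "p \<in> {..d}"
    then have "p < Suc d" "d - p < Suc d" by auto
    moreover have "p = d - p \<longleftrightarrow> p = d div 2" using \<open>p \<in> {..d}\<close> assms by auto
    ultimately show "of_nat (d choose p) * (\<Sum>k<Suc d. (?\<omega> ^ k) ^ p * (cnj (?\<omega> ^ k)) ^ (d - p))
        = (if p = d div 2 then of_nat (d choose p) * of_nat (Suc d) else (0 :: complex))"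
      using unity_root_average[of p "Suc d" "d - p"] by simp
  qed (rule refl)
  also have "\<dots> = of_nat (d choose (d div 2)) * of_nat (Suc d)" by simp
  also have "\<dots> = complex_of_real (real (Suc d) * real (d choose (d div 2)))" by simp
  finally show ?thesis by (simp only: of_real_eq_iff)
qed

section \<open>The norm on all square matrices\<close>

text \<open>Minkowski's inequality for a counting measure.\<close>

lemma Minkowski_inequality_sum:
  fixes a b :: "nat \<Rightarrow> real"
  assumes m: "1 \<le> m" and a: "\<And>k. k < N \<Longrightarrow> 0 \<le> a k" and b: "\<And>k. k < N \<Longrightarrow> 0 \<le> b k"
  shows "root m (\<Sum>k<N. (a k + b k) ^ m) \<le> root m (\<Sum>k<N. a k ^ m) + root m (\<Sum>k<N. b k ^ m)"
proof -
  let ?M = "count_space {..<N}"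
  have Lp: "h \<in> Lp_rv ?M (real m)" for h :: "nat \<Rightarrow> real"
    by (simp add: Lp_rv_def integrable_count_space)
  have eq: "(\<integral>k. \<bar>h k\<bar> powr real m \<partial>?M) powr (1 / real m) = root m (\<Sum>k<N. h k ^ m)"
    if h: "\<And>k. k < N \<Longrightarrow> 0 \<le> h k" for h :: "nat \<Rightarrow> real"
  proof -
    have "\<bar>h k\<bar> powr real m = h k ^ m" if "k < N" for k
      using m h[OF that] by (cases "h k = 0") (auto simp: powr_realpow)
    then have I: "(\<integral>k. \<bar>h k\<bar> powr real m \<partial>?M) = (\<Sum>k<N. h k ^ m)"
      by (simp add: lebesgue_integral_count_space_finite)
    have "0 \<le> (\<Sum>k<N. h k ^ m)" using h by (intro sum_nonneg) auto
    then show ?thesis unfolding I using m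
      by (cases "(\<Sum>k<N. h k ^ m) = 0") (auto simp: root_powr_inverse)
  qed
  show ?thesis
    using Minkowski_inequality[of "real m" a ?M b, OF _ Lp Lp] m
      eq[of a] eq[of b] eq[of "\<lambda>k. a k + b k"] a b by simp
qed

lemma of_real_part_prod:
  "of_real (part_prod f \<pi>) = prod_list (map (\<lambda>p. of_real (f p) :: 'b::{real_algebra_1, comm_monoid_mult}) \<pi>)"
  unfolding part_prod_def by (induction \<pi>) auto

theorem T_part_eq_average:
  assumes Z: "Z \<in> carrier_mat n n" and m: "even m" and \<pi>: "sum_list \<pi> = m"
  shows "T_part \<pi> Z = of_real ((\<Sum>k<Suc m. part_prod (\<lambda>r. power_sum r (eigvals (hermitian_rotation m k Z))) \<pi>)
    / (real (Suc m) * real (m choose (m div 2))))"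
proof -
  have "(of_nat (Suc m) * of_nat (m choose (m div 2)) :: complex) * T_part \<pi> Z
      = (\<Sum>k<Suc m. prod_list (map (\<lambda>p. mat_trace (hermitian_rotation m k Z ^\<^sub>m p)) \<pi>))"
    by (rule trace_product_average[OF Z m \<pi>, symmetric])
  also have "\<dots> = of_real (\<Sum>k<Suc m. part_prod (\<lambda>r. power_sum r (eigvals (hermitian_rotation m k Z))) \<pi>)"
    unfolding hermitian_trace_power[OF hermitian_rotation_hermitian[OF Z]] of_real_part_prod[symmetric] of_real_sum ..
  finally have *: "(of_nat (Suc m) * of_nat (m choose (m div 2)) :: complex) * T_part \<pi> Z
      = of_real (\<Sum>k<Suc m. part_prod (\<lambda>r. power_sum r (eigvals (hermitian_rotation m k Z))) \<pi>)" .
  have nz: "(of_nat (Suc m) * of_nat (m choose (m div 2)) :: complex) \<noteq> 0"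
    by (simp del: of_nat_Suc)
  have "T_part \<pi> Z = of_real (\<Sum>k<Suc m. part_prod (\<lambda>r. power_sum r (eigvals (hermitian_rotation m k Z))) \<pi>)
      / (of_nat (Suc m) * of_nat (m choose (m div 2)))"
    unfolding *[symmetric] by (rule nonzero_mult_div_cancel_left[OF nz, symmetric])
  then show ?thesis by (simp only: of_real_divide of_real_mult of_real_of_nat_eq)
qed

lemma part_prod_mult: "part_prod (\<lambda>r. f r * h r) \<pi> = part_prod f \<pi> * part_prod h \<pi>"
  unfolding part_prod_def by (rule prod_list_map_mult)

lemma hermitian_rotation_add:
  assumes "Z \<in> carrier_mat n n" "W \<in> carrier_mat n n"
  shows "hermitian_rotation d k (Z + W) = hermitian_rotation d k Z + hermitian_rotation d k W"
  unfolding hermitian_rotation_def star_pencil_def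
  by (rule eq_matI) (use assms in \<open>auto simp: algebra_simps\<close>)

lemma hermitian_rotation_of_hermitian:
  assumes "A \<in> hermitian_mats n"
  shows "hermitian_rotation d k A = of_real (2 * Re (unity_root (Suc d) ^ k)) \<cdot>\<^sub>m A"
proof -
  have A: "A \<in> carrier_mat n n" "mat_adjoint A = A" using assms by (auto simp: hermitian_mats_def)
  have "star_pencil c (cnj c) A = of_real (2 * Re c) \<cdot>\<^sub>m A" for c
    unfolding star_pencil_def A(2) complex_add_cnj[symmetric]
    by (rule eq_matI) (use A(1) in \<open>auto simp: algebra_simps\<close>)
  then show ?thesis unfolding hermitian_rotation_def .
qed

text \<open>For \<open>k = 0\<close> the hypothesis says \<open>Z\<^sup>* = - Z\<close>, and for \<open>k = 1\<close> it
then gives \<open>\<omega> Z = \<omega>\<^sup>-\<^sup>1 Z\<close>. Here \<open>\<omega>\<^sup>2 \<noteq>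
1\<close> because the order \<open>d + 1\<close> is at least \<open>3\<close>.\<close>

lemma hermitian_rotation_all_zero:
  assumes Z: "Z \<in> carrier_mat n n" and d: "2 \<le> d"
    and zero: "\<And>k. k < Suc d \<Longrightarrow> hermitian_rotation d k Z = 0\<^sub>m n n"
  shows "Z = 0\<^sub>m n n"
proof (rule eq_matI)
  fix i j assume "i < dim_row (0\<^sub>m n n :: complex mat)" "j < dim_col (0\<^sub>m n n :: complex mat)"
  then have ij: "i < n" "j < n" by auto
  let ?\<omega> = "unity_root (Suc d)"
  have e: "?\<omega> ^ k * Z $$ (i, j) + cnj (?\<omega> ^ k) * cnj (Z $$ (j, i)) = 0" if "k < Suc d" for k
    using arg_cong[OF zero[OF that], of "\<lambda>M. M $$ (i, j)"] Z ij
    by (simp add: hermitian_rotation_def star_pencil_def)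
  have "cnj (Z $$ (j, i)) = - Z $$ (i, j)"
    using e[of 0] by (simp add: eq_neg_iff_add_eq_0 add.commute)
  then have "?\<omega> * Z $$ (i, j) = inverse ?\<omega> * Z $$ (i, j)"
    using e[of 1] d by (simp add: unity_root_cnj)
  moreover have "?\<omega> \<noteq> inverse ?\<omega>"
  proof
    assume "?\<omega> = inverse ?\<omega>"
    then have "?\<omega> ^ 2 = ?\<omega> ^ 0"
      using unity_root_nonzero[of "Suc d"] by (simp add: power2_eq_square) (metis right_inverse)
    then show False using unity_root_inj[of 2 "Suc d" 0] d by simp
  qed
  ultimately show "Z $$ (i, j) = 0\<^sub>m n n $$ (i, j)" using ij by simp
qed (use Z in auto)

lemma eval_letter_smult: "eval_letter (c \<cdot>\<^sub>m Z) x = letter_weight c (cnj c) x \<cdot>\<^sub>m eval_letter Z x"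
  by (cases x) (auto simp: eval_letter_def letter_weight_def mat_adjoint_smult)

lemma eval_word_smult:
  assumes Z: "Z \<in> carrier_mat n n"
  shows "eval_word (c \<cdot>\<^sub>m Z) w = prod_list (map (letter_weight c (cnj c)) w) \<cdot>\<^sub>m eval_word Z w"
proof (induction w)
  case Nil
  then show ?case using eval_word_Nil[OF Z] eval_word_Nil[of "c \<cdot>\<^sub>m Z" n] Z by (auto intro!: eq_matI)
next
  case (Cons x w)
  note c = eval_letter_carrier[OF Z, of x] eval_word_carrier[OF Z, of w]
  let ?a = "letter_weight c (cnj c) x" and ?b = "prod_list (map (letter_weight c (cnj c)) w)"
  have "eval_word (c \<cdot>\<^sub>m Z) (x # w) = (?a \<cdot>\<^sub>m eval_letter Z x) * (?b \<cdot>\<^sub>m eval_word Z w)"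
    by (simp only: eval_word_Cons eval_letter_smult Cons.IH)
  also have "\<dots> = ?a \<cdot>\<^sub>m (?b \<cdot>\<^sub>m (eval_letter Z x * eval_word Z w))"
    using mult_smult_assoc_mat[OF c(1) smult_carrier_mat[OF c(2)]] mult_smult_distrib[OF c] by simp
  also have "\<dots> = (?a * ?b) \<cdot>\<^sub>m (eval_letter Z x * eval_word Z w)"
    by (rule eq_matI) auto
  finally show ?case by (simp only: eval_word_Cons list.map prod_list.Cons)
qed

text \<open>Each balanced tuple of words contributes equally many factors \<open>c\<close> and \<open>cnj c\<close>.
This gives homogeneity under complex scalars, which the average over finitely many rotations does not show.\<close>

lemma T_part_smult:
  assumes Z: "Z \<in> carrier_mat n n" and m: "even m" "sum_list \<pi> = m"
  shows "T_part \<pi> (c \<cdot>\<^sub>m Z) = of_real (cmod c ^ m) * T_part \<pi> Z"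
proof -
  have "prod_list (map (\<lambda>w. mat_trace (eval_word (c \<cdot>\<^sub>m Z) w)) ws)
      = of_real (cmod c ^ m) * prod_list (map (\<lambda>w. mat_trace (eval_word Z w)) ws)"
    if ws: "ws \<in> balanced_words \<pi>" for ws
  proof -
    have P: "count_list (concat ws) Plain = m div 2"
      using ws m by (simp add: balanced_words_def)
    have "count_list (concat ws) Plain + count_list (concat ws) Star = m"
      using ws m length_eq_count_letters[of "concat ws"] length_concat_words[of ws \<pi>] by (simp add: balanced_words_def)
    then have S: "count_list (concat ws) Star = m div 2" using P m(1) by presburger
    have "prod_list (map (\<lambda>w. mat_trace (eval_word (c \<cdot>\<^sub>m Z) w)) ws)
        = prod_list (map (\<lambda>w. prod_list (map (letter_weight c (cnj c)) w) * mat_trace (eval_word Z w)) ws)"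
      unfolding eval_word_smult[OF Z] mat_trace_smult[OF eval_word_carrier[OF Z]] ..
    also have "\<dots> = c ^ (m div 2) * cnj c ^ (m div 2) * prod_list (map (\<lambda>w. mat_trace (eval_word Z w)) ws)"
      unfolding prod_list_concat_weight unfolding prod_list_letter_weight P S ..
    also have "c ^ (m div 2) * cnj c ^ (m div 2) = of_real (cmod c ^ m)"
    proof -
      have "c ^ (m div 2) * cnj c ^ (m div 2) = (of_real (cmod c ^ 2)) ^ (m div 2)"
        by (simp only: power_mult_distrib[symmetric] complex_norm_square)
      also have "\<dots> = of_real (cmod c ^ (2 * (m div 2)))" by (simp only: of_real_power power_mult)
      finally show ?thesis using m(1) by simp
    qed
    finally show ?thesis .
  qed
  then show ?thesis by (simp add: T_part_def sum_distrib_left)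
qed

lemma finite_balanced_words: "finite (balanced_words \<pi>)"
  by (rule finite_subset[OF _ finite_words_tuples[of \<pi>]]) (auto simp: balanced_words_def)

lemma trace_polynomial_combination_T_part:
  assumes J: "finite J"
  shows "trace_polynomial n (\<lambda>Z. \<Sum>\<pi>\<in>J. c \<pi> * T_part \<pi> Z)"
proof -
  let ?S = "Sigma J balanced_words"
  let ?c = "\<lambda>(\<pi>, ws::letter list list). c \<pi> / of_nat (sum_list \<pi> choose (sum_list \<pi> div 2))"
  have fin: "finite ?S" using J by (intro finite_SigmaI finite_balanced_words)
  obtain p :: "(letter list \<Rightarrow>\<^sub>0 nat) \<Rightarrow>\<^sub>0 complex"
    where p: "\<forall>v. mpoly_eval p v = (\<Sum>s\<in>?S. ?c s * prod_list (map v (snd s)))"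
    using mpoly_of_monomial_list[OF fin, of ?c snd] by blast
  have "(\<Sum>\<pi>\<in>J. c \<pi> * T_part \<pi> Z) = mpoly_eval p (\<lambda>w. mat_trace (eval_word Z w))" for Z
  proof -
    have "(\<Sum>\<pi>\<in>J. c \<pi> * T_part \<pi> Z) = (\<Sum>\<pi>\<in>J. \<Sum>ws\<in>balanced_words \<pi>.
        c \<pi> / of_nat (sum_list \<pi> choose (sum_list \<pi> div 2)) * prod_list (map (\<lambda>w. mat_trace (eval_word Z w)) ws))"
      unfolding T_part_def sum_divide_distrib sum_distrib_left by (intro sum.cong refl) simp
    also have "\<dots> = (\<Sum>(\<pi>, ws)\<in>?S.
        c \<pi> / of_nat (sum_list \<pi> choose (sum_list \<pi> div 2)) * prod_list (map (\<lambda>w. mat_trace (eval_word Z w)) ws))"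
      using J finite_balanced_words by (intro sum.Sigma) auto
    finally show ?thesis unfolding p[rule_format] by (simp add: case_prod_beta)
  qed
  then show ?thesis unfolding trace_polynomial_def by blast
qed

context iid_family
begin

abbreviation \<kappa> :: "nat \<Rightarrow> real" where "\<kappa> \<equiv> cumulant P (X 0)"

abbreviation spectral_gauge :: "complex mat \<Rightarrow> real" where
  "spectral_gauge A \<equiv> rv_gauge (vec_index (eigvals A))"

lemma herm_norm_eq: "A \<in> hermitian_mats n \<Longrightarrow> herm_norm P X d A = spectral_gauge A"
  unfolding herm_norm_def by (rule rv_vec_norm_eq_gauge[OF eigvals_carrier])

lemma spectral_gauge_power:
  assumes m: "d = real m" "even m" and A: "A \<in> hermitian_mats n"
  shows "spectral_gauge A ^ m = (\<Sum>\<pi>\<in>int_partitions m.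
    part_prod (\<lambda>r. \<kappa> r * power_sum r (eigvals A)) \<pi> / of_nat (y_part \<pi>))"
proof -
  have "dim_vec (eigvals A) = n" using eigvals_carrier[OF A] by simp
  then show ?thesis unfolding gauge_power_eq_partition_sum[OF m] power_sum_def by simp
qed

abbreviation partition_form :: "nat \<Rightarrow> complex mat \<Rightarrow> real" where
  "partition_form m Z \<equiv> (\<Sum>\<pi>\<in>int_partitions m. part_prod \<kappa> \<pi> * Re (T_part \<pi> Z) / of_nat (y_part \<pi>))"

text \<open>This identity carries the results for Hermitian matrices over to all matrices: the partition sum of
\<open>Z\<close> is a positive multiple of the sum of the \<open>m\<close>th powers of norms of Hermitian
matrices that depend real linearly on \<open>Z\<close>.\<close>

theorem partition_form_eq_average:
  assumes m: "d = real m" "even m" and Z: "Z \<in> carrier_mat n n"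
  shows "partition_form m Z = (\<Sum>k<Suc m. spectral_gauge (hermitian_rotation m k Z) ^ m)
    / (real (Suc m) * real (m choose (m div 2)))"
proof -
  let ?c = "real (Suc m) * real (m choose (m div 2))"
  have factor: "(\<Sum>k\<in>K. a * q k / y) / c = a * ((\<Sum>k\<in>K. q k) / c) / y"
    for K and q :: "nat \<Rightarrow> real" and a c y
    by (simp add: sum_distrib_left[symmetric] sum_divide_distrib[symmetric] mult.commute)
  let ?q = "\<lambda>k \<pi>. part_prod (\<lambda>r. power_sum r (eigvals (hermitian_rotation m k Z))) \<pi>"
  have "(\<Sum>k<Suc m. spectral_gauge (hermitian_rotation m k Z) ^ m) / ?c
      = (\<Sum>k<Suc m. \<Sum>\<pi>\<in>int_partitions m. part_prod \<kappa> \<pi> * ?q k \<pi> / of_nat (y_part \<pi>)) / ?c"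
    unfolding spectral_gauge_power[OF m hermitian_rotation_hermitian[OF Z]] part_prod_mult ..
  also have "\<dots> = (\<Sum>\<pi>\<in>int_partitions m. \<Sum>k<Suc m. part_prod \<kappa> \<pi> * ?q k \<pi> / of_nat (y_part \<pi>)) / ?c"
    by (subst sum.swap) (rule refl)
  also have "\<dots> = (\<Sum>\<pi>\<in>int_partitions m. part_prod \<kappa> \<pi> * ((\<Sum>k<Suc m. ?q k \<pi>) / ?c) / of_nat (y_part \<pi>))"
    unfolding sum_divide_distrib[of _ "int_partitions m"] by (intro sum.cong refl factor)
  also have "\<dots> = partition_form m Z"
  proof (rule sum.cong)
    fix \<pi> assume "\<pi> \<in> int_partitions m"
    then have "sum_list \<pi> = m" by (simp add: int_partitions_def)
    then show "part_prod \<kappa> \<pi> * ((\<Sum>k<Suc m. ?q k \<pi>) / ?c) / of_nat (y_part \<pi>)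
        = part_prod \<kappa> \<pi> * Re (T_part \<pi> Z) / of_nat (y_part \<pi>)"
      unfolding T_part_eq_average[OF Z m(2) \<open>sum_list \<pi> = m\<close>] by (simp only: Re_complex_of_real)
  qed (rule refl)
  finally show ?thesis by (rule sym)
qed

lemma mat_norm_eq_root_average:
  assumes m: "d = real m" "even m" and Z: "Z \<in> carrier_mat n n"
  shows "mat_norm \<kappa> m Z = root m (\<Sum>k<Suc m. spectral_gauge (hermitian_rotation m k Z) ^ m)
    / root m (real (Suc m) * real (m choose (m div 2)))"
  unfolding mat_norm_def partition_form_eq_average[OF m Z] by (rule real_root_divide)

lemma mat_norm_power:
  assumes m: "d = real m" "even m" and Z: "Z \<in> carrier_mat n n"
  shows "mat_norm \<kappa> m Z ^ m = partition_form m Z"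
proof -
  have "0 \<le> partition_form m Z"
    unfolding partition_form_eq_average[OF m Z]
    by (intro divide_nonneg_nonneg sum_nonneg zero_le_power gauge_nonneg) auto
  then show ?thesis unfolding mat_norm_def using m d by (intro real_root_pow_pos2) auto
qed

text \<open>For Hermitian \<open>A\<close> the rotations are the real multiples \<open>2 Re (\<omega>\<^sup>k)
A\<close>, so the average is that of the scalar factors.\<close>

theorem mat_norm_on_hermitian:
  assumes m: "d = real m" "even m" and A: "A \<in> hermitian_mats n"
  shows "mat_norm \<kappa> m A = spectral_gauge A"
proof -
  let ?c = "real (Suc m) * real (m choose (m div 2))"
  have Ac: "A \<in> carrier_mat n n" using A by (simp add: hermitian_mats_def)
  have "(\<Sum>k<Suc m. spectral_gauge (hermitian_rotation m k A) ^ m)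
      = (\<Sum>k<Suc m. (2 * Re (unity_root (Suc m) ^ k)) ^ m * spectral_gauge A ^ m)"
  proof (rule sum.cong)
    fix k
    have "spectral_gauge (hermitian_rotation m k A) = \<bar>2 * Re (unity_root (Suc m) ^ k)\<bar> * spectral_gauge A"
      unfolding hermitian_rotation_of_hermitian[OF A]
      using gauge_eigvals_norm A unfolding is_norm_on_def
      by (metis Reals_of_real norm_of_real)
    then show "spectral_gauge (hermitian_rotation m k A) ^ m = (2 * Re (unity_root (Suc m) ^ k)) ^ m * spectral_gauge A ^ m"
      using m(2) by (simp only: power_mult_distrib power_even_abs)
  qed (rule refl)
  also have "\<dots> = ?c * spectral_gauge A ^ m"
    unfolding sum_distrib_right[symmetric] rotation_binomial_average[OF m(2)] ..
  finally have "partition_form m A = spectral_gauge A ^ m"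
    unfolding partition_form_eq_average[OF m Ac] by (simp del: of_nat_Suc)
  then show ?thesis
    unfolding mat_norm_def using m d gauge_nonneg by (simp add: real_root_power_cancel)
qed

theorem mat_norm_is_norm:
  assumes m: "d = real m" "even m"
  shows "is_norm_on n UNIV (carrier_mat n n) (mat_norm \<kappa> m)"
proof -
  let ?G = "\<lambda>k Z. spectral_gauge (hermitian_rotation m k Z)"
  let ?c = "real (Suc m) * real (m choose (m div 2))"
  have m2: "2 \<le> m" using d m by simp
  have cpos: "0 < root m ?c" using m2 by (simp del: of_nat_Suc)
  have hnorm: "is_norm_on n \<real> (hermitian_mats n) spectral_gauge" by (rule gauge_eigvals_norm)
  show ?thesis
    unfolding is_norm_on_def
  proof (intro conjI ballI)
    fix Z :: "complex mat" assume Z: "Z \<in> carrier_mat n n"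
    note eq = mat_norm_eq_root_average[OF m Z]
    have nn: "0 \<le> (\<Sum>k<Suc m. ?G k Z ^ m)" by (intro sum_nonneg zero_le_power gauge_nonneg)
    show "0 \<le> mat_norm \<kappa> m Z" unfolding eq using nn cpos m2 by (intro divide_nonneg_pos) auto
    show "(mat_norm \<kappa> m Z = 0) = (Z = 0\<^sub>m n n)"
    proof
      assume "mat_norm \<kappa> m Z = 0"
      then have "root m (\<Sum>k<Suc m. ?G k Z ^ m) = 0"
        unfolding eq divide_eq_0_iff using cpos by (metis less_irrefl)
      then have "(\<Sum>k<Suc m. ?G k Z ^ m) = 0" using m2 by (metis real_root_eq_0_iff not_numeral_le_zero gr0I)
      then have "\<forall>k\<in>{..<Suc m}. ?G k Z ^ m = 0"
        by (subst (asm) sum_nonneg_eq_0_iff) (auto intro: zero_le_power gauge_nonneg)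
      then have "?G k Z = 0" if "k < Suc m" for k using that by (meson lessThan_iff power_not_zero)
      then have "hermitian_rotation m k Z = 0\<^sub>m n n" if "k < Suc m" for k
        using hnorm hermitian_rotation_hermitian[OF Z, of m k] that unfolding is_norm_on_def by metis
      then show "Z = 0\<^sub>m n n" by (rule hermitian_rotation_all_zero[OF Z m2])
    next
      assume Z0: "Z = 0\<^sub>m n n"
      have herm: "0\<^sub>m n n \<in> hermitian_mats n"
        unfolding hermitian_mats_def by (auto intro!: eq_matI)
      show "mat_norm \<kappa> m Z = 0"
        unfolding Z0 mat_norm_on_hermitian[OF m herm] using hnorm herm unfolding is_norm_on_def by metis
    qed
  next
    fix c :: complex and Z :: "complex mat" assume Z: "Z \<in> carrier_mat n n"
    have "partition_form m (c \<cdot>\<^sub>m Z) = cmod c ^ m * partition_form m Z"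
      unfolding sum_distrib_left
    proof (rule sum.cong)
      fix \<pi> assume "\<pi> \<in> int_partitions m"
      then have "sum_list \<pi> = m" by (simp add: int_partitions_def)
      moreover have "Re (of_real r * z) = r * Re z" for r z by simp
      ultimately have "Re (T_part \<pi> (c \<cdot>\<^sub>m Z)) = cmod c ^ m * Re (T_part \<pi> Z)"
        using T_part_smult[OF Z m(2), of \<pi> c] by (simp only:)
      then show "part_prod \<kappa> \<pi> * Re (T_part \<pi> (c \<cdot>\<^sub>m Z)) / of_nat (y_part \<pi>)
          = cmod c ^ m * (part_prod \<kappa> \<pi> * Re (T_part \<pi> Z) / of_nat (y_part \<pi>))" by simp
    qed (rule refl)
    then show "mat_norm \<kappa> m (c \<cdot>\<^sub>m Z) = cmod c * mat_norm \<kappa> m Z"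
      unfolding mat_norm_def using m2 by (simp only: real_root_mult) (simp add: real_root_power_cancel)
  next
    fix Z W :: "complex mat" assume Z: "Z \<in> carrier_mat n n" and W: "W \<in> carrier_mat n n"
    have ZW: "Z + W \<in> carrier_mat n n" using Z W by simp
    have "(\<Sum>k<Suc m. ?G k (Z + W) ^ m) \<le> (\<Sum>k<Suc m. (?G k Z + ?G k W) ^ m)"
    proof (intro sum_mono power_mono gauge_nonneg)
      fix k
      show "?G k (Z + W) \<le> ?G k Z + ?G k W"
        unfolding hermitian_rotation_add[OF Z W]
        using hnorm hermitian_rotation_hermitian[OF Z, of m k] hermitian_rotation_hermitian[OF W, of m k]
        unfolding is_norm_on_def by blast
    qed
    then have "root m (\<Sum>k<Suc m. ?G k (Z + W) ^ m) \<le> root m (\<Sum>k<Suc m. (?G k Z + ?G k W) ^ m)"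
      using m2 by (intro real_root_le_mono) auto
    also have "\<dots> \<le> root m (\<Sum>k<Suc m. ?G k Z ^ m) + root m (\<Sum>k<Suc m. ?G k W ^ m)"
      using m2 by (intro Minkowski_inequality_sum gauge_nonneg) auto
    finally show "mat_norm \<kappa> m (Z + W) \<le> mat_norm \<kappa> m Z + mat_norm \<kappa> m W"
      unfolding mat_norm_eq_root_average[OF m Z] mat_norm_eq_root_average[OF m W] mat_norm_eq_root_average[OF m ZW]
        add_divide_distrib[symmetric]
      using cpos by (intro divide_right_mono) auto
  qed
qed

theorem mat_norm_trace_polynomial:
  assumes m: "d = real m" "even m"
  shows "trace_polynomial n (\<lambda>Z. of_real (mat_norm \<kappa> m Z ^ m))"
proof -
  let ?c = "\<lambda>\<pi>. complex_of_real (part_prod \<kappa> \<pi> / of_nat (y_part \<pi>))"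
  have "complex_of_real (mat_norm \<kappa> m Z ^ m) = (\<Sum>\<pi>\<in>int_partitions m. ?c \<pi> * T_part \<pi> Z)"
    if Z: "Z \<in> carrier_mat n n" for Z
    unfolding mat_norm_power[OF m Z] of_real_sum
  proof (rule sum.cong)
    fix \<pi> assume "\<pi> \<in> int_partitions m"
    then have "sum_list \<pi> = m" by (simp add: int_partitions_def)
    from T_part_eq_average[OF Z m(2) this] have "complex_of_real (Re (T_part \<pi> Z)) = T_part \<pi> Z"
      by (metis Re_complex_of_real)
    then show "complex_of_real (part_prod \<kappa> \<pi> * Re (T_part \<pi> Z) / of_nat (y_part \<pi>)) = ?c \<pi> * T_part \<pi> Z"
      by (simp only: of_real_divide of_real_mult times_divide_eq_left)
  qed (rule refl)
  moreover have "trace_polynomial n (\<lambda>Z. \<Sum>\<pi>\<in>int_partitions m. ?c \<pi> * T_part \<pi> Z)"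
    by (rule trace_polynomial_combination_T_part[OF finite_int_partitions])
  ultimately show ?thesis unfolding trace_polynomial_def by metis
qed

end

section \<open>Random vector norms\<close>

theorem theorem1:
  fixes P :: "real measure" and X :: "nat \<Rightarrow> real \<Rightarrow> real" and n :: nat and d :: real
  assumes "prob_space P"
    and "1 \<le> n"
    and "2 \<le> d"
    and "\<forall>i<n. X i \<in> Lp_rv P d"
    and "\<forall>i<n. nondegenerate P (X i)"
    and "prob_space.indep_vars P (\<lambda>_. borel) X {..<n}"
    and "\<forall>i<n. \<forall>j<n. distr P borel (X i) = distr P borel (X j)"
  shows "(is_norm_on n \<real> (hermitian_mats n) (herm_norm P X d)) \<and>
     (\<forall>m::nat. d = real m \<and> even m \<and> (\<forall>i<n. admits_mgf P (X i)) \<longrightarrow>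
        (\<forall>A\<in>hermitian_mats n.
           let lam = eigvals A;
               Lam = (\<lambda>\<omega>. \<Sum>i<n. vec_index lam i * X i \<omega>);
               M_Lam = (\<lambda>t. \<Prod>i<n. mgf P (X 0) (vec_index lam i * t))
           in (\<exists>F. M_Lam has_fps_expansion F \<and> herm_norm P X d A ^ m = fps_nth F m) \<and>
              admits_mgf P Lam \<and>
              (\<forall>t. (\<forall>i<n. integrable P (\<lambda>\<omega>. exp (vec_index lam i * t * X i \<omega>))) \<longrightarrow>
                   integrable P (\<lambda>\<omega>. exp (t * Lam \<omega>)) \<and> mgf P Lam t = M_Lam t)) \<and>
        (\<exists>p :: (nat \<Rightarrow>\<^sub>0 nat) \<Rightarrow>\<^sub>0 real.
           mpoly_vars_in {..<n} p \<and>
           mpoly_homogeneous m p \<and>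
           symmetric_fun n (\<lambda>x. mpoly_eval p (vec_index x)) \<and>
           positive_definite_on (carrier_vec n) (0\<^sub>v n) (\<lambda>x. mpoly_eval p (vec_index x)) \<and>
           (\<forall>A\<in>hermitian_mats n. herm_norm P X d A ^ m = mpoly_eval p (vec_index (eigvals A))))) \<and>
     (\<forall>m::nat. d = real m \<and> even m \<and> (\<forall>i<n. \<forall>k\<in>{1..m}. integrable P (\<lambda>\<omega>. X i \<omega> ^ k)) \<longrightarrow>
        (\<forall>A\<in>hermitian_mats n.
           complex_of_real (herm_norm P X d A ^ m) =
             complete_bell m (\<lambda>j. of_real (cumulant P (X 0) j) * mat_trace (A ^\<^sub>m j)) / fact m \<and>
           herm_norm P X d A ^ m =
             (\<Sum>\<pi>\<in>int_partitions m.
                part_prod (cumulant P (X 0)) \<pi> * part_prod (\<lambda>k. power_sum k (eigvals A)) \<pi>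
                  / of_nat (y_part \<pi>)))) \<and>
     (schur_convex n (rv_vec_norm P X d)) \<and>
     (\<forall>m::nat. d = real m \<and> even m \<longrightarrow>
        (\<forall>\<pi>\<in>int_partitions m. \<forall>Z\<in>carrier_mat n n. T_part \<pi> Z \<in> \<real>) \<and>
        is_norm_on n UNIV (carrier_mat n n) (mat_norm (cumulant P (X 0)) m) \<and>
        (\<forall>A\<in>hermitian_mats n. mat_norm (cumulant P (X 0)) m A = herm_norm P X d A) \<and>
        trace_polynomial n (\<lambda>Z. of_real (mat_norm (cumulant P (X 0)) m Z ^ m)) \<and>
        positive_definite_on (carrier_mat n n) (0\<^sub>m n n)
          (\<lambda>Z. mat_norm (cumulant P (X 0)) m Z ^ m))"
proof -
  interpret iid_family P X n d
  proof (intro iid_family.intro iid_family_axioms.intro assms(1-3))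
    show "\<And>i. i < n \<Longrightarrow> X i \<in> Lp_rv P d" "\<And>i. i < n \<Longrightarrow> nondegenerate P (X i)"
      using assms(4,5) by blast+
    show "\<And>i j. i < n \<Longrightarrow> j < n \<Longrightarrow> distr P borel (X i) = distr P borel (X j)"
      using assms(7) by blast
  qed (rule assms(6))
  have norm: "is_norm_on n \<real> (hermitian_mats n) (herm_norm P X d)"
    using gauge_eigvals_norm unfolding is_norm_on_def
    by (simp add: herm_norm_eq hermitian_add hermitian_smult)
  have mgf_part: "(let lam = eigvals A;
        Lam = (\<lambda>\<omega>. \<Sum>i<n. vec_index lam i * X i \<omega>);
        M_Lam = (\<lambda>t. \<Prod>i<n. mgf P (X 0) (vec_index lam i * t))
      in (\<exists>F. M_Lam has_fps_expansion F \<and> herm_norm P X d A ^ m = fps_nth F m) \<and>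
         admits_mgf P Lam \<and>
         (\<forall>t. (\<forall>i<n. integrable P (\<lambda>\<omega>. exp (vec_index lam i * t * X i \<omega>))) \<longrightarrow>
              integrable P (\<lambda>\<omega>. exp (t * Lam \<omega>)) \<and> mgf P Lam t = M_Lam t))"
    if m: "d = real m" "even m" and mgf: "\<forall>i<n. admits_mgf P (X i)" and A: "A \<in> hermitian_mats n" for m A
  proof -
    let ?x = "vec_index (eigvals A)"
    have mgf0: "admits_mgf P (X 0)" using mgf n by simp
    have "herm_norm P X d A ^ m = fps_nth (\<Prod>i<n. Abs_fps (\<lambda>k. ?x i ^ k * fps_nth (exp_gen_fps \<mu>) k)) m"
      unfolding herm_norm_eq[OF A] by (rule gauge_power_eq_coeff[OF m])
    with prod_mgf_has_fps_expansion[OF mgf0, of ?x] lin_admits_mgf[OF mgf0, of ?x] lin_mgf[of ?x]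
    show ?thesis unfolding Let_def by blast
  qed
  have polynomial_part: "\<exists>p :: (nat \<Rightarrow>\<^sub>0 nat) \<Rightarrow>\<^sub>0 real.
      mpoly_vars_in {..<n} p \<and> mpoly_homogeneous m p \<and>
      symmetric_fun n (\<lambda>x. mpoly_eval p (vec_index x)) \<and>
      positive_definite_on (carrier_vec n) (0\<^sub>v n) (\<lambda>x. mpoly_eval p (vec_index x)) \<and>
      (\<forall>A\<in>hermitian_mats n. herm_norm P X d A ^ m = mpoly_eval p (vec_index (eigvals A)))"
    if m: "d = real m" "even m" for m
  proof -
    obtain p :: "(nat \<Rightarrow>\<^sub>0 nat) \<Rightarrow>\<^sub>0 real" where p: "\<forall>x. mpoly_eval p x = rv_gauge x ^ m"
        "mpoly_vars_in {..<n} p" "mpoly_homogeneous m p"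
      using gauge_power_polynomial[OF m] by blast
    have "symmetric_fun n (\<lambda>x. mpoly_eval p (vec_index x))"
      unfolding symmetric_fun_def p(1)[rule_format]
    proof (intro allI impI ballI)
      fix \<sigma> and x :: "real Matrix.vec" assume \<sigma>: "\<sigma> permutes {..<n}"
      have "rv_gauge (vec_index (Matrix.vec n (\<lambda>i. vec_index x (\<sigma> i)))) = rv_gauge (\<lambda>i. vec_index x (\<sigma> i))"
        by (rule gauge_cong) simp
      then show "rv_gauge (vec_index (Matrix.vec n (\<lambda>i. vec_index x (\<sigma> i)))) ^ m = rv_gauge (vec_index x) ^ m"
        by (simp add: gauge_permute[OF \<sigma>])
    qed
    moreover have "positive_definite_on (carrier_vec n) (0\<^sub>v n) (\<lambda>x. mpoly_eval p (vec_index x))"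
      unfolding positive_definite_on_def p(1)[rule_format]
    proof (intro ballI impI)
      fix x :: "real Matrix.vec" assume x: "x \<in> carrier_vec n" "x \<noteq> 0\<^sub>v n"
      have "rv_gauge (vec_index x) \<noteq> 0"
      proof
        assume "rv_gauge (vec_index x) = 0"
        then have "vec_index x i = 0" if "i < n" for i using gauge_zeroD that by blast
        then have "x = 0\<^sub>v n" using x(1) by (intro eq_vecI) auto
        with x(2) show False ..
      qed
      then show "0 < rv_gauge (vec_index x) ^ m" using gauge_nonneg[of "vec_index x"] by simp
    qed
    moreover have "\<forall>A\<in>hermitian_mats n. herm_norm P X d A ^ m = mpoly_eval p (vec_index (eigvals A))"
      using p(1) herm_norm_eq by simp
    ultimately show ?thesis using p(2,3) by blast
  qed
  have cumulant_part: "complex_of_real (herm_norm P X d A ^ m) =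
        complete_bell m (\<lambda>j. of_real (cumulant P (X 0) j) * mat_trace (A ^\<^sub>m j)) / fact m \<and>
      herm_norm P X d A ^ m =
        (\<Sum>\<pi>\<in>int_partitions m.
           part_prod (cumulant P (X 0)) \<pi> * part_prod (\<lambda>k. power_sum k (eigvals A)) \<pi>
             / of_nat (y_part \<pi>))"
    if m: "d = real m" "even m" and A: "A \<in> hermitian_mats n" for m A
  proof
    have sum: "herm_norm P X d A ^ m = (\<Sum>\<pi>\<in>int_partitions m.
        part_prod (\<lambda>r. \<kappa> r * power_sum r (eigvals A)) \<pi> / of_nat (y_part \<pi>))"
      unfolding herm_norm_eq[OF A] by (rule spectral_gauge_power[OF m A])
    then show "herm_norm P X d A ^ m = (\<Sum>\<pi>\<in>int_partitions m.
        part_prod \<kappa> \<pi> * part_prod (\<lambda>k. power_sum k (eigvals A)) \<pi> / of_nat (y_part \<pi>))"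
      unfolding part_prod_mult .
    have "complete_bell m (\<lambda>j. of_real (\<kappa> j) * mat_trace (A ^\<^sub>m j)) / fact m
        = (\<Sum>\<pi>\<in>int_partitions m. part_prod (\<lambda>j. complex_of_real (\<kappa> j * power_sum j (eigvals A))) \<pi> / of_nat (y_part \<pi>))"
      unfolding complete_bell_eq_partition_sum hermitian_trace_power[OF A] of_real_mult ..
    also have "\<dots> = complex_of_real (herm_norm P X d A ^ m)"
      by (simp only: sum of_real_sum of_real_divide of_real_of_nat_eq of_real_part_prod) (simp only: part_prod_def)
    finally show "complex_of_real (herm_norm P X d A ^ m) =
        complete_bell m (\<lambda>j. of_real (\<kappa> j) * mat_trace (A ^\<^sub>m j)) / fact m" by (rule sym)
  qed
  have schur: "schur_convex n (rv_vec_norm P X d)"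
    using gauge_schur_convex unfolding schur_convex_def by (simp add: rv_vec_norm_eq_gauge)
  have matrix_part: "(\<forall>\<pi>\<in>int_partitions m. \<forall>Z\<in>carrier_mat n n. T_part \<pi> Z \<in> \<real>) \<and>
      is_norm_on n UNIV (carrier_mat n n) (mat_norm (cumulant P (X 0)) m) \<and>
      (\<forall>A\<in>hermitian_mats n. mat_norm (cumulant P (X 0)) m A = herm_norm P X d A) \<and>
      trace_polynomial n (\<lambda>Z. of_real (mat_norm (cumulant P (X 0)) m Z ^ m)) \<and>
      positive_definite_on (carrier_mat n n) (0\<^sub>m n n)
        (\<lambda>Z. mat_norm (cumulant P (X 0)) m Z ^ m)"
    if m: "d = real m" "even m" for m
  proof (intro conjI ballI)
    fix \<pi> and Z :: "complex mat" assume "\<pi> \<in> int_partitions m" and Z: "Z \<in> carrier_mat n n"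
    then have "sum_list \<pi> = m" by (simp add: int_partitions_def)
    from T_part_eq_average[OF Z m(2) this] show "T_part \<pi> Z \<in> \<real>" by (metis Reals_of_real)
  next
    show matnorm: "is_norm_on n UNIV (carrier_mat n n) (mat_norm \<kappa> m)"
      by (rule mat_norm_is_norm[OF m])
    show "positive_definite_on (carrier_mat n n) (0\<^sub>m n n) (\<lambda>Z. mat_norm \<kappa> m Z ^ m)"
      unfolding positive_definite_on_def
    proof (intro ballI impI)
      fix Z :: "complex mat" assume "Z \<in> carrier_mat n n" "Z \<noteq> 0\<^sub>m n n"
      then have "0 < mat_norm \<kappa> m Z" using matnorm unfolding is_norm_on_def by (metis less_eq_real_def)
      then show "0 < mat_norm \<kappa> m Z ^ m" by (rule zero_less_power)
    qed
  next
    fix A assume A: "A \<in> hermitian_mats n"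
    show "mat_norm \<kappa> m A = herm_norm P X d A"
      unfolding herm_norm_eq[OF A] by (rule mat_norm_on_hermitian[OF m A])
  next
    show "trace_polynomial n (\<lambda>Z. of_real (mat_norm \<kappa> m Z ^ m))"
      by (rule mat_norm_trace_polynomial[OF m])
  qed
  show ?thesis
    by (rule conjI[OF norm], rule conjI,
        (rule allI, rule impI, elim conjE, rule conjI, rule ballI, rule mgf_part, assumption+,
          rule polynomial_part, assumption+)[1],
        rule conjI,
        (rule allI, rule impI, rule ballI, elim conjE, rule cumulant_part, assumption+)[1],
        rule conjI[OF schur], rule allI, rule impI, elim conjE, rule matrix_part, assumption+)
qed

end
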